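(* Let ${\bf P}=(\mathcal L,l_0,l_f,\Gamma,b,k,L,(Z_i)_{0\le i\le L},{\rm Stm}_P)$ be a generalized Turing machine. For each $i$, $0\le i\le L$, let $\delta_i:Y_i\rightrightarrows Z_i$ be a generalized multi-representation and let $\gamma_i:\Sigma^\omega\rightrightarrows Y_i$ be a multi-representation. Suppose: (1) for every statement $(i:=f(i_1,\ldots,i_n),l')$ in ${\bf P}$ the multi-function $f$ has a realization $g:Y_{i_1}\times\cdots\times Y_{i_n}\rightrightarrows Y_i$ via $(\delta_{i_1},\ldots,\delta_{i_n},\delta_i)$ that is $(\gamma_{i_1},\ldots,\gamma_{i_n},\gamma_i)$-computable, and (2) for every statement $({\rm if}\ f(i_1,\ldots,i_n)\ {\rm then}\ l',\ {\rm else}\ l'')$ in ${\bf P}$ the partial function $f$ has a realization $g:\subseteq Y_{i_1}\times\cdots\times Y_{i_n}\to\Sigma^*$ via $(\delta_{i_1},\ldots,\delta_{i_n},\mathrm{id}_* )$ that is $(\gamma_{i_1},\ldots,\gamma_{i_n},\mathrm{id}_* )$-computable. Let ${\bf M}=(\mathcal L,l_0,l_f,\Gamma,b,k,L,(Y_i)_{0\le i\le L},{\rm Stm}_M)$ be a generalized Turing machine obtained from ${\bf P}$ by replacing every function $f$ in an assignment or test by some such $g$ as in (1) and (2), respectively. Then (a) $f_M$ is $(\gamma_1,\ldots,\gamma_k,\gamma_0)$-computable, (b) $f_M$ realizes $f_P$ via $(\delta_1,\ldots,\delta_k,\delta_0)$, (c) $f_P$ is $(\delta_1\odot\gamma_1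,\ldots,\delta_k\odot\gamma_k,\delta_0\odot\gamma_0)$-computable.
   Context: **Multi-functions.** A multi-function $f:A\rightrightarrows B$ is a triple $(A,B,R_f)$ with $R_f\subseteq A\times B$; $f(a):=\{b\mid (a,b)\in R_f\}$, $\mathrm{dom}(f):=\{a\mid f(a)\ne\emptyset\}$, $\mathrm{range}(f):=\bigcup_{a\in A} f(a)$. If every $f(a)$ has at most one element, $f$ is a partial function, written $f:\subseteq A\to B$. For $\gamma:X\rightrightarrows Y$, $\delta:Y\rightrightarrows Z$ the relational composition $\delta\odot\gamma:X\rightrightarrows Z$ is: $z\in(\delta\odot\gamma)(x)$ iff there is $y$ with $y\in\gamma(x)$ and $z\in\delta(y)$. $\Sigma$ is a fixed finite alphabet with $0,1\in\Sigma$; $\Sigma^*$ is the set of finite words, $\Sigma^\omega$ the set of infinite sequences; $\mathrm{id}_*$ is the identity on $\Sigma^*$. A generalized multi-representation of $Z$ is a multi-function $\delta:Y\rightrightarrows Z$ ($Y$ any set) with $\mathrm{range}(\delta)=Z$; it is a multi-representation if $Y=\Sigma^\omega$. **Computability on $\Sigma^*,\Sigma^\omega$.** For $U_0,\ldots,U_n\in\{\Sigma^*,\Sigma^\omega\}$, a Type-2 machine of type $(U_1,\ldots,U_n\to U_0)$ is a multi-tape Turing machine with $n$ input tapes, finitely many work tapes and one one-way output tape. It computes $f:\subseteq U_1\times\cdots\times U_n\to U_0$ where: if $U_0=\Sigma^*$, $f(p)=w$ iff the machine on input $p$ halts with $w$ on the output tape; if $U_0=\Sigma^\omega$, $f(p)=q$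 iff it computes forever and writes $q\in\Sigma^\omega$ on the output tape. Functions so computed are Turing computable; a partial function is called computable if it has a Turing computable extension. **Realization and relative computability.** Let $f:X_1\times\cdots\times X_n\rightrightarrows X_0$, $g:V_1\times\cdots\times V_n\rightrightarrows V_0$ be multi-functions and let $\beta_i:X_i\rightrightarrows V_i$ be generalized multi-representations ($0\le i\le n$). Put $\beta(x):=\beta_1(x_1)\times\cdots\times\beta_n(x_n)$. Then $f$ realizes $g$ via $(\beta_1,\ldots,\beta_n,\beta_0)$ (is a realization of $g$ via them) iff for all $x,v$: if $v\in\beta(x)\cap\mathrm{dom}(g)$ then $f(x)\ne\emptyset$ and for all $x_0\in f(x)$, $g(v)\cap\beta_0(x_0)\ne\emptyset$. If all $X_i\in\{\Sigma^*,\Sigma^\omega\}$, then $g$ is called $(\beta_1,\ldots,\beta_n,\beta_0)$-computable iff it has a realization via $(\beta_1,\ldots,\beta_n,\beta_0)$ that is a computable partial function $f:\subseteq X_1\times\cdots\times X_n\to X_0$. **Generalized Turing machine (GTM).** A GTM is a tuple $(\mathcal L,l_0,l_f,\Gamma,b,k,L,(X_i)_{0\le i\le L},{\rm Stm})$ where $\mathcal L$ is a finite set (labels) with $l_0,l_f\in\mathcal L$ (initial, final label); $\Gamma$ is a finite set with $\Sigma\cap\Gamma=\emptyset$ and $b\in\Gamma$ (blank); $k,L\in\mathbb N$, $k\le L$ (tapes $0,\ldots,L$; input tapes $1,\ldots,k$; output tape $0$); each $X_i$ is a set with $X_i\cap\Gamma=\emptyset$; and ${\rm Stm}$ assigns to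 each $l\in\mathcal L\setminus\{l_f\}$ a statement of one of the forms (with $i,i_1,\ldots,i_n\in\{0,\ldots,L\}$, $l',l''\in\mathcal L$, $a\in\Gamma$): (a) $(i,{\rm right},l')$; (b) $(i,{\rm left},l')$; (c) $(i:=a,l')$; (d) $(i,{\rm if}\ a\ {\rm then}\ l',\ {\rm else}\ l'')$; (e) $(i:=f(i_1,\ldots,i_n),l')$ with $f:X_{i_1}\times\cdots\times X_{i_n}\rightrightarrows X_i$; (f) $({\rm if}\ f(i_1,\ldots,i_n)\ {\rm then}\ l',\ {\rm else}\ l'')$ with $f:\subseteq X_{i_1}\times\cdots\times X_{i_n}\to\Sigma^*$, $\mathrm{range}(f)\subseteq\{0,1\}$. **Semantics.** A configuration is $\kappa=(l,(\alpha_0,m_0),\ldots,(\alpha_L,m_L))$ with $l\in\mathcal L$, $\alpha_i:\mathbb Z\to X_i\cup\Gamma$ (tape inscription), $m_i\in\mathbb Z$ (head position). Let $x_j:=\alpha_j(m_j)$. The successor relation $\kappa\vdash\kappa'$ is determined by ${\rm Stm}(l)$ (no successor if $l=l_f$): in case (a)/(b), $\kappa'$ is $\kappa$ with $m_i$ replaced by $m_i+1$ / $m_i-1$ and label $l'$; (c) $\alpha_i(m_i)$ is replaced by $a$, label $l'$; (d) label $l'$ if $x_i=a$, label $l''$ if $x_i\ne a$; (e) $\alpha_i(m_i)$ is replaced by some $x\in f(x_{i_1},\ldots,x_{i_n})$, label $l'$ (no successor if there is no such $x$, in particular if some $x_{i_j}\notin X_{i_j}$); (f) label $l'$ if $f(x_{i_1},\ldots,x_{i_n})=0$,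 label $l''$ if $f(x_{i_1},\ldots,x_{i_n})=1$ (no successor otherwise). A computation is a finite or infinite sequence of configurations, each the $\vdash$-predecessor of the next; it is maximal if it is infinite or its last configuration has no successor. A configuration is accepting if $l=l_f$ and $\alpha_0(0)\in X_0$; an accepting computation is a finite computation whose last configuration is accepting. The initial configuration ${\rm IC}(x_1,\ldots,x_k)$ has label $l_0$, all heads at position $0$, $\alpha_i(0)=x_i$ for $1\le i\le k$, and $b$ in all other cells. The multi-function $f_M:X_1\times\cdots\times X_k\rightrightarrows X_0$ computed by a GTM ${\bf M}$: $x_0\in f_M(x_1,\ldots,x_k)$ iff every maximal computation starting with ${\rm IC}(x_1,\ldots,x_k)$ is accepting and there is an accepting computation starting with it whose last configuration has $\alpha_0(0)=x_0$. Likewise for $f_P$. *)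

theory Defs
  imports Main
begin

section \<open>Words and infinite sequences\<close>

text \<open>
  The alphabet is an arbitrary finite type with two distinguished distinct elements
  \<open>0\<close> and \<open>1\<close>, i.e. a type variable of sort \<open>{finite, zero_neq_one}\<close>.
  Words and infinite sequences live in one type, so that tuples mixing both are lists.
\<close>

datatype 's elem = Word "'s list" | Seq "nat \<Rightarrow> 's"

definition sigma_star :: "'s elem set" where
  "sigma_star = range Word"

definition sigma_omega :: "'s elem set" where
  "sigma_omega = range Seq"


section \<open>Multi-functions\<close>

text \<open>
  A multi-function from \<open>A\<close> to \<open>B\<close> is a set-valued function with values included in
  \<open>B\<close> and empty outside \<open>A\<close>. The product of sets \<open>A\<^sub>1, \<dots>, A\<^sub>n\<close> is
  \<open>listset [A\<^sub>1, \<dots>, A\<^sub>n]\<close>, so a multi-function of \<open>n\<close> arguments takes a list of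
  length \<open>n\<close>; \<open>n = 0\<close> is allowed.
\<close>

definition multifun :: "'a set \<Rightarrow> 'b set \<Rightarrow> ('a \<Rightarrow> 'b set) \<Rightarrow> bool" where
  "multifun A B f \<longleftrightarrow> (\<forall>a\<in>A. f a \<subseteq> B) \<and> (\<forall>a. a \<notin> A \<longrightarrow> f a = {})"

definition partial_fun :: "'a set \<Rightarrow> 'b set \<Rightarrow> ('a \<Rightarrow> 'b set) \<Rightarrow> bool" where
  "partial_fun A B f \<longleftrightarrow> multifun A B f \<and> (\<forall>a. \<forall>x\<in>f a. \<forall>y\<in>f a. x = y)"

definition rel_comp :: "('b \<Rightarrow> 'c set) \<Rightarrow> ('a \<Rightarrow> 'b set) \<Rightarrow> 'a \<Rightarrow> 'c set"
    (infixr "\<odot>" 55) where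
  "(\<delta> \<odot> \<gamma>) x = {z. \<exists>y. y \<in> \<gamma> x \<and> z \<in> \<delta> y}"

definition id_star :: "'s elem \<Rightarrow> 's elem set" where
  "id_star w = (if w \<in> sigma_star then {w} else {})"

definition gen_multirep :: "'y set \<Rightarrow> 'z set \<Rightarrow> ('y \<Rightarrow> 'z set) \<Rightarrow> bool" where
  "gen_multirep Y Z \<delta> \<longleftrightarrow> multifun Y Z \<delta> \<and> (\<Union>y\<in>Y. \<delta> y) = Z"

definition multirep :: "'z set \<Rightarrow> ('s elem \<Rightarrow> 'z set) \<Rightarrow> bool" where
  "multirep Z \<delta> \<longleftrightarrow> gen_multirep sigma_omega Z \<delta>"


section \<open>Type-2 machines\<close>

datatype 's sym = Blank | Letter 's | Mark nat

datatype move = MoveLeft | Stay | MoveRight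

fun shift :: "move \<Rightarrow> int" where
  "shift MoveLeft = -1"
| "shift Stay = 0"
| "shift MoveRight = 1"

text \<open>
  The transition function takes a state and the lists of symbols scanned on the input tapes
  and on the work tapes; it yields the next state, the moves of the (read-only) input heads, the
  symbols written and the moves on the work tapes, and optionally a letter to be
  appended to the one-way output tape. The type \<open>'s sym\<close> is a supply of symbols; each
  machine uses a finite part of it.
\<close>

record 's t2_machine =
  t2_states :: "nat set"
  t2_start :: nat
  t2_halt :: nat
  t2_works :: nat
  t2_syms :: "'s sym set"
  t2_trans :: "nat \<Rightarrow> 's sym list \<Rightarrow> 's sym list
     \<Rightarrow> nat \<times> move list \<times> ('s sym \<times> move) list \<times> 's option"

definition wf_t2 :: "nat \<Rightarrow> 's t2_machine \<Rightarrow> bool" where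
  "wf_t2 n M \<longleftrightarrow>
     finite (t2_states M) \<and> t2_start M \<in> t2_states M \<and> t2_halt M \<in> t2_states M \<and>
     finite (t2_syms M) \<and> insert Blank (range Letter) \<subseteq> t2_syms M \<and>
     (\<forall>q ins wks q' mvs acts out.
        q \<in> t2_states M \<and> q \<noteq> t2_halt M \<and>
        length ins = n \<and> set ins \<subseteq> insert Blank (range Letter) \<and>
        length wks = t2_works M \<and> set wks \<subseteq> t2_syms M \<and>
        t2_trans M q ins wks = (q', mvs, acts, out)
        \<longrightarrow> q' \<in> t2_states M \<and> length mvs = n \<and>
            length acts = t2_works M \<and> fst ` set acts \<subseteq> t2_syms M)"

record 's t2_config =
  c_state :: nat
  c_heads :: "int list"
  c_works :: "((int \<Rightarrow> 's sym) \<times> int) list"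
  c_out :: "'s list"

fun input_tape :: "'s elem \<Rightarrow> int \<Rightarrow> 's sym" where
  "input_tape (Word w) j = (if 0 \<le> j \<and> nat j < length w then Letter (w ! nat j) else Blank)"
| "input_tape (Seq p) j = (if 0 \<le> j then Letter (p (nat j)) else Blank)"

definition t2_init :: "'s t2_machine \<Rightarrow> nat \<Rightarrow> 's t2_config" where
  "t2_init M n = \<lparr>c_state = t2_start M, c_heads = replicate n 0,
     c_works = replicate (t2_works M) (\<lambda>_. Blank, 0), c_out = []\<rparr>"

definition t2_step :: "'s t2_machine \<Rightarrow> 's elem list \<Rightarrow> 's t2_config \<Rightarrow> 's t2_config" where
  "t2_step M ps c =
     (if c_state c = t2_halt M then c
      else case t2_trans M (c_state c) (map2 input_tape ps (c_heads c))
                  (map (\<lambda>(t, h). t h) (c_works c)) of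
        (q, mvs, acts, out) \<Rightarrow>
          \<lparr>c_state = q,
           c_heads = map2 (\<lambda>h m. h + shift m) (c_heads c) mvs,
           c_works = map2 (\<lambda>(t, h) (a, m). (t(h := a), h + shift m)) (c_works c) acts,
           c_out = c_out c @ (case out of None \<Rightarrow> [] | Some a \<Rightarrow> [a])\<rparr>)"

definition t2_run :: "'s t2_machine \<Rightarrow> 's elem list \<Rightarrow> nat \<Rightarrow> 's t2_config" where
  "t2_run M ps t = (t2_step M ps ^^ t) (t2_init M (length ps))"

text \<open>
  The results of the machine for both possible output types; fixing the output type \<open>U0\<close>
  amounts to intersecting with \<open>U0\<close>.
\<close>

definition t2_result :: "'s t2_machine \<Rightarrow> 's elem list \<Rightarrow> 's elem set" where
  "t2_result M ps =
     {Word w | w. \<exists>t. c_state (t2_run M ps t) = t2_halt M \<and> c_out (t2_run M ps t) = w} \<union>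
     {Seq q | q. (\<forall>t. c_state (t2_run M ps t) \<noteq> t2_halt M) \<and>
                 (\<forall>n. \<exists>t. c_out (t2_run M ps t) = map q [0..<n])}"

definition turing_computable ::
    "'s elem set list \<Rightarrow> 's elem set \<Rightarrow> ('s elem list \<Rightarrow> 's elem set) \<Rightarrow> bool" where
  "turing_computable Us U0 f \<longleftrightarrow>
     set Us \<subseteq> {sigma_star, sigma_omega} \<and> U0 \<in> {sigma_star, sigma_omega} \<and>
     partial_fun (listset Us) U0 f \<and>
     (\<exists>M. wf_t2 (length Us) M \<and> (\<forall>ps\<in>listset Us. f ps = t2_result M ps \<inter> U0))"

definition computable ::
    "'s elem set list \<Rightarrow> 's elem set \<Rightarrow> ('s elem list \<Rightarrow> 's elem set) \<Rightarrow> bool" where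
  "computable Us U0 f \<longleftrightarrow>
     partial_fun (listset Us) U0 f \<and>
     (\<exists>F. turing_computable Us U0 F \<and> (\<forall>ps. f ps \<subseteq> F ps))"


section \<open>Realization and relative computability\<close>

definition prod_rep :: "('x \<Rightarrow> 'v set) list \<Rightarrow> 'x list \<Rightarrow> 'v list set" where
  "prod_rep \<beta>s xs =
     (if length xs = length \<beta>s then listset (map2 (\<lambda>\<beta> x. \<beta> x) \<beta>s xs) else {})"

text \<open>\<open>realizes \<beta>s \<beta>0 f g\<close>: the multi-function \<open>f\<close> realizes \<open>g\<close> via \<open>(\<beta>s, \<beta>0)\<close>.\<close>

definition realizes ::
    "('x \<Rightarrow> 'v set) list \<Rightarrow> ('x0 \<Rightarrow> 'v0 set) \<Rightarrow>
     ('x list \<Rightarrow> 'x0 set) \<Rightarrow> ('v list \<Rightarrow> 'v0 set) \<Rightarrow> bool" where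
  "realizes \<beta>s \<beta>0 f g \<longleftrightarrow>
     (\<forall>xs vs. vs \<in> prod_rep \<beta>s xs \<and> g vs \<noteq> {} \<longrightarrow>
        f xs \<noteq> {} \<and> (\<forall>x0\<in>f xs. g vs \<inter> \<beta>0 x0 \<noteq> {}))"

text \<open>
  \<open>Us\<close> and \<open>U0\<close> are the domains (\<open>\<Sigma>\<^sup>*\<close> or \<open>\<Sigma>\<^sup>\<omega>\<close>) of the
  multi-representations \<open>\<beta>s\<close> and \<open>\<beta>0\<close>.
\<close>

definition rep_computable ::
    "'s elem set list \<Rightarrow> 's elem set \<Rightarrow> ('s elem \<Rightarrow> 'v set) list \<Rightarrow> ('s elem \<Rightarrow> 'v0 set) \<Rightarrow>
     ('v list \<Rightarrow> 'v0 set) \<Rightarrow> bool" where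
  "rep_computable Us U0 \<beta>s \<beta>0 g \<longleftrightarrow>
     length Us = length \<beta>s \<and> (\<exists>f. computable Us U0 f \<and> realizes \<beta>s \<beta>0 f g)"


section \<open>Generalized Turing machines\<close>

text \<open>
  All the sets \<open>X\<^sub>i\<close> are subsets of one type \<open>'x\<close>. A cell holds an element of some
  \<open>X\<^sub>i\<close> or a symbol of \<open>\<Gamma>\<close>; the datatype makes these two kinds of contents
  (and \<open>\<Sigma>\<close> and \<open>\<Gamma>\<close>) disjoint.
\<close>

datatype ('x, 'g) cell = Val 'x | Sym 'g

datatype ('l, 'g, 'x, 's) stmt =
    GoRight nat 'l
  | GoLeft nat 'l
  | Write nat 'g 'l
  | IfSym nat 'g 'l 'l
  | Assign nat "'x list \<Rightarrow> 'x set" "nat list" 'l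
  | Test "'x list \<Rightarrow> 's elem set" "nat list" 'l 'l

record ('l, 'g, 'x, 's) gtm =
  labels :: "'l set"
  init_label :: 'l
  final_label :: 'l
  gamma :: "'g set"
  blank :: 'g
  num_inputs :: nat
  last_tape :: nat
  carr :: "nat \<Rightarrow> 'x set"
  stm :: "'l \<Rightarrow> ('l, 'g, 'x, 's) stmt"

fun wf_stmt :: "('l, 'g, 'x, 's::{finite, zero_neq_one}) gtm \<Rightarrow>
    ('l, 'g, 'x, 's) stmt \<Rightarrow> bool" where
  "wf_stmt M (GoRight i l) \<longleftrightarrow> i \<le> last_tape M \<and> l \<in> labels M"
| "wf_stmt M (GoLeft i l) \<longleftrightarrow> i \<le> last_tape M \<and> l \<in> labels M"
| "wf_stmt M (Write i a l) \<longleftrightarrow> i \<le> last_tape M \<and> a \<in> gamma M \<and> l \<in> labels M"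
| "wf_stmt M (IfSym i a l l') \<longleftrightarrow>
     i \<le> last_tape M \<and> a \<in> gamma M \<and> l \<in> labels M \<and> l' \<in> labels M"
| "wf_stmt M (Assign i f js l) \<longleftrightarrow>
     i \<le> last_tape M \<and> set js \<subseteq> {..last_tape M} \<and> l \<in> labels M \<and>
     multifun (listset (map (carr M) js)) (carr M i) f"
| "wf_stmt M (Test f js l l') \<longleftrightarrow>
     set js \<subseteq> {..last_tape M} \<and> l \<in> labels M \<and> l' \<in> labels M \<and>
     partial_fun (listset (map (carr M) js)) sigma_star f \<and>
     (\<Union>xs. f xs) \<subseteq> {Word [0], Word [1]}"

definition wf_gtm :: "('l, 'g, 'x, 's::{finite, zero_neq_one}) gtm \<Rightarrow> bool" where
  "wf_gtm M \<longleftrightarrow>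
     finite (labels M) \<and> init_label M \<in> labels M \<and> final_label M \<in> labels M \<and>
     finite (gamma M) \<and> blank M \<in> gamma M \<and> num_inputs M \<le> last_tape M \<and>
     (\<forall>l \<in> labels M - {final_label M}. wf_stmt M (stm M l))"

text \<open>
  Tape inscriptions and head positions are indexed by all natural numbers; the tapes beyond
  \<open>last_tape\<close> are initially blank and never touched.
\<close>

record ('l, 'g, 'x) config =
  lab :: 'l
  tape :: "nat \<Rightarrow> int \<Rightarrow> ('x, 'g) cell"
  pos :: "nat \<Rightarrow> int"

definition scanned :: "('l, 'g, 'x) config \<Rightarrow> nat \<Rightarrow> ('x, 'g) cell" where
  "scanned \<kappa> i = tape \<kappa> i (pos \<kappa> i)"

definition write_cell :: "nat \<Rightarrow> ('x, 'g) cell \<Rightarrow> ('l, 'g, 'x) config \<Rightarrow> ('l, 'g, 'x) config" where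
  "write_cell i c \<kappa> = \<kappa>\<lparr>tape := (tape \<kappa>)(i := (tape \<kappa> i)(pos \<kappa> i := c))\<rparr>"

inductive succ :: "('l, 'g, 'x, 's::{finite, zero_neq_one}) gtm \<Rightarrow>
    ('l, 'g, 'x) config \<Rightarrow> ('l, 'g, 'x) config \<Rightarrow> bool" for M where
  go_right: "\<lbrakk>lab \<kappa> \<noteq> final_label M; stm M (lab \<kappa>) = GoRight i l\<rbrakk> \<Longrightarrow>
     succ M \<kappa> (\<kappa>\<lparr>lab := l, pos := (pos \<kappa>)(i := pos \<kappa> i + 1)\<rparr>)"
| go_left: "\<lbrakk>lab \<kappa> \<noteq> final_label M; stm M (lab \<kappa>) = GoLeft i l\<rbrakk> \<Longrightarrow>
     succ M \<kappa> (\<kappa>\<lparr>lab := l, pos := (pos \<kappa>)(i := pos \<kappa> i - 1)\<rparr>)"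
| write_sym: "\<lbrakk>lab \<kappa> \<noteq> final_label M; stm M (lab \<kappa>) = Write i a l\<rbrakk> \<Longrightarrow>
     succ M \<kappa> ((write_cell i (Sym a) \<kappa>)\<lparr>lab := l\<rparr>)"
| if_sym: "\<lbrakk>lab \<kappa> \<noteq> final_label M; stm M (lab \<kappa>) = IfSym i a l l'\<rbrakk> \<Longrightarrow>
     succ M \<kappa> (\<kappa>\<lparr>lab := (if scanned \<kappa> i = Sym a then l else l')\<rparr>)"
| assignment: "\<lbrakk>lab \<kappa> \<noteq> final_label M; stm M (lab \<kappa>) = Assign i f js l;
     map (scanned \<kappa>) js = map Val xs; x \<in> f xs\<rbrakk> \<Longrightarrow>
     succ M \<kappa> ((write_cell i (Val x) \<kappa>)\<lparr>lab := l\<rparr>)"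
| test_0: "\<lbrakk>lab \<kappa> \<noteq> final_label M; stm M (lab \<kappa>) = Test f js l l';
     map (scanned \<kappa>) js = map Val xs; Word [0] \<in> f xs\<rbrakk> \<Longrightarrow>
     succ M \<kappa> (\<kappa>\<lparr>lab := l\<rparr>)"
| test_1: "\<lbrakk>lab \<kappa> \<noteq> final_label M; stm M (lab \<kappa>) = Test f js l l';
     map (scanned \<kappa>) js = map Val xs; Word [1] \<in> f xs\<rbrakk> \<Longrightarrow>
     succ M \<kappa> (\<kappa>\<lparr>lab := l'\<rparr>)"

definition init_config :: "('l, 'g, 'x, 's) gtm \<Rightarrow> 'x list \<Rightarrow> ('l, 'g, 'x) config" where
  "init_config M xs =
     \<lparr>lab = init_label M,
      tape = (\<lambda>i m. if m = 0 \<and> 1 \<le> i \<and> i \<le> num_inputs M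
                    then Val (xs ! (i - 1)) else Sym (blank M)),
      pos = (\<lambda>_. 0)\<rparr>"

definition accepting :: "('l, 'g, 'x, 's) gtm \<Rightarrow> ('l, 'g, 'x) config \<Rightarrow> bool" where
  "accepting M \<kappa> \<longleftrightarrow> lab \<kappa> = final_label M \<and> (\<exists>x\<in>carr M 0. tape \<kappa> 0 0 = Val x)"

definition finite_computation :: "('l, 'g, 'x, 's::{finite, zero_neq_one}) gtm \<Rightarrow>
    ('l, 'g, 'x) config list \<Rightarrow> bool" where
  "finite_computation M \<kappa>s \<longleftrightarrow>
     \<kappa>s \<noteq> [] \<and> (\<forall>j. Suc j < length \<kappa>s \<longrightarrow> succ M (\<kappa>s ! j) (\<kappa>s ! Suc j))"

definition infinite_computation :: "('l, 'g, 'x, 's::{finite, zero_neq_one}) gtm \<Rightarrow>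
    (nat \<Rightarrow> ('l, 'g, 'x) config) \<Rightarrow> bool" where
  "infinite_computation M \<kappa>s \<longleftrightarrow> (\<forall>j. succ M (\<kappa>s j) (\<kappa>s (Suc j)))"

text \<open>
  Every infinite computation is maximal and none is accepting; hence all maximal
  computations from \<open>\<kappa>\<close> accept iff there is no infinite one and every finite one whose
  last configuration has no successor ends in an accepting configuration.
\<close>

definition all_maximal_accepting :: "('l, 'g, 'x, 's::{finite, zero_neq_one}) gtm \<Rightarrow>
    ('l, 'g, 'x) config \<Rightarrow> bool" where
  "all_maximal_accepting M \<kappa> \<longleftrightarrow>
     \<not> (\<exists>\<kappa>s. infinite_computation M \<kappa>s \<and> \<kappa>s 0 = \<kappa>) \<and>
     (\<forall>\<kappa>s. finite_computation M \<kappa>s \<and> hd \<kappa>s = \<kappa> \<and> \<not> (\<exists>\<kappa>'. succ M (last \<kappa>s) \<kappa>')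
        \<longrightarrow> accepting M (last \<kappa>s))"

definition gtm_fun :: "('l, 'g, 'x, 's::{finite, zero_neq_one}) gtm \<Rightarrow> 'x list \<Rightarrow> 'x set" where
  "gtm_fun M xs =
     (if xs \<in> listset (map (carr M) [1..<Suc (num_inputs M)])
      then {x0. all_maximal_accepting M (init_config M xs) \<and>
                (\<exists>\<kappa>s. finite_computation M \<kappa>s \<and> hd \<kappa>s = init_config M xs \<and>
                      accepting M (last \<kappa>s) \<and> tape (last \<kappa>s) 0 0 = Val x0)}
      else {})"


section \<open>Replacing the functions of a machine by realizations\<close>

text \<open>
  \<open>g\<close> is an admissible replacement of \<open>f\<close> in an assignment \<open>i := f(js)\<close>,
  respectively in a test on \<open>f(js)\<close>.
\<close>

definition assign_realization :: "(nat \<Rightarrow> 'y set) \<Rightarrow> (nat \<Rightarrow> 's elem \<Rightarrow> 'y set) \<Rightarrow>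
    (nat \<Rightarrow> 'y \<Rightarrow> 'z set) \<Rightarrow> nat \<Rightarrow> nat list \<Rightarrow>
    ('z list \<Rightarrow> 'z set) \<Rightarrow> ('y list \<Rightarrow> 'y set) \<Rightarrow> bool" where
  "assign_realization Y \<gamma> \<delta> i js f g \<longleftrightarrow>
     multifun (listset (map Y js)) (Y i) g \<and>
     realizes (map \<delta> js) (\<delta> i) g f \<and>
     rep_computable (map (\<lambda>_. sigma_omega) js) sigma_omega (map \<gamma> js) (\<gamma> i) g"

definition test_realization :: "(nat \<Rightarrow> 'y set) \<Rightarrow> (nat \<Rightarrow> 's elem \<Rightarrow> 'y set) \<Rightarrow>
    (nat \<Rightarrow> 'y \<Rightarrow> 'z set) \<Rightarrow> nat list \<Rightarrow>
    ('z list \<Rightarrow> 's elem set) \<Rightarrow> ('y list \<Rightarrow> 's elem set) \<Rightarrow> bool" where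
  "test_realization Y \<gamma> \<delta> js f g \<longleftrightarrow>
     partial_fun (listset (map Y js)) sigma_star g \<and>
     realizes (map \<delta> js) id_star g f \<and>
     rep_computable (map (\<lambda>_. sigma_omega) js) sigma_star (map \<gamma> js) id_star g"

inductive stmt_replacement :: "(nat \<Rightarrow> 'y set) \<Rightarrow> (nat \<Rightarrow> 's elem \<Rightarrow> 'y set) \<Rightarrow>
    (nat \<Rightarrow> 'y \<Rightarrow> 'z set) \<Rightarrow> ('l, 'g, 'z, 's) stmt \<Rightarrow> ('l, 'g, 'y, 's) stmt \<Rightarrow> bool"
    for Y \<gamma> \<delta> where
  "stmt_replacement Y \<gamma> \<delta> (GoRight i l) (GoRight i l)"
| "stmt_replacement Y \<gamma> \<delta> (GoLeft i l) (GoLeft i l)"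
| "stmt_replacement Y \<gamma> \<delta> (Write i a l) (Write i a l)"
| "stmt_replacement Y \<gamma> \<delta> (IfSym i a l l') (IfSym i a l l')"
| "assign_realization Y \<gamma> \<delta> i js f g \<Longrightarrow>
     stmt_replacement Y \<gamma> \<delta> (Assign i f js l) (Assign i g js l)"
| "test_realization Y \<gamma> \<delta> js f g \<Longrightarrow>
     stmt_replacement Y \<gamma> \<delta> (Test f js l l') (Test g js l l')"

definition gtm_replacement :: "(nat \<Rightarrow> 's elem \<Rightarrow> 'y set) \<Rightarrow> (nat \<Rightarrow> 'y \<Rightarrow> 'z set) \<Rightarrow>
    ('l, 'g, 'z, 's) gtm \<Rightarrow> ('l, 'g, 'y, 's) gtm \<Rightarrow> bool" where
  "gtm_replacement \<gamma> \<delta> P M \<longleftrightarrow>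
     labels M = labels P \<and> init_label M = init_label P \<and> final_label M = final_label P \<and>
     gamma M = gamma P \<and> blank M = blank P \<and>
     num_inputs M = num_inputs P \<and> last_tape M = last_tape P \<and>
     (\<forall>l \<in> labels P - {final_label P}. stmt_replacement (carr M) \<gamma> \<delta> (stm P l) (stm M l))"

end

theory Submission
  imports Defs "HOL-Library.Countable" "HOL-Library.Nat_Bijection"
begin

text \<open>
  Part (b) is a simulation argument. A configuration of \<open>M\<close> represents one of \<open>P\<close> if labels
  and head positions agree and corresponding cells hold the same symbol or a value and one of its
  \<open>\<delta>\<close>-names. Where \<open>P\<close> can make a step, \<open>M\<close> can make one too, and every step of \<open>M\<close>
  leads to a configuration that represents a possible successor in \<open>P\<close>
  (\<open>succ_realizes\<close>). Induction over the computation tree of \<open>P\<close>, which is well-founded if all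
  maximal computations accept, gives the claim (\<open>gtm_fun_realizes\<close>). Part (c) follows from (a)
  and (b) since realizations compose (\<open>realizes_comp\<close>).

  For part (a), let \<open>D\<close> be obtained from \<open>M\<close> by replacing every function \<open>g\<close> by the
  partial function on sequences that some Type-2 machine computes and that realizes \<open>g\<close> via
  \<open>\<gamma>\<close>. The simulation argument of part (b), now applied to \<open>D\<close> and \<open>M\<close>, shows that the
  function of \<open>D\<close> realizes the function of \<open>M\<close>. It remains to compute the function of \<open>D\<close> by
  a single Type-2 machine (\<open>gtm_fun_computable\<close>).

  A cell of \<open>D\<close> holds an infinite sequence, of which only a finite prefix can be known at any
  time. Hence the computation of \<open>D\<close> is repeated in stages. Stage \<open>N\<close> starts from the first
  \<open>N + 1\<close> letters of the inputs and simulates \<open>N\<close> steps of \<open>D\<close> on words: each machine that is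
  called runs for as many steps as \<open>N\<close> and the lengths of its argument words permit. During that
  time its heads cannot pass the ends of the argument words, so that its output is a prefix of the
  true result; a test that has not halted by then ends the stage. If the
  final label is reached, then the word in the output cell is a prefix of the true result.
  For the finite accepting computation of \<open>D\<close> all these prefixes become arbitrarily long as \<open>N\<close>
  grows (\<open>gtm_computable\<close>), so every letter of the result is eventually found.

  The word produced at stage \<open>N\<close> is a primitive recursive function of \<open>N\<close> and the letters
  read. A Type-2 machine evaluates such functions in two steps: primitive recursive functions,
  coded with a pairing function, are translated to structured programs over counters
  (\<open>runs_prim_com\<close>), and a counter is a work tape with a mark at position \<open>0\<close>
  (\<open>t2_run_com_machine\<close>). The program that reads a letter of each input, evaluates the stage
  and emits at most one new letter runs forever (\<open>transducer_computes\<close>).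
\<close>

section \<open>Realization of generalized Turing machines\<close>

lemma in_listset_iff: "xs \<in> listset As \<longleftrightarrow> list_all2 (\<lambda>x A. x \<in> A) xs As"
  by (induction As arbitrary: xs) (auto simp: set_Cons_def list_all2_Cons2)

lemma in_prod_rep_iff: "vs \<in> prod_rep \<beta>s xs \<longleftrightarrow>
    length xs = length \<beta>s \<and> length vs = length \<beta>s \<and> (\<forall>i<length \<beta>s. vs ! i \<in> (\<beta>s ! i) (xs ! i))"
  by (auto simp: prod_rep_def in_listset_iff list_all2_conv_all_nth)

text \<open>
  The condition \<open>all_maximal_accepting\<close> speaks of infinite sequences. The well-founded part of
  the computation tree expresses the same condition in a form that admits induction.
\<close>

inductive halts_accepting :: "('l, 'g, 'x, 's::{finite, zero_neq_one}) gtm \<Rightarrow>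
    ('l, 'g, 'x) config \<Rightarrow> bool" for M where
  "\<lbrakk>\<And>\<kappa>'. succ M \<kappa> \<kappa>' \<Longrightarrow> halts_accepting M \<kappa>';
    \<not> (\<exists>\<kappa>'. succ M \<kappa> \<kappa>') \<Longrightarrow> accepting M \<kappa>\<rbrakk> \<Longrightarrow> halts_accepting M \<kappa>"

lemma finite_computation_Cons:
  "finite_computation M (\<kappa> # \<kappa>s) \<longleftrightarrow> \<kappa>s = [] \<or> succ M \<kappa> (hd \<kappa>s) \<and> finite_computation M \<kappa>s"
proof (cases \<kappa>s)
  case (Cons \<kappa>' \<kappa>s')
  then show ?thesis
    unfolding finite_computation_def
    by (auto simp: nth_Cons split: nat.splits)
qed (simp add: finite_computation_def)

lemma reachable_iff_finite_computation:
  "(succ M)\<^sup>*\<^sup>* \<kappa> \<kappa>' \<longleftrightarrow> (\<exists>\<kappa>s. finite_computation M \<kappa>s \<and> hd \<kappa>s = \<kappa> \<and> last \<kappa>s = \<kappa>')"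
proof
  assume "(succ M)\<^sup>*\<^sup>* \<kappa> \<kappa>'"
  then show "\<exists>\<kappa>s. finite_computation M \<kappa>s \<and> hd \<kappa>s = \<kappa> \<and> last \<kappa>s = \<kappa>'"
  proof (induction rule: converse_rtranclp_induct)
    case base
    show ?case by (rule exI[of _ "[\<kappa>']"]) (simp add: finite_computation_def)
  next
    case (step \<kappa> \<kappa>1)
    then obtain \<kappa>s where "finite_computation M \<kappa>s" "hd \<kappa>s = \<kappa>1" "last \<kappa>s = \<kappa>'" by blast
    moreover from this have "\<kappa>s \<noteq> []" by (simp add: finite_computation_def)
    ultimately show ?case
      using step.hyps(1) by (intro exI[of _ "\<kappa> # \<kappa>s"]) (simp add: finite_computation_Cons)
  qed
next
  assume "\<exists>\<kappa>s. finite_computation M \<kappa>s \<and> hd \<kappa>s = \<kappa> \<and> last \<kappa>s = \<kappa>'"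
  then obtain \<kappa>s where "finite_computation M \<kappa>s" "hd \<kappa>s = \<kappa>" "last \<kappa>s = \<kappa>'" by blast
  then show "(succ M)\<^sup>*\<^sup>* \<kappa> \<kappa>'"
  proof (induction \<kappa>s arbitrary: \<kappa>)
    case Nil
    then show ?case by (simp add: finite_computation_def)
  next
    case (Cons \<kappa>1 \<kappa>s)
    then show ?case
      by (auto simp: finite_computation_Cons split: if_splits intro: converse_rtranclp_into_rtranclp)
  qed
qed

lemma all_maximal_accepting_iff: "all_maximal_accepting M \<kappa> \<longleftrightarrow> halts_accepting M \<kappa>"
proof
  assume all: "all_maximal_accepting M \<kappa>"
  show "halts_accepting M \<kappa>"
  proof (rule ccontr)
    assume bad: "\<not> halts_accepting M \<kappa>"
    define B where "B = {\<kappa>'. (succ M)\<^sup>*\<^sup>* \<kappa> \<kappa>' \<and> \<not> halts_accepting M \<kappa>'}"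
    have "\<exists>\<kappa>''. succ M \<kappa>' \<kappa>'' \<and> \<kappa>'' \<in> B" if "\<kappa>' \<in> B" for \<kappa>'
    proof (rule ccontr)
      assume no: "\<not> ?thesis"
      have reach: "(succ M)\<^sup>*\<^sup>* \<kappa> \<kappa>'" and nh: "\<not> halts_accepting M \<kappa>'"
        using that by (auto simp: B_def)
      have "halts_accepting M \<kappa>''" if "succ M \<kappa>' \<kappa>''" for \<kappa>''
        using no that reach by (auto simp: B_def intro: rtranclp.rtrancl_into_rtrancl)
      moreover have "accepting M \<kappa>'" if "\<not> (\<exists>\<kappa>''. succ M \<kappa>' \<kappa>'')"
        using all that reach unfolding all_maximal_accepting_def reachable_iff_finite_computation
        by blast
      ultimately show False using nh halts_accepting.intros by blast
    qed
    then obtain s where s: "\<And>\<kappa>'. \<kappa>' \<in> B \<Longrightarrow> succ M \<kappa>' (s \<kappa>') \<and> s \<kappa>' \<in> B" by metis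
    have "(s ^^ n) \<kappa> \<in> B" for n
      by (induction n) (use bad s in \<open>auto simp: B_def\<close>)
    then have "infinite_computation M (\<lambda>n. (s ^^ n) \<kappa>)"
      using s by (simp add: infinite_computation_def)
    moreover have "(s ^^ 0) \<kappa> = \<kappa>" by simp
    ultimately show False using all unfolding all_maximal_accepting_def by blast
  qed
next
  assume "halts_accepting M \<kappa>"
  then have "\<not> (\<exists>\<kappa>s. infinite_computation M \<kappa>s \<and> \<kappa>s 0 = \<kappa>) \<and>
     (\<forall>\<kappa>'. (succ M)\<^sup>*\<^sup>* \<kappa> \<kappa>' \<and> \<not> (\<exists>\<kappa>''. succ M \<kappa>' \<kappa>'') \<longrightarrow> accepting M \<kappa>')"
  proof (induction rule: halts_accepting.induct)
    case (1 \<kappa>)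
    have "\<not> (infinite_computation M \<kappa>s \<and> \<kappa>s 0 = \<kappa>)" for \<kappa>s
    proof
      assume inf: "infinite_computation M \<kappa>s \<and> \<kappa>s 0 = \<kappa>"
      then have "succ M \<kappa> (\<kappa>s 1)" unfolding infinite_computation_def by (metis One_nat_def)
      moreover have "infinite_computation M (\<lambda>j. \<kappa>s (Suc j))" "\<kappa>s (Suc 0) = \<kappa>s 1"
        using inf by (auto simp: infinite_computation_def)
      ultimately show False using 1 by blast
    qed
    moreover have "accepting M \<kappa>'" if "(succ M)\<^sup>*\<^sup>* \<kappa> \<kappa>'" "\<not> (\<exists>\<kappa>''. succ M \<kappa>' \<kappa>'')" for \<kappa>'
      using that 1 by (metis converse_rtranclpE)
    ultimately show ?case by blast
  qed
  then show "all_maximal_accepting M \<kappa>"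
    unfolding all_maximal_accepting_def reachable_iff_finite_computation by blast
qed

lemma gtm_fun_iff:
  "x \<in> gtm_fun M xs \<longleftrightarrow>
     xs \<in> listset (map (carr M) [1..<Suc (num_inputs M)]) \<and>
     halts_accepting M (init_config M xs) \<and>
     (\<exists>\<kappa>. (succ M)\<^sup>*\<^sup>* (init_config M xs) \<kappa> \<and> accepting M \<kappa> \<and> tape \<kappa> 0 0 = Val x)"
  unfolding gtm_fun_def reachable_iff_finite_computation
  by (auto simp: all_maximal_accepting_iff)

lemma halts_accepting_reaches_accepting:
  "halts_accepting M \<kappa> \<Longrightarrow> \<exists>\<kappa>'. (succ M)\<^sup>*\<^sup>* \<kappa> \<kappa>' \<and> accepting M \<kappa>'"
proof (induction rule: halts_accepting.induct)
  case (1 \<kappa>)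
  then show ?case
    by (metis converse_rtranclp_into_rtranclp rtranclp.rtrancl_refl)
qed

text \<open>
  A single notion of replacement serves both realizations in the theorem: the realization of the
  functions of \<open>P\<close> by those of \<open>M\<close> via \<open>\<delta>\<close>, and the realization of the functions of \<open>M\<close> by
  partial functions on sequences via \<open>\<gamma>\<close>. A realized test has at most one value, hence
  its realization cannot answer \<open>1\<close> when the test itself answers \<open>0\<close>.
\<close>

inductive stmt_realizes :: "(nat \<Rightarrow> 'y \<Rightarrow> 'z set) \<Rightarrow>
    ('l, 'g, 'y, 's) stmt \<Rightarrow> ('l, 'g, 'z, 's) stmt \<Rightarrow> bool" for \<delta> where
  "stmt_realizes \<delta> (GoRight i l) (GoRight i l)"
| "stmt_realizes \<delta> (GoLeft i l) (GoLeft i l)"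
| "stmt_realizes \<delta> (Write i a l) (Write i a l)"
| "stmt_realizes \<delta> (IfSym i a l l') (IfSym i a l l')"
| "realizes (map \<delta> js) (\<delta> i) g f \<Longrightarrow> stmt_realizes \<delta> (Assign i g js l) (Assign i f js l)"
| "\<lbrakk>realizes (map \<delta> js) id_star g f; \<And>xs. \<forall>a\<in>f xs. \<forall>b\<in>f xs. a = b\<rbrakk> \<Longrightarrow>
     stmt_realizes \<delta> (Test g js l l') (Test f js l l')"

definition gtm_realizes :: "(nat \<Rightarrow> 'y \<Rightarrow> 'z set) \<Rightarrow>
    ('l, 'g, 'y, 's::{finite, zero_neq_one}) gtm \<Rightarrow> ('l, 'g, 'z, 's) gtm \<Rightarrow> bool" where
  "gtm_realizes \<delta> M P \<longleftrightarrow>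
     init_label M = init_label P \<and> final_label M = final_label P \<and> blank M = blank P \<and>
     num_inputs M = num_inputs P \<and> init_label P \<in> labels P \<and>
     (\<forall>l \<in> labels P - {final_label P}. wf_stmt P (stm P l) \<and> stmt_realizes \<delta> (stm M l) (stm P l))"

fun cell_realizes :: "('y \<Rightarrow> 'z set) \<Rightarrow> ('y, 'g) cell \<Rightarrow> ('z, 'g) cell \<Rightarrow> bool" where
  "cell_realizes d (Val y) (Val z) \<longleftrightarrow> z \<in> d y"
| "cell_realizes d (Sym a) (Sym b) \<longleftrightarrow> a = b"
| "cell_realizes d _ _ \<longleftrightarrow> False"

lemma cell_realizes_Val2: "cell_realizes d c (Val z) \<longleftrightarrow> (\<exists>y. c = Val y \<and> z \<in> d y)"
  by (cases c) simp_all

lemma cell_realizes_Sym: "cell_realizes d c c' \<Longrightarrow> c = Sym a \<longleftrightarrow> c' = Sym a"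
  by (cases c; cases c'; auto)

definition config_realizes :: "(nat \<Rightarrow> 'y \<Rightarrow> 'z set) \<Rightarrow> 'l set \<Rightarrow>
    ('l, 'g, 'y) config \<Rightarrow> ('l, 'g, 'z) config \<Rightarrow> bool" where
  "config_realizes \<delta> Ls \<kappa> \<kappa>' \<longleftrightarrow>
     lab \<kappa> = lab \<kappa>' \<and> lab \<kappa>' \<in> Ls \<and> pos \<kappa> = pos \<kappa>' \<and>
     (\<forall>i j. cell_realizes (\<delta> i) (tape \<kappa> i j) (tape \<kappa>' i j))"

lemma scanned_values_realize:
  assumes "config_realizes \<delta> Ls \<kappa> \<kappa>'" "map (scanned \<kappa>') js = map Val zs"
  shows "\<exists>ys. map (scanned \<kappa>) js = map Val ys \<and> zs \<in> prod_rep (map \<delta> js) ys"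
proof -
  have len: "length js = length zs" using assms(2) by (metis length_map)
  have "\<exists>y. scanned \<kappa> (js ! n) = Val y \<and> zs ! n \<in> \<delta> (js ! n) y" if "n < length js" for n
  proof -
    have "scanned \<kappa>' (js ! n) = Val (zs ! n)" using assms(2) that len by (metis nth_map)
    moreover have "cell_realizes (\<delta> (js ! n)) (scanned \<kappa> (js ! n)) (scanned \<kappa>' (js ! n))"
      using assms(1) by (simp add: config_realizes_def scanned_def)
    ultimately show ?thesis by (simp add: cell_realizes_Val2)
  qed
  then obtain y where y: "\<And>n. n < length js \<Longrightarrow>
      scanned \<kappa> (js ! n) = Val (y n) \<and> zs ! n \<in> \<delta> (js ! n) (y n)" by metis
  have "map (scanned \<kappa>) js = map Val (map y [0..<length js])"
    by (rule nth_equalityI) (use y in auto)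
  moreover have "zs \<in> prod_rep (map \<delta> js) (map y [0..<length js])"
    unfolding in_prod_rep_iff using y len by auto
  ultimately show ?thesis by blast
qed

lemma config_realizes_write_cell:
  assumes "config_realizes \<delta> Ls \<kappa> \<kappa>'" "cell_realizes (\<delta> i) c c'" "l \<in> Ls"
  shows "config_realizes \<delta> Ls ((write_cell i c \<kappa>)\<lparr>lab := l\<rparr>) ((write_cell i c' \<kappa>')\<lparr>lab := l\<rparr>)"
  using assms by (auto simp: config_realizes_def write_cell_def)

lemma map_Val_eq_iff: "map Val xs = map Val ys \<longleftrightarrow> xs = ys"
  by (auto simp: inj_map_eq_map inj_def)

text \<open>
  If \<open>P\<close> can continue from a configuration then the functions of \<open>P\<close> that occur in the
  current statement are defined there, so their realizations are defined, and every value that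
  the realizing machine chooses represents a value that \<open>P\<close> could have chosen. Both the
  existence of a step of \<open>M\<close> and the translation of every step of \<open>M\<close> are needed since all
  maximal computations of \<open>M\<close> must accept.
\<close>

lemma succ_realizes:
  fixes M :: "('l, 'g, 'y, 's::{finite, zero_neq_one}) gtm" and P :: "('l, 'g, 'z, 's) gtm"
  assumes real: "gtm_realizes \<delta> M P" and rel: "config_realizes \<delta> (labels P) \<kappa> \<kappa>'"
    and succ_P: "succ P \<kappa>' \<kappa>P"
  shows "\<exists>\<kappa>M. succ M \<kappa> \<kappa>M"
    and "succ M \<kappa> \<kappa>M \<Longrightarrow> \<exists>\<kappa>P'. succ P \<kappa>' \<kappa>P' \<and> config_realizes \<delta> (labels P) \<kappa>M \<kappa>P'"
proof -
  have lab: "lab \<kappa> = lab \<kappa>'" and pos: "pos \<kappa> = pos \<kappa>'" and labP: "lab \<kappa>' \<in> labels P"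
    and final: "final_label M = final_label P"
    using rel real by (auto simp: config_realizes_def gtm_realizes_def)
  have nf: "lab \<kappa>' \<noteq> final_label P" using succ_P by (auto elim: succ.cases)
  have wf: "wf_stmt P (stm P (lab \<kappa>'))"
    and sr: "stmt_realizes \<delta> (stm M (lab \<kappa>')) (stm P (lab \<kappa>'))"
    using real labP nf by (auto simp: gtm_realizes_def)
  note defs = lab nf final
  have "(\<exists>\<kappa>M. succ M \<kappa> \<kappa>M) \<and>
    (\<forall>\<kappa>M. succ M \<kappa> \<kappa>M \<longrightarrow> (\<exists>\<kappa>P'. succ P \<kappa>' \<kappa>P' \<and> config_realizes \<delta> (labels P) \<kappa>M \<kappa>P'))"
    using sr
  proof cases
    case (1 i l)
    have "succ M \<kappa> \<kappa>M \<longleftrightarrow> \<kappa>M = \<kappa>\<lparr>lab := l, pos := (pos \<kappa>)(i := pos \<kappa> i + 1)\<rparr>" for \<kappa>M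
      using 1 defs by (auto elim: succ.cases intro: succ.intros)
    moreover have "succ P \<kappa>' (\<kappa>'\<lparr>lab := l, pos := (pos \<kappa>')(i := pos \<kappa>' i + 1)\<rparr>)"
      using 1 defs by (intro go_right) auto
    ultimately show ?thesis
      using rel wf 1 by (auto simp: config_realizes_def intro!: exI)
  next
    case (2 i l)
    have "succ M \<kappa> \<kappa>M \<longleftrightarrow> \<kappa>M = \<kappa>\<lparr>lab := l, pos := (pos \<kappa>)(i := pos \<kappa> i - 1)\<rparr>" for \<kappa>M
      using 2 defs by (auto elim: succ.cases intro: succ.intros)
    moreover have "succ P \<kappa>' (\<kappa>'\<lparr>lab := l, pos := (pos \<kappa>')(i := pos \<kappa>' i - 1)\<rparr>)"
      using 2 defs by (intro go_left) auto
    ultimately show ?thesis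
      using rel wf 2 by (auto simp: config_realizes_def intro!: exI)
  next
    case (3 i a l)
    have "succ M \<kappa> \<kappa>M \<longleftrightarrow> \<kappa>M = (write_cell i (Sym a) \<kappa>)\<lparr>lab := l\<rparr>" for \<kappa>M
      using 3 defs by (auto elim: succ.cases intro: succ.intros)
    moreover have "succ P \<kappa>' ((write_cell i (Sym a) \<kappa>')\<lparr>lab := l\<rparr>)"
      using 3 defs by (intro write_sym) auto
    ultimately show ?thesis
      using config_realizes_write_cell[OF rel, of i "Sym a" "Sym a" l] wf 3 by auto
  next
    case (4 i a l l')
    have "succ M \<kappa> \<kappa>M \<longleftrightarrow> \<kappa>M = \<kappa>\<lparr>lab := (if scanned \<kappa> i = Sym a then l else l')\<rparr>" for \<kappa>M
      using 4 defs if_sym[of \<kappa> M i a l l'] by (auto elim: succ.cases)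
    moreover have "succ P \<kappa>' (\<kappa>'\<lparr>lab := (if scanned \<kappa>' i = Sym a then l else l')\<rparr>)"
      using 4 defs by (intro if_sym) auto
    moreover have "scanned \<kappa> i = Sym a \<longleftrightarrow> scanned \<kappa>' i = Sym a"
      using rel cell_realizes_Sym by (fastforce simp: config_realizes_def scanned_def)
    ultimately show ?thesis
      using rel wf 4 by (auto simp: config_realizes_def intro!: exI)
  next
    case (5 js i g f l)
    from succ_P nf 5 obtain zs z where zs: "map (scanned \<kappa>') js = map Val zs" "z \<in> f zs"
      by (auto elim: succ.cases)
    obtain ys where ys: "map (scanned \<kappa>) js = map Val ys" "zs \<in> prod_rep (map \<delta> js) ys"
      using scanned_values_realize[OF rel zs(1)] by blast
    have g: "g ys \<noteq> {}" "\<And>y. y \<in> g ys \<Longrightarrow> f zs \<inter> \<delta> i y \<noteq> {}"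
      using 5(3) ys(2) zs(2) unfolding realizes_def by blast+
    have "succ M \<kappa> \<kappa>M \<longleftrightarrow> (\<exists>y\<in>g ys. \<kappa>M = (write_cell i (Val y) \<kappa>)\<lparr>lab := l\<rparr>)" for \<kappa>M
      using 5 defs ys(1) by (auto elim!: succ.cases intro: succ.intros simp: map_Val_eq_iff)
    note step_M = this
    have step_P: "succ P \<kappa>' ((write_cell i (Val z) \<kappa>')\<lparr>lab := l\<rparr>)" if "z \<in> f zs" for z
      using 5 defs zs(1) that by (intro assignment) auto
    have rel': "config_realizes \<delta> (labels P) ((write_cell i (Val y) \<kappa>)\<lparr>lab := l\<rparr>)
        ((write_cell i (Val z) \<kappa>')\<lparr>lab := l\<rparr>)" if "z \<in> \<delta> i y" for y z
      using config_realizes_write_cell[OF rel] that wf 5 by simp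
    show ?thesis
    proof (intro conjI allI impI)
      show "\<exists>\<kappa>M. succ M \<kappa> \<kappa>M" using g(1) step_M by blast
      fix \<kappa>M assume "succ M \<kappa> \<kappa>M"
      then obtain y where y: "y \<in> g ys" "\<kappa>M = (write_cell i (Val y) \<kappa>)\<lparr>lab := l\<rparr>"
        using step_M by blast
      obtain z where "z \<in> f zs" "z \<in> \<delta> i y" using g(2)[OF y(1)] by blast
      then show "\<exists>\<kappa>P'. succ P \<kappa>' \<kappa>P' \<and> config_realizes \<delta> (labels P) \<kappa>M \<kappa>P'"
        using step_P rel' y(2) by blast
    qed
  next
    case (6 js g f l l')
    define answer where "answer b = (if b then Word [0] else Word [1] :: 's elem)" for b
    define target where "target b = (if b then l else l')" for b
    have succ_Test_iff: "succ N \<sigma> \<sigma>' \<longleftrightarrow> (\<exists>b. answer b \<in> h xs \<and> \<sigma>' = \<sigma>\<lparr>lab := target b\<rparr>)"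
      if "stm N (lab \<sigma>) = Test h js l l'" "lab \<sigma> \<noteq> final_label N" "map (scanned \<sigma>) js = map Val xs"
      for N :: "('l, 'g, 'x, 's) gtm" and \<sigma> \<sigma>' h xs
    proof
      assume "succ N \<sigma> \<sigma>'"
      then show "\<exists>b. answer b \<in> h xs \<and> \<sigma>' = \<sigma>\<lparr>lab := target b\<rparr>"
      proof cases
        case test_0
        then show ?thesis using that
          by (intro exI[of _ True]) (auto simp: answer_def target_def map_Val_eq_iff)
      next
        case test_1
        then show ?thesis using that
          by (intro exI[of _ False]) (auto simp: answer_def target_def map_Val_eq_iff)
      qed (use that in auto)
    next
      assume "\<exists>b. answer b \<in> h xs \<and> \<sigma>' = \<sigma>\<lparr>lab := target b\<rparr>"
      then show "succ N \<sigma> \<sigma>'"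
        using that by (auto simp: answer_def target_def intro: test_0 test_1 split: if_splits)
    qed
    from succ_P nf 6 obtain zs where zs: "map (scanned \<kappa>') js = map Val zs"
      by (auto elim: succ.cases)
    have step_P: "succ P \<kappa>' \<sigma>' \<longleftrightarrow> (\<exists>b. answer b \<in> f zs \<and> \<sigma>' = \<kappa>'\<lparr>lab := target b\<rparr>)" for \<sigma>'
      by (rule succ_Test_iff) (use 6 nf zs in auto)
    then obtain b where b: "answer b \<in> f zs" using succ_P by blast
    obtain ys where ys: "map (scanned \<kappa>) js = map Val ys" "zs \<in> prod_rep (map \<delta> js) ys"
      using scanned_values_realize[OF rel zs] by blast
    have step_M: "succ M \<kappa> \<sigma>' \<longleftrightarrow> (\<exists>b. answer b \<in> g ys \<and> \<sigma>' = \<kappa>\<lparr>lab := target b\<rparr>)" for \<sigma>'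
      by (rule succ_Test_iff) (use 6 defs ys in auto)
    have g: "g ys \<noteq> {}" "\<And>y. y \<in> g ys \<Longrightarrow> f zs \<inter> id_star y \<noteq> {}"
      using 6(3) ys(2) b unfolding realizes_def by blast+
    have "y = answer b" if "y \<in> g ys" for y
      using g(2)[OF that] b 6(4)[of zs] by (auto simp: id_star_def split: if_splits)
    with g(1) have "g ys = {answer b}" by blast
    moreover have "config_realizes \<delta> (labels P) (\<kappa>\<lparr>lab := target b\<rparr>) (\<kappa>'\<lparr>lab := target b\<rparr>)" for b
      using rel wf 6 by (auto simp: config_realizes_def target_def)
    moreover have "answer c = answer b \<Longrightarrow> c = b" for c
      by (auto simp: answer_def split: if_splits)
    ultimately show ?thesis using b by (auto simp: step_P step_M)
  qed
  then show "\<exists>\<kappa>M. succ M \<kappa> \<kappa>M"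
    and "succ M \<kappa> \<kappa>M \<Longrightarrow> \<exists>\<kappa>P'. succ P \<kappa>' \<kappa>P' \<and> config_realizes \<delta> (labels P) \<kappa>M \<kappa>P'" by blast+
qed

text \<open>
  Induction over the well-founded computation tree of \<open>P\<close>: the tree of \<open>M\<close> is well-founded
  as well, and each of its branches follows a branch of the tree of \<open>P\<close>.
\<close>

lemma gtm_fun_realizes:
  assumes real: "gtm_realizes \<delta> M P" and le: "num_inputs P \<le> L"
    and delta: "\<And>i. i \<le> L \<Longrightarrow> multifun (carr M i) (carr P i) (\<delta> i)"
  shows "realizes (map \<delta> [1..<Suc (num_inputs P)]) (\<delta> 0) (gtm_fun M) (gtm_fun P)"
  unfolding realizes_def
proof (intro allI impI, elim conjE)
  fix xs vs
  define k where "k = num_inputs P"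
  assume vs: "vs \<in> prod_rep (map \<delta> [1..<Suc (num_inputs P)]) xs" and ne: "gtm_fun P vs \<noteq> {}"
  have kM: "num_inputs M = k" using real by (simp add: gtm_realizes_def k_def)
  have len: "length xs = k" "length vs = k" and rep: "\<And>i. i < k \<Longrightarrow> vs ! i \<in> \<delta> (Suc i) (xs ! i)"
    using vs by (auto simp: in_prod_rep_iff k_def simp del: upt_Suc)
  have in_carr: "y \<in> carr M i" if "z \<in> \<delta> i y" "i \<le> L" for y z i
    using delta[OF that(2)] that(1) by (auto simp: multifun_def)
  have rel: "config_realizes \<delta> (labels P) (init_config M xs) (init_config P vs)"
  proof -
    have "vs ! (i - 1) \<in> \<delta> i (xs ! (i - 1))" if "1 \<le> i" "i \<le> k" for i
      using rep[of "i - 1"] that by simp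
    then show ?thesis
      using real kM by (auto simp: config_realizes_def init_config_def gtm_realizes_def k_def)
  qed
  have xs_in: "xs \<in> listset (map (carr M) [1..<Suc (num_inputs M)])"
    unfolding in_listset_iff list_all2_conv_all_nth
  proof (intro conjI allI impI)
    show "length xs = length (map (carr M) [1..<Suc (num_inputs M)])" using len kM by simp
    fix i assume "i < length xs"
    then have "i < k" "map (carr M) [1..<Suc (num_inputs M)] ! i = carr M (Suc i)"
      using len kM by (simp_all del: upt_Suc)
    then show "xs ! i \<in> map (carr M) [1..<Suc (num_inputs M)] ! i"
      using in_carr[OF rep[of i]] le by (simp add: k_def)
  qed
  have halts_P: "halts_accepting P (init_config P vs)" using ne by (auto simp: gtm_fun_iff)
  \<comment> \<open>In an accepting configuration of \<open>P\<close> the machine \<open>M\<close> accepts as well: the content of the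
    output cell of \<open>M\<close> represents that of \<open>P\<close>.\<close>
  have accept: "accepting M \<kappa>" "\<not> succ M \<kappa> \<kappa>1"
    if rel: "config_realizes \<delta> (labels P) \<kappa> \<kappa>'" and acc: "accepting P \<kappa>'" for \<kappa> \<kappa>' \<kappa>1
  proof -
    have fin: "lab \<kappa> = final_label M"
      using rel acc real by (auto simp: config_realizes_def accepting_def gtm_realizes_def)
    then show "\<not> succ M \<kappa> \<kappa>1" by (auto elim: succ.cases)
    obtain z where "tape \<kappa>' 0 0 = Val z" using acc by (auto simp: accepting_def)
    then obtain y where "tape \<kappa> 0 0 = Val y" "z \<in> \<delta> 0 y"
      using rel unfolding config_realizes_def by (metis cell_realizes_Val2)
    then show "accepting M \<kappa>" using fin in_carr by (auto simp: accepting_def)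
  qed
  have halts_M: "halts_accepting M \<kappa>"
    if "halts_accepting P \<kappa>'" "config_realizes \<delta> (labels P) \<kappa> \<kappa>'" for \<kappa> \<kappa>'
    using that
  proof (induction arbitrary: \<kappa> rule: halts_accepting.induct)
    case (1 \<kappa>')
    show ?case
    proof (cases "\<exists>\<kappa>P. succ P \<kappa>' \<kappa>P")
      case True
      then show ?thesis
        using succ_realizes[OF real 1(4)] 1(1,3) by (metis halts_accepting.intros)
    next
      case False
      then have "accepting P \<kappa>'" using 1(2) by blast
      then show ?thesis using accept[OF 1(4)] by (metis halts_accepting.intros)
    qed
  qed
  have trace: "\<exists>\<kappa>P. (succ P)\<^sup>*\<^sup>* \<kappa>' \<kappa>P \<and> accepting P \<kappa>P \<and> config_realizes \<delta> (labels P) \<kappa>M \<kappa>P"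
    if "halts_accepting P \<kappa>'" "config_realizes \<delta> (labels P) \<kappa> \<kappa>'"
      "(succ M)\<^sup>*\<^sup>* \<kappa> \<kappa>M" "accepting M \<kappa>M" for \<kappa> \<kappa>' \<kappa>M
    using that
  proof (induction arbitrary: \<kappa> rule: halts_accepting.induct)
    case (1 \<kappa>')
    show ?case
    proof (cases "\<exists>\<kappa>P. succ P \<kappa>' \<kappa>P")
      case True
      then obtain \<kappa>P where \<kappa>P: "succ P \<kappa>' \<kappa>P" by blast
      have "\<kappa> \<noteq> \<kappa>M"
        using 1(6) succ_realizes(1)[OF real 1(4) \<kappa>P] by (auto simp: accepting_def elim: succ.cases)
      then obtain \<kappa>1 where \<kappa>1: "succ M \<kappa> \<kappa>1" "(succ M)\<^sup>*\<^sup>* \<kappa>1 \<kappa>M"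
        using 1(5) by (metis converse_rtranclpE)
      obtain \<kappa>P' where "succ P \<kappa>' \<kappa>P'" "config_realizes \<delta> (labels P) \<kappa>1 \<kappa>P'"
        using succ_realizes(2)[OF real 1(4) \<kappa>P \<kappa>1(1)] by blast
      with 1(3)[of \<kappa>P' \<kappa>1] \<kappa>1(2) 1(6) show ?thesis
        by (meson converse_rtranclp_into_rtranclp)
    next
      case False
      then have acc: "accepting P \<kappa>'" using 1(2) by blast
      then have "\<kappa>M = \<kappa>" using 1(5) accept(2)[OF 1(4)] by (metis converse_rtranclpE)
      then show ?thesis using acc 1(4) by blast
    qed
  qed
  have halts: "halts_accepting M (init_config M xs)" by (rule halts_M[OF halts_P rel])
  show "gtm_fun M xs \<noteq> {} \<and> (\<forall>x0\<in>gtm_fun M xs. gtm_fun P vs \<inter> \<delta> 0 x0 \<noteq> {})"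
  proof
    obtain \<kappa> where "(succ M)\<^sup>*\<^sup>* (init_config M xs) \<kappa>" "accepting M \<kappa>"
      using halts_accepting_reaches_accepting[OF halts] by blast
    moreover from this obtain x where "tape \<kappa> 0 0 = Val x" by (auto simp: accepting_def)
    ultimately have "x \<in> gtm_fun M xs" using xs_in halts by (auto simp: gtm_fun_iff simp del: upt_Suc)
    then show "gtm_fun M xs \<noteq> {}" by blast
    show "\<forall>x0\<in>gtm_fun M xs. gtm_fun P vs \<inter> \<delta> 0 x0 \<noteq> {}"
    proof
      fix x0 assume "x0 \<in> gtm_fun M xs"
      then obtain \<kappa> where \<kappa>: "(succ M)\<^sup>*\<^sup>* (init_config M xs) \<kappa>" "accepting M \<kappa>" "tape \<kappa> 0 0 = Val x0"
        by (auto simp: gtm_fun_iff)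
      obtain \<kappa>P where \<kappa>P: "(succ P)\<^sup>*\<^sup>* (init_config P vs) \<kappa>P" "accepting P \<kappa>P"
          "config_realizes \<delta> (labels P) \<kappa> \<kappa>P"
        using trace[OF halts_P rel \<kappa>(1,2)] by blast
      then obtain z where z: "tape \<kappa>P 0 0 = Val z" by (auto simp: accepting_def)
      have "cell_realizes (\<delta> 0) (tape \<kappa> 0 0) (tape \<kappa>P 0 0)"
        using \<kappa>P(3) by (simp add: config_realizes_def)
      then have "z \<in> \<delta> 0 x0" using z \<kappa>(3) by simp
      moreover have "z \<in> gtm_fun P vs"
        using ne halts_P \<kappa>P z by (auto simp: gtm_fun_iff simp del: upt_Suc)
      ultimately show "gtm_fun P vs \<inter> \<delta> 0 x0 \<noteq> {}" by blast
    qed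
  qed
qed

section \<open>Counter programs on Type-2 machines\<close>

text \<open>
  A work tape that carries a mark in cell \<open>0\<close> and is otherwise blank serves as a counter whose
  value is the head position. Structured programs over such counters are an intermediate
  language between recursive functions and Type-2 machines.
\<close>

datatype 's cond = NonZero nat | Scanned nat 's

datatype 's com = Skip | Inc nat | Dec nat | Advance nat | Emit 's
  | Then "'s com" "'s com" (infixr ";;" 60)
  | Cond "'s cond" "'s com" "'s com"
  | While "'s cond" "'s com"

instance cond :: (countable) countable by countable_datatype
instance com :: (countable) countable by countable_datatype

text \<open>
  A state consists of the input head positions, the counter values and the output. The control
  state is the list of the commands that remain to be executed.
\<close>

type_synonym 's cstate = "(nat \<Rightarrow> nat) \<times> (nat \<Rightarrow> nat) \<times> 's list"

fun next_stack :: "('s cond \<Rightarrow> bool) \<Rightarrow> 's com list \<Rightarrow> 's com list" where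
  "next_stack b [] = []"
| "next_stack b ((c ;; d) # k) = c # d # k"
| "next_stack b (Cond t c d # k) = (if b t then c else d) # k"
| "next_stack b (While t c # k) = (if b t then c # While t c # k else k)"
| "next_stack b (_ # k) = k"

fun effect :: "'s com \<Rightarrow> 's cstate \<Rightarrow> 's cstate" where
  "effect (Inc r) (h, v, w) = (h, v(r := Suc (v r)), w)"
| "effect (Dec r) (h, v, w) = (h, v(r := v r - 1), w)"
| "effect (Advance i) (h, v, w) = (h(i := Suc (h i)), v, w)"
| "effect (Emit a) (h, v, w) = (h, v, w @ [a])"
| "effect _ s = s"

fun cond_holds :: "(nat \<Rightarrow> nat \<Rightarrow> 's) \<Rightarrow> 's cstate \<Rightarrow> 's cond \<Rightarrow> bool" where
  "cond_holds p (h, v, w) (NonZero r) \<longleftrightarrow> v r \<noteq> 0"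
| "cond_holds p (h, v, w) (Scanned i a) \<longleftrightarrow> p i (h i) = a"

fun cstep :: "(nat \<Rightarrow> nat \<Rightarrow> 's) \<Rightarrow> 's com list \<times> 's cstate \<Rightarrow> 's com list \<times> 's cstate" where
  "cstep p ([], s) = ([], s)"
| "cstep p (c # k, s) = (next_stack (cond_holds p s) (c # k), effect c s)"

text \<open>
  The rest \<open>k\<close> of the program is arbitrary, so that executions of commands compose. The number of
  steps is positive, so that an endless loop takes infinitely many steps.
\<close>

definition runs :: "(nat \<Rightarrow> nat \<Rightarrow> 's) \<Rightarrow> 's com \<Rightarrow> 's cstate \<Rightarrow> 's cstate \<Rightarrow> bool" where
  "runs p c s s' \<longleftrightarrow> (\<forall>k. \<exists>n>0. (cstep p ^^ n) (c # k, s) = (k, s'))"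

lemma runs_effect: "cstep p ([c], s) = ([], s') \<Longrightarrow> c \<in> {Skip, Inc r, Dec r, Advance r, Emit a} \<Longrightarrow>
    runs p c s s'"
  unfolding runs_def by (auto intro!: exI[of _ 1])

lemma runs_Skip: "runs p Skip s s"
  and runs_Inc: "runs p (Inc r) (h, v, w) (h, v(r := Suc (v r)), w)"
  and runs_Dec: "runs p (Dec r) (h, v, w) (h, v(r := v r - 1), w)"
  and runs_Advance: "runs p (Advance i) (h, v, w) (h(i := Suc (h i)), v, w)"
  and runs_Emit: "runs p (Emit a) (h, v, w) (h, v, w @ [a])"
  by (cases s, rule runs_effect; simp)+

lemma funpow_trans: "(f ^^ m) x = y \<Longrightarrow> (f ^^ n) y = z \<Longrightarrow> (f ^^ (n + m)) x = z"
  by (simp add: funpow_add)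

lemma runs_first_step:
  assumes "\<And>k. cstep p (c # k, s) = (d # k, s)" "runs p d s s'"
  shows "runs p c s s'"
  unfolding runs_def
proof
  fix k
  obtain n where "(cstep p ^^ n) (d # k, s) = (k, s')" using assms(2) by (auto simp: runs_def)
  then have "(cstep p ^^ (Suc n)) (c # k, s) = (k, s')"
    using assms(1) by (simp add: funpow_swap1)
  then show "\<exists>n>0. (cstep p ^^ n) (c # k, s) = (k, s')" by blast
qed

lemma runs_Then:
  assumes "runs p c s s'" "runs p d s' s''"
  shows "runs p (c ;; d) s s''"
  unfolding runs_def
proof
  fix k
  obtain n where "(cstep p ^^ n) (c # d # k, s) = (d # k, s')" using assms(1) by (auto simp: runs_def)
  moreover obtain m where "(cstep p ^^ m) (d # k, s') = (k, s'')" using assms(2) by (auto simp: runs_def)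
  ultimately have "(cstep p ^^ (m + n)) (c # d # k, s) = (k, s'')" by (rule funpow_trans)
  then have "(cstep p ^^ (Suc (m + n))) ((c ;; d) # k, s) = (k, s'')" by (cases s) (simp add: funpow_swap1)
  then show "\<exists>n>0. (cstep p ^^ n) ((c ;; d) # k, s) = (k, s'')" by blast
qed

lemma runs_Cond_True: "cond_holds p s t \<Longrightarrow> runs p c s s' \<Longrightarrow> runs p (Cond t c d) s s'"
  by (rule runs_first_step) (cases s; auto)

lemma runs_Cond_False: "\<not> cond_holds p s t \<Longrightarrow> runs p d s s' \<Longrightarrow> runs p (Cond t c d) s s'"
  by (rule runs_first_step) (cases s; auto)

lemma runs_While_False: "\<not> cond_holds p s t \<Longrightarrow> runs p (While t c) s s"
  unfolding runs_def by (cases s) (auto intro!: exI[of _ 1])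

lemma While_unfold:
  assumes "cond_holds p s t" "runs p c s s'"
  shows "\<exists>n>0. (cstep p ^^ n) (While t c # k, s) = (While t c # k, s')"
proof -
  obtain n where "(cstep p ^^ n) (c # While t c # k, s) = (While t c # k, s')"
    using assms(2) by (auto simp: runs_def)
  then have "(cstep p ^^ (Suc n)) (While t c # k, s) = (While t c # k, s')"
    using assms(1) by (cases s) (simp add: funpow_swap1)
  then show ?thesis by blast
qed

lemma runs_While_True:
  assumes "cond_holds p s t" "runs p c s s'" "runs p (While t c) s' s''"
  shows "runs p (While t c) s s''"
  unfolding runs_def
proof
  fix k
  obtain n where "(cstep p ^^ n) (While t c # k, s) = (While t c # k, s')"
    using While_unfold[OF assms(1,2)] by blast
  moreover obtain m where m: "m > 0" "(cstep p ^^ m) (While t c # k, s') = (k, s'')"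
    using assms(3) by (auto simp: runs_def)
  ultimately have "(cstep p ^^ (m + n)) (While t c # k, s) = (k, s'')" by (blast intro: funpow_trans)
  then show "\<exists>n>0. (cstep p ^^ n) (While t c # k, s) = (k, s'')" using m(1) by (metis add_gr_0)
qed


subsection \<open>The machine that executes a program\<close>

text \<open>
  Only finitely many lists of remaining commands occur: \<open>remainders c k\<close> contains those that
  occur while \<open>c\<close> is executed on top of \<open>k\<close>.
\<close>

fun remainders :: "'s com \<Rightarrow> 's com list \<Rightarrow> 's com list set" where
  "remainders (c ;; d) k = insert ((c ;; d) # k) (remainders c (d # k) \<union> remainders d k)"
| "remainders (Cond t c d) k = insert (Cond t c d # k) (remainders c k \<union> remainders d k)"
| "remainders (While t c) k = insert (While t c # k) (remainders c (While t c # k))"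
| "remainders c k = {c # k}"

lemma finite_remainders: "finite (remainders c k)"
  by (induction c arbitrary: k) auto

lemma remainders_start: "c # k \<in> remainders c k"
  by (cases c) auto

lemma remainders_closed: "x \<in> remainders c k \<Longrightarrow> next_stack b x \<in> insert k (remainders c k)"
proof (induction c arbitrary: k)
  case (Then c d)
  then show ?case using remainders_start by fastforce
next
  case (Cond t c d)
  then show ?case using remainders_start[of c k] remainders_start[of d k] by (auto split: if_splits)
next
  case (While t c)
  then show ?case using remainders_start by fastforce
qed auto

fun head_move :: "'s com list \<Rightarrow> nat \<Rightarrow> move" where
  "head_move (Advance i # k) j = (if j = i then MoveRight else Stay)"
| "head_move _ j = Stay"

fun counter_move :: "'s com list \<Rightarrow> 's sym \<Rightarrow> nat \<Rightarrow> move" where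
  "counter_move (Inc r # k) a j = (if j = r then MoveRight else Stay)"
| "counter_move (Dec r # k) a j = (if j = r \<and> a \<noteq> Mark 0 then MoveLeft else Stay)"
| "counter_move _ a j = Stay"

fun emitted :: "'s com list \<Rightarrow> 's option" where
  "emitted (Emit a # k) = Some a"
| "emitted _ = None"

fun cond_scanned :: "'s sym list \<Rightarrow> 's sym list \<Rightarrow> 's cond \<Rightarrow> bool" where
  "cond_scanned ins wks (NonZero r) \<longleftrightarrow> wks ! r \<noteq> Mark 0"
| "cond_scanned ins wks (Scanned i a) \<longleftrightarrow> ins ! i = Letter a"

text \<open>The state \<open>None\<close> is the start state, in which the marks are put on the work tapes.\<close>

definition com_machine :: "nat \<Rightarrow> nat \<Rightarrow> 's::finite com \<Rightarrow> 's t2_machine" where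
  "com_machine n W c = \<lparr>
     t2_states = to_nat ` insert None (Some ` insert [] (remainders c [])),
     t2_start = to_nat (None :: 's com list option),
     t2_halt = to_nat (Some [] :: 's com list option),
     t2_works = W,
     t2_syms = insert Blank (insert (Mark 0) (range Letter)),
     t2_trans = (\<lambda>q ins wks. case from_nat q of
         None \<Rightarrow> (to_nat (Some [c]), replicate n Stay, replicate W (Mark 0, Stay), None)
       | Some k \<Rightarrow> (to_nat (Some (next_stack (cond_scanned ins wks) k)),
           map (head_move k) [0..<n],
           map (\<lambda>j. (wks ! j, counter_move k (wks ! j) j)) [0..<W], emitted k))\<rparr>"

lemma wf_com_machine: "wf_t2 n (com_machine n W c)"
proof -
  have "next_stack b k = [] \<or> next_stack b k \<in> remainders c []" if "k \<in> remainders c []" for b k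
    using remainders_closed[OF that] by auto
  then have "x \<in> remainders c [] \<Longrightarrow> next_stack b x \<noteq> [] \<Longrightarrow> next_stack b x \<in> remainders c []" for b x
    by blast
  then show ?thesis
    unfolding wf_t2_def com_machine_def
    by (auto simp: finite_remainders remainders_start split: option.splits
        intro!: imageI dest!: nth_mem)
qed

fun cond_fits :: "nat \<Rightarrow> nat \<Rightarrow> 's cond \<Rightarrow> bool" where
  "cond_fits n W (NonZero r) \<longleftrightarrow> r < W"
| "cond_fits n W (Scanned i a) \<longleftrightarrow> i < n"

fun fits :: "nat \<Rightarrow> nat \<Rightarrow> 's com \<Rightarrow> bool" where
  "fits n W (Inc r) \<longleftrightarrow> r < W"
| "fits n W (Dec r) \<longleftrightarrow> r < W"
| "fits n W (Advance i) \<longleftrightarrow> i < n"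
| "fits n W (c ;; d) \<longleftrightarrow> fits n W c \<and> fits n W d"
| "fits n W (Cond t c d) \<longleftrightarrow> cond_fits n W t \<and> fits n W c \<and> fits n W d"
| "fits n W (While t c) \<longleftrightarrow> cond_fits n W t \<and> fits n W c"
| "fits n W c \<longleftrightarrow> True"

lemma fits_next_stack: "list_all (fits n W) k \<Longrightarrow> list_all (fits n W) (next_stack b k)"
  by (cases "(b, k)" rule: next_stack.cases) auto

definition com_config :: "nat \<Rightarrow> nat \<Rightarrow> 's::finite com list \<times> 's cstate \<Rightarrow> 's t2_config" where
  "com_config n W = (\<lambda>(k, h, v, w).
     \<lparr>c_state = to_nat (Some k), c_heads = map (\<lambda>i. int (h i)) [0..<n],
      c_works = map (\<lambda>r. ((\<lambda>_. Blank)(0 := Mark 0), int (v r))) [0..<W], c_out = w\<rparr>)"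

lemma t2_step_com_machine:
  fixes c :: "'s::finite com" and p :: "nat \<Rightarrow> nat \<Rightarrow> 's"
  assumes fits: "list_all (fits n W) k"
  shows "t2_step (com_machine n W c) (map (\<lambda>i. Seq (p i)) [0..<n]) (com_config n W (k, s)) =
         com_config n W (cstep p (k, s))"
proof (cases k)
  case Nil
  then show ?thesis by (cases s) (simp add: t2_step_def com_machine_def com_config_def)
next
  case (Cons d k')
  obtain h v w where s: "s = (h, v, w)" by (cases s)
  let ?tp = "(\<lambda>_. Blank)(0 := Mark 0) :: int \<Rightarrow> 's sym"
  let ?ins = "map (\<lambda>i. Letter (p i (h i))) [0..<n]"
  let ?wks = "map (\<lambda>r. ?tp (int (v r))) [0..<W]"
  have ins: "map2 input_tape (map (\<lambda>i. Seq (p i)) [0..<n]) (map (\<lambda>i. int (h i)) [0..<n]) = ?ins"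
    by (simp add: list_eq_iff_nth_eq)
  have wks: "map (\<lambda>(t, h). t h) (map (\<lambda>r. (?tp, int (v r))) [0..<W]) = ?wks" by simp
  have cond: "cond_scanned ?ins ?wks t \<longleftrightarrow> cond_holds p s t" if "cond_fits n W t" for t
    using that s by (cases t) auto
  then have stack: "next_stack (cond_scanned ?ins ?wks) k = next_stack (cond_holds p s) k"
    using fits Cons by (cases d) auto
  have "t2_step (com_machine n W c) (map (\<lambda>i. Seq (p i)) [0..<n]) (com_config n W (k, s)) =
    \<lparr>c_state = to_nat (Some (next_stack (cond_scanned ?ins ?wks) k)),
     c_heads = map2 (\<lambda>h m. h + shift m) (map (\<lambda>i. int (h i)) [0..<n]) (map (head_move k) [0..<n]),
     c_works = map2 (\<lambda>(t, h) (a, m). (t(h := a), h + shift m)) (map (\<lambda>r. (?tp, int (v r))) [0..<W])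
       (map (\<lambda>j. (?wks ! j, counter_move k (?wks ! j) j)) [0..<W]),
     c_out = w @ (case emitted k of None \<Rightarrow> [] | Some a \<Rightarrow> [a])\<rparr>"
  proof -
    let ?c = "com_config n W (k, s)"
    have c: "c_state ?c = to_nat (Some k)" "c_heads ?c = map (\<lambda>i. int (h i)) [0..<n]"
        "c_works ?c = map (\<lambda>r. (?tp, int (v r))) [0..<W]" "c_out ?c = w"
      by (simp_all add: com_config_def s)
    have "c_state ?c \<noteq> t2_halt (com_machine n W c)" using Cons c by (simp add: com_machine_def)
    moreover have "t2_trans (com_machine n W c) (to_nat (Some k)) ?ins ?wks =
        (to_nat (Some (next_stack (cond_scanned ?ins ?wks) k)), map (head_move k) [0..<n],
         map (\<lambda>j. (?wks ! j, counter_move k (?wks ! j) j)) [0..<W], emitted k)"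
      by (simp add: com_machine_def)
    ultimately show ?thesis
      unfolding t2_step_def c ins wks by (simp only: if_False split_conv prod.case)
  qed
  also have "\<dots> = com_config n W (cstep p (k, s))"
  proof -
    have "map2 (\<lambda>h m. h + shift m) (map (\<lambda>i. int (h i)) [0..<n]) (map (head_move k) [0..<n]) =
        map (\<lambda>i. int (fst (effect d s) i)) [0..<n]"
      using Cons s by (intro nth_equalityI; cases d) auto
    moreover have "map2 (\<lambda>(t, h) (a, m). (t(h := a), h + shift m)) (map (\<lambda>r. (?tp, int (v r))) [0..<W])
       (map (\<lambda>j. (?wks ! j, counter_move k (?wks ! j) j)) [0..<W]) =
       map (\<lambda>r. (?tp, int (fst (snd (effect d s)) r))) [0..<W]"
      using Cons s by (intro nth_equalityI; cases d) auto
    moreover have "w @ (case emitted k of None \<Rightarrow> [] | Some a \<Rightarrow> [a]) = snd (snd (effect d s))"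
      using Cons s by (cases d) auto
    ultimately show ?thesis
      using Cons stack by (simp add: com_config_def split_beta)
  qed
  finally show ?thesis .
qed

lemma t2_run_com_machine:
  fixes c :: "'s::finite com" and p :: "nat \<Rightarrow> nat \<Rightarrow> 's"
  assumes "fits n W c"
  defines "C \<equiv> \<lambda>t. (cstep p ^^ t) ([c], (\<lambda>_. 0), (\<lambda>_. 0), [])"
  shows "t2_run (com_machine n W c) (map (\<lambda>i. Seq (p i)) [0..<n]) (Suc t) = com_config n W (C t)"
proof -
  have step_fits: "list_all (fits n W) (fst (cstep p x))" if "list_all (fits n W) (fst x)" for x
    using fits_next_stack[of n W "fst x"] that
    by (cases x; cases "fst x") auto
  have fits: "list_all (fits n W) (fst (C t))" for t
    by (induction t) (use assms(1) step_fits in \<open>auto simp: C_def\<close>)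
  show ?thesis
  proof (induction t)
    case 0
    have "t2_step (com_machine n W c) (map (\<lambda>i. Seq (p i)) [0..<n]) (t2_init (com_machine n W c) n) =
        com_config n W (C 0)"
      by (simp add: t2_step_def com_machine_def t2_init_def com_config_def C_def map_replicate_const)
    then show ?case by (simp add: t2_run_def)
  next
    case (Suc t)
    have "t2_run (com_machine n W c) (map (\<lambda>i. Seq (p i)) [0..<n]) (Suc (Suc t)) =
       t2_step (com_machine n W c) (map (\<lambda>i. Seq (p i)) [0..<n]) (com_config n W (C t))"
      using Suc by (simp add: t2_run_def)
    also have "\<dots> = com_config n W (cstep p (C t))"
      using t2_step_com_machine fits by (metis prod.collapse)
    finally show ?case by (simp add: C_def)
  qed
qed

lemma cstep_stops: "(cstep p ^^ t) x = ([], s) \<Longrightarrow> t \<le> t' \<Longrightarrow> (cstep p ^^ t') x = ([], s)"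
proof (induction t' arbitrary: s)
  case (Suc t')
  then show ?case by (cases "t = Suc t'") auto
qed simp

text \<open>
  An endless loop whose body emits at most one letter passes, at the head of the loop, through every
  finite prefix of the sequence that it emits.
\<close>

lemma forever_result:
  fixes c :: "'s::finite com" and p :: "nat \<Rightarrow> nat \<Rightarrow> 's" and S :: "nat \<Rightarrow> 's cstate"
  assumes fits: "fits n W (c ;; While t d)"
    and start: "runs p c ((\<lambda>_. 0), (\<lambda>_. 0), []) (S 0)"
    and body: "\<And>N. runs p d (S N) (S (Suc N))" and cond: "\<And>N. cond_holds p (S N) t"
    and out: "\<And>N. snd (snd (S N)) = map q [0..<m N]"
    and m: "m 0 = 0" "\<And>N. m (Suc N) \<le> Suc (m N)" "\<And>j. \<exists>N. j \<le> m N"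
  shows "Seq q \<in> t2_result (com_machine n W (c ;; While t d)) (map (\<lambda>i. Seq (p i)) [0..<n])"
proof -
  define C where "C t' = (cstep p ^^ t') ([c ;; While t d], (\<lambda>_. 0), (\<lambda>_. 0), [])" for t'
  have run: "t2_run (com_machine n W (c ;; While t d)) (map (\<lambda>i. Seq (p i)) [0..<n]) (Suc t') =
      com_config n W (C t')" for t'
    using t2_run_com_machine[OF fits] by (simp add: C_def)
  have loop: "\<exists>t'\<ge>N. C t' = ([While t d], S N)" for N
  proof (induction N)
    case 0
    obtain n where "(cstep p ^^ n) (c # [While t d], (\<lambda>_. 0), (\<lambda>_. 0), []) = ([While t d], S 0)"
      using start by (auto simp: runs_def)
    then have "C (Suc n) = ([While t d], S 0)" by (simp add: C_def funpow_swap1)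
    then show ?case by blast
  next
    case (Suc N)
    then obtain t' where t': "t' \<ge> N" "C t' = ([While t d], S N)" by blast
    obtain n where "n > 0" "(cstep p ^^ n) ([While t d], S N) = ([While t d], S (Suc N))"
      using While_unfold[OF cond body] by blast
    then have "C (n + t') = ([While t d], S (Suc N))" "n + t' \<ge> Suc N"
      using t' by (auto simp: C_def funpow_add)
    then show ?case by blast
  qed
  have "c_state (t2_run (com_machine n W (c ;; While t d)) (map (\<lambda>i. Seq (p i)) [0..<n]) t')
      \<noteq> t2_halt (com_machine n W (c ;; While t d))" for t'
  proof (cases t')
    case 0
    then show ?thesis by (simp add: t2_run_def t2_init_def com_machine_def)
  next
    case (Suc t1)
    obtain t2 where "t2 \<ge> t1" "C t2 = ([While t d], S t1)" using loop by blast
    then have "fst (C t1) \<noteq> []"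
      using cstep_stops[of t1 p _ "snd (C t1)" t2] unfolding C_def
      by (metis list.distinct(1) prod.collapse prod.inject)
    then show ?thesis
      unfolding Suc run by (simp add: com_machine_def com_config_def split_beta)
  qed
  moreover have "\<exists>t'. c_out (t2_run (com_machine n W (c ;; While t d)) (map (\<lambda>i. Seq (p i)) [0..<n]) t')
      = map q [0..<j]" for j
  proof -
    \<comment> \<open>Since \<open>m\<close> grows by at most one per round, it skips no number.\<close>
    have "\<exists>N. m N = j"
    proof -
      define N where "N = (LEAST N. j \<le> m N)"
      have N: "j \<le> m N" "\<And>N'. j \<le> m N' \<Longrightarrow> N \<le> N'"
        unfolding N_def using m(3)[of j] by (auto intro: LeastI_ex Least_le)
      have "m N \<le> j"
      proof (cases N)
        case (Suc N')
        then show ?thesis using N(2)[of N'] m(2)[of N'] by fastforce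
      qed (simp add: m(1))
      then show ?thesis using N(1) by (metis le_antisym)
    qed
    then obtain N where "m N = j" by blast
    moreover obtain t' where "C t' = ([While t d], S N)" using loop by blast
    ultimately have "c_out (t2_run (com_machine n W (c ;; While t d)) (map (\<lambda>i. Seq (p i)) [0..<n])
        (Suc t')) = map q [0..<j]"
      unfolding run using out[of N] by (simp add: com_config_def split_beta)
    then show ?thesis by blast
  qed
  ultimately show ?thesis unfolding t2_result_def by blast
qed

section \<open>Recursive functions as counter programs\<close>

text \<open>
  Unary primitive recursive functions, with tuples represented by the pairing function
  \<open>prod_encode\<close>. Iteration suffices as a recursion scheme because the iterated state may carry
  parameters.
\<close>

datatype prim = PZero | PSucc | PId | PFst | PSnd | PPair prim prim | PComp prim prim | PIter prim

fun prim_eval :: "prim \<Rightarrow> nat \<Rightarrow> nat" where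
  "prim_eval PZero x = 0"
| "prim_eval PSucc x = Suc x"
| "prim_eval PId x = x"
| "prim_eval PFst x = fst (prod_decode x)"
| "prim_eval PSnd x = snd (prod_decode x)"
| "prim_eval (PPair f g) x = prod_encode (prim_eval f x, prim_eval g x)"
| "prim_eval (PComp f g) x = prim_eval f (prim_eval g x)"
| "prim_eval (PIter f) x = (prim_eval f ^^ snd (prod_decode x)) (fst (prod_decode x))"

definition count_down :: "nat \<Rightarrow> 's com \<Rightarrow> 's com" where
  "count_down r c = While (NonZero r) (Dec r ;; c)"

lemma runs_count_down:
  assumes body: "\<And>j. j < N \<Longrightarrow>
      runs p c (h, (V j)(r := N - Suc j), w) (h, (V (Suc j))(r := N - Suc j), w)"
    and v: "v = (V 0)(r := N)" "v' = (V N)(r := 0)"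
  shows "runs p (count_down r c) (h, v, w) (h, v', w)"
proof -
  have "runs p (count_down r c) (h, (V j)(r := N - j), w) (h, (V N)(r := 0), w)" if "j \<le> N" for j
    using that
  proof (induction rule: inc_induct)
    case base
    then show ?case unfolding count_down_def by (simp add: runs_While_False)
  next
    case (step j)
    have "runs p (Dec r) (h, (V j)(r := N - j), w) (h, (V j)(r := N - Suc j), w)"
      using runs_Dec[of p r h "(V j)(r := N - j)" w] by simp
    then have "runs p (Dec r ;; c) (h, (V j)(r := N - j), w) (h, (V (Suc j))(r := N - Suc j), w)"
      using body[of j] step.hyps by (blast intro: runs_Then)
    moreover have "cond_holds p (h, (V j)(r := N - j), w) (NonZero r)" using step.hyps by simp
    ultimately show ?case
      using step.IH unfolding count_down_def by (blast intro: runs_While_True)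
  qed
  from this[of 0] show ?thesis by (simp add: v)
qed

definition clear :: "nat \<Rightarrow> 's com" where
  "clear r = count_down r Skip"

definition move_to :: "nat \<Rightarrow> nat \<Rightarrow> 's com" where
  "move_to a b = count_down a (Inc b)"

definition add_to :: "nat \<Rightarrow> nat \<Rightarrow> nat \<Rightarrow> 's com" where
  "add_to a b t = count_down a (Inc b ;; Inc t) ;; move_to t a"

text \<open>The sum of both components counts down, so that its successive values add up to a triangle number.\<close>

definition encode_pair :: "nat \<Rightarrow> 's com" where
  "encode_pair d = count_down d (Inc (d + 1) ;; Inc (d + 2)) ;;
     count_down (d + 1) (Inc (d + 2) ;; add_to (d + 1) (d + 2) (d + 3)) ;; move_to (d + 2) d"

text \<open>
  The enumeration inverse to \<open>prod_encode\<close> runs along the diagonals: \<open>(a, b)\<close> is followed by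
  \<open>(a + 1, b - 1)\<close>, and the last pair \<open>(a, 0)\<close> of a diagonal by \<open>(0, a + 1)\<close>. Decoding
  counts along this enumeration.
\<close>

definition next_pair :: "nat \<Rightarrow> nat \<Rightarrow> 's com" where
  "next_pair a b = Inc a ;; Cond (NonZero b) (Dec b) (move_to a b)"

definition decode_pair :: "nat \<Rightarrow> 's com" where
  "decode_pair d = count_down d (next_pair (d + 1) (d + 2))"

lemma runs_Inc': "v' = v(r := Suc (v r)) \<Longrightarrow> runs p (Inc r) (h, v, w) (h, v', w)"
  and runs_Dec': "v' = v(r := v r - 1) \<Longrightarrow> runs p (Dec r) (h, v, w) (h, v', w)"
  by (simp_all add: runs_Inc runs_Dec del: One_nat_def)

lemma runs_clear: "v' = v(r := 0) \<Longrightarrow> runs p (clear r) (h, v, w) (h, v', w)"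
  unfolding clear_def by (rule runs_count_down[where V = "\<lambda>_. v" and N = "v r"]) (auto simp: runs_Skip)

lemma runs_move_to:
  "a \<noteq> b \<Longrightarrow> v' = v(a := 0, b := v b + v a) \<Longrightarrow> runs p (move_to a b) (h, v, w) (h, v', w)"
  unfolding move_to_def
  by (rule runs_count_down[where V = "\<lambda>j. v(b := v b + j)" and N = "v a"]) (auto intro!: runs_Inc')

lemma runs_add_to:
  assumes "a \<noteq> b" "a \<noteq> t" "b \<noteq> t" "v t = 0" "v' = v(b := v b + v a)"
  shows "runs p (add_to a b t) (h, v, w) (h, v', w)"
proof -
  have "runs p (count_down a (Inc b ;; Inc t)) (h, v, w) (h, v(a := 0, b := v b + v a, t := v a), w)"
    by (rule runs_count_down[where V = "\<lambda>j. v(b := v b + j, t := j)" and N = "v a"])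
      (use assms in \<open>auto intro!: runs_Then[OF runs_Inc'[OF refl] runs_Inc']\<close>)
  then show ?thesis
    unfolding add_to_def by (rule runs_Then) (rule runs_move_to; use assms in auto)
qed

lemma triangle_mono: "i \<le> j \<Longrightarrow> triangle i \<le> triangle j"
  by (induction rule: dec_induct) auto

lemma runs_encode_pair:
  assumes "v (d + 2) = 0" "v (d + 3) = 0"
    and "v' = v(d := prod_encode (v d, v (d + 1)), d + 1 := 0)"
  shows "runs p (encode_pair d) (h, v, w) (h, v', w)"
proof -
  define N where "N = v d + v (d + 1)"
  let ?v1 = "v(d := 0, d + 1 := N, d + 2 := v d)"
  let ?V = "\<lambda>j. v(d := 0, d + 2 := v d + triangle N - triangle (N - j))"
  have 1: "runs p (count_down d (Inc (d + 1) ;; Inc (d + 2))) (h, v, w) (h, ?v1, w)"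
    by (rule runs_count_down[where V = "\<lambda>j. v(d + 1 := v (d + 1) + j, d + 2 := j)" and N = "v d"])
      (use assms in \<open>auto simp: N_def intro!: runs_Then[OF runs_Inc'[OF refl] runs_Inc']\<close>)
  have step: "triangle (N - j) = triangle (N - Suc j) + (N - j)" "triangle (N - j) \<le> triangle N"
    if "j < N" for j
  proof -
    have "N - j = Suc (N - Suc j)" using that by simp
    then show "triangle (N - j) = triangle (N - Suc j) + (N - j)" by (metis triangle_Suc)
    show "triangle (N - j) \<le> triangle N" by (simp add: triangle_mono)
  qed
  have 2: "runs p (count_down (d + 1) (Inc (d + 2) ;; add_to (d + 1) (d + 2) (d + 3)))
      (h, ?v1, w) (h, v(d := 0, d + 1 := 0, d + 2 := v d + triangle N), w)"
  proof (rule runs_count_down[where V = ?V and N = N])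
    fix j assume j: "j < N"
    show "runs p (Inc (d + 2) ;; add_to (d + 1) (d + 2) (d + 3))
        (h, (?V j)(d + 1 := N - Suc j), w) (h, (?V (Suc j))(d + 1 := N - Suc j), w)"
      by (rule runs_Then, rule runs_Inc', rule refl, rule runs_add_to)
        (use assms step[OF j] j in \<open>auto simp: fun_eq_iff\<close>)
  qed (auto simp: fun_eq_iff)
  have 3: "runs p (move_to (d + 2) d) (h, v(d := 0, d + 1 := 0, d + 2 := v d + triangle N), w) (h, v', w)"
    by (rule runs_move_to) (use assms in \<open>auto simp: fun_eq_iff prod_encode_def N_def\<close>)
  show ?thesis
    unfolding encode_pair_def by (rule runs_Then[OF 1 runs_Then[OF 2 3]])
qed

lemma prod_decode_Suc:
  "prod_decode (Suc x) = (case prod_decode x of (a, b) \<Rightarrow>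
     if b = 0 then (0, Suc a) else (Suc a, b - 1))"
proof -
  obtain a b where x: "x = prod_encode (a, b)" by (metis prod.collapse prod_decode_inverse)
  have "Suc x = prod_encode (if b = 0 then (0, Suc a) else (Suc a, b - 1))"
    by (cases b) (auto simp: x prod_encode_def)
  then show ?thesis by (simp add: x)
qed

lemma runs_decode_pair:
  assumes "v (d + 1) = 0" "v (d + 2) = 0"
    and "v' = v(d := 0, d + 1 := fst (prod_decode (v d)), d + 2 := snd (prod_decode (v d)))"
  shows "runs p (decode_pair d) (h, v, w) (h, v', w)"
  unfolding decode_pair_def
proof (rule runs_count_down[where N = "v d" and
      V = "\<lambda>j. v(d + 1 := fst (prod_decode j), d + 2 := snd (prod_decode j))"])
  fix j assume "j < v d"
  let ?V = "\<lambda>j. v(d + 1 := fst (prod_decode j), d + 2 := snd (prod_decode j))"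
  obtain a b where ab: "prod_decode j = (a, b)" by (cases "prod_decode j")
  show "runs p (next_pair (d + 1) (d + 2)) (h, (?V j)(d := v d - Suc j), w)
      (h, (?V (Suc j))(d := v d - Suc j), w)"
  proof (cases "b = 0")
    case True
    then show ?thesis
      unfolding next_pair_def using ab
      by (intro runs_Then[OF runs_Inc'[OF refl]] runs_Cond_False runs_move_to)
        (auto simp: prod_decode_Suc fun_eq_iff)
  next
    case False
    then show ?thesis
      unfolding next_pair_def using ab
      by (intro runs_Then[OF runs_Inc'[OF refl]] runs_Cond_True runs_Dec')
        (auto simp: prod_decode_Suc fun_eq_iff)
  qed
qed (use assms in \<open>auto simp: fun_eq_iff prod_decode_def prod_decode_aux.simps\<close>)

text \<open>
  The program for a function replaces the value \<open>x\<close> of counter \<open>d\<close> by the value at \<open>x\<close>. It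
  finds all counters above \<open>d\<close> zero and leaves them zero.
\<close>

fun prim_com :: "prim \<Rightarrow> nat \<Rightarrow> 's com" where
  "prim_com PZero d = clear d"
| "prim_com PSucc d = Inc d"
| "prim_com PId d = Skip"
| "prim_com PFst d = decode_pair d ;; clear (d + 2) ;; move_to (d + 1) d"
| "prim_com PSnd d = decode_pair d ;; clear (d + 1) ;; move_to (d + 2) d"
| "prim_com (PPair f g) d =
     add_to d (d + 1) (d + 2) ;; prim_com f (d + 1) ;;
     add_to d (d + 2) (d + 3) ;; prim_com g (d + 2) ;;
     clear d ;; encode_pair (d + 1) ;; move_to (d + 1) d"
| "prim_com (PComp f g) d = prim_com g d ;; prim_com f d"
| "prim_com (PIter f) d =
     decode_pair d ;; move_to (d + 2) d ;; count_down d (prim_com f (d + 1)) ;; move_to (d + 1) d"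

lemma runs_prim_com:
  assumes "\<And>r. r > d \<Longrightarrow> v r = 0" "v' = v(d := prim_eval f (v d))"
  shows "runs p (prim_com f d) (h, v, w) (h, v', w)"
  using assms
proof (induction f arbitrary: d v v')
  case PZero
  show ?case unfolding prim_com.simps by (rule runs_clear) (use PZero in \<open>simp add: fun_eq_iff\<close>)
next
  case PSucc
  show ?case unfolding prim_com.simps by (rule runs_Inc') (use PSucc in \<open>simp add: fun_eq_iff\<close>)
next
  case PId
  then have "v' = v" by (simp add: fun_eq_iff)
  then show ?case by (simp add: runs_Skip)
next
  case PFst
  show ?case
    unfolding prim_com.simps
    by (rule runs_Then, rule runs_decode_pair[OF _ _ refl], (use PFst in \<open>simp; fail\<close>)+,
        rule runs_Then, rule runs_clear[OF refl], rule runs_move_to)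
      (use PFst in \<open>auto simp: fun_eq_iff\<close>)
next
  case PSnd
  show ?case
    unfolding prim_com.simps
    by (rule runs_Then, rule runs_decode_pair[OF _ _ refl], (use PSnd in \<open>simp; fail\<close>)+,
        rule runs_Then, rule runs_clear[OF refl], rule runs_move_to)
      (use PSnd in \<open>auto simp: fun_eq_iff\<close>)
next
  case (PPair f g)
  let ?a = "prim_eval f (v d)" and ?b = "prim_eval g (v d)"
  show ?case
    unfolding prim_com.simps
  proof (intro runs_Then)
    show "runs p (add_to d (d + 1) (d + 2)) (h, v, w) (h, v(d + 1 := v d), w)"
      by (rule runs_add_to) (use PPair in auto)
    show "runs p (prim_com f (d + 1)) (h, v(d + 1 := v d), w) (h, v(d + 1 := ?a), w)"
      by (rule PPair.IH(1)) (use PPair.prems in auto)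
    show "runs p (add_to d (d + 2) (d + 3)) (h, v(d + 1 := ?a), w) (h, v(d + 1 := ?a, d + 2 := v d), w)"
      by (rule runs_add_to) (use PPair in auto)
    show "runs p (prim_com g (d + 2)) (h, v(d + 1 := ?a, d + 2 := v d), w)
        (h, v(d + 1 := ?a, d + 2 := ?b), w)"
      by (rule PPair.IH(2)) (use PPair.prems in auto)
    show "runs p (clear d) (h, v(d + 1 := ?a, d + 2 := ?b), w) (h, v(d := 0, d + 1 := ?a, d + 2 := ?b), w)"
      by (rule runs_clear) (auto simp: fun_eq_iff)
    show "runs p (encode_pair (d + 1)) (h, v(d := 0, d + 1 := ?a, d + 2 := ?b), w)
        (h, v(d := 0, d + 1 := prod_encode (?a, ?b)), w)"
      by (rule runs_encode_pair) (use PPair.prems in \<open>auto simp: fun_eq_iff\<close>)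
    show "runs p (move_to (d + 1) d) (h, v(d := 0, d + 1 := prod_encode (?a, ?b)), w) (h, v', w)"
      by (rule runs_move_to) (use PPair.prems in \<open>auto simp: fun_eq_iff\<close>)
  qed
next
  case (PComp f g)
  have "runs p (prim_com g d) (h, v, w) (h, v(d := prim_eval g (v d)), w)"
    by (rule PComp.IH(2)) (use PComp.prems in auto)
  moreover have "runs p (prim_com f d) (h, v(d := prim_eval g (v d)), w) (h, v', w)"
    by (rule PComp.IH(1)) (use PComp.prems in auto)
  ultimately show ?case by (simp add: runs_Then)
next
  case (PIter f)
  obtain x n where xn: "prod_decode (v d) = (x, n)" by (cases "prod_decode (v d)")
  show ?case
    unfolding prim_com.simps
  proof (intro runs_Then)
    show "runs p (decode_pair d) (h, v, w) (h, v(d := 0, d + 1 := x, d + 2 := n), w)"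
      by (rule runs_decode_pair) (use PIter.prems xn in auto)
    show "runs p (move_to (d + 2) d) (h, v(d := 0, d + 1 := x, d + 2 := n), w)
        (h, v(d := n, d + 1 := x), w)"
      by (rule runs_move_to) (use PIter.prems in \<open>auto simp: fun_eq_iff\<close>)
    show "runs p (count_down d (prim_com f (d + 1))) (h, v(d := n, d + 1 := x), w)
        (h, v(d := 0, d + 1 := (prim_eval f ^^ n) x), w)"
    proof (rule runs_count_down[where V = "\<lambda>j. v(d + 1 := (prim_eval f ^^ j) x)" and N = n])
      fix j assume "j < n"
      show "runs p (prim_com f (d + 1)) (h, v(d + 1 := (prim_eval f ^^ j) x, d := n - Suc j), w)
          (h, v(d + 1 := (prim_eval f ^^ Suc j) x, d := n - Suc j), w)"
        by (rule PIter.IH) (use PIter.prems in \<open>auto simp: fun_eq_iff\<close>)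
    qed (auto simp: fun_eq_iff)
    show "runs p (move_to (d + 1) d) (h, v(d := 0, d + 1 := (prim_eval f ^^ n) x), w) (h, v', w)"
      by (rule runs_move_to) (use PIter.prems xn in \<open>auto simp: fun_eq_iff\<close>)
  qed
qed

definition fitting :: "nat \<Rightarrow> 's com \<Rightarrow> bool" where
  "fitting n c \<longleftrightarrow> (\<exists>W. fits n W c)"

lemma cond_fits_mono: "cond_fits n W t \<Longrightarrow> W \<le> W' \<Longrightarrow> cond_fits n W' t"
  by (cases t) auto

lemma fits_mono: "fits n W c \<Longrightarrow> W \<le> W' \<Longrightarrow> fits n W' c"
  by (induction c) (auto intro: cond_fits_mono)

lemma fitting_Then [simp]: "fitting n (c ;; d) \<longleftrightarrow> fitting n c \<and> fitting n d"
  unfolding fitting_def by (auto intro: fits_mono) (metis fits_mono max.cobounded1 max.cobounded2)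

lemma fitting_While [simp]: "fitting n (While (NonZero r) c) \<longleftrightarrow> fitting n c"
proof
  assume "fitting n c"
  then obtain W where "fits n W c" by (auto simp: fitting_def)
  then have "fits n (max W (Suc r)) (While (NonZero r) c)" by (auto intro: fits_mono)
  then show "fitting n (While (NonZero r) c)" by (auto simp: fitting_def)
qed (auto simp: fitting_def)

lemma fitting_Cond: "fitting n c \<Longrightarrow> fitting n d \<Longrightarrow> (\<And>i a. t = Scanned i a \<Longrightarrow> i < n) \<Longrightarrow>
    fitting n (Cond t c d)"
proof -
  assume cd: "fitting n c" "fitting n d" and t: "\<And>i a. t = Scanned i a \<Longrightarrow> i < n"
  have "\<exists>W. cond_fits n W t" using t by (cases t) auto
  then obtain W1 W2 W3 where W: "fits n W1 c" "fits n W2 d" "cond_fits n W3 t"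
    using cd by (auto simp: fitting_def)
  let ?W = "max W1 (max W2 W3)"
  have "fits n ?W (Cond t c d)"
    using fits_mono[OF W(1), of ?W] fits_mono[OF W(2), of ?W] cond_fits_mono[OF W(3), of ?W] by auto
  then show ?thesis by (auto simp: fitting_def)
qed

lemma fitting_simple [simp]:
  "fitting n Skip" "fitting n (Inc r)" "fitting n (Dec r)" "fitting n (Emit a)"
  "fitting n (Advance i) \<longleftrightarrow> i < n"
  by (auto simp: fitting_def)

lemma fitting_count_down [simp]: "fitting n (count_down r c) \<longleftrightarrow> fitting n c"
  by (simp add: count_down_def)

lemma fitting_prim_com [simp]: "fitting n (prim_com f d)"
  by (induction f arbitrary: d)
    (auto simp: clear_def move_to_def add_to_def encode_pair_def decode_pair_def next_pair_def
      intro!: fitting_Cond)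

section \<open>Primitive recursion on structured data\<close>

text \<open>
  Codes of tuples, lists and integers by natural numbers. The closure rules below are stated for
  functions of a parameter \<open>x\<close>, so that a function that is written with the operations
  concerned is shown to be primitive recursive by following its syntax.
\<close>

class enc =
  fixes enc :: "'a \<Rightarrow> nat"
  assumes enc_inj: "enc x = enc y \<Longrightarrow> x = y"

instantiation nat :: enc
begin
definition enc_nat :: "nat \<Rightarrow> nat" where "enc_nat n = n"
instance by standard (simp add: enc_nat_def)
end

instantiation bool :: enc
begin
definition enc_bool :: "bool \<Rightarrow> nat" where "enc_bool b = (if b then 1 else 0)"
instance by standard (simp add: enc_bool_def split: if_splits)
end

instantiation prod :: (enc, enc) enc
begin
definition enc_prod :: "'a \<times> 'b \<Rightarrow> nat" where
  "enc_prod z = prod_encode (enc (fst z), enc (snd z))"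
instance by standard (auto simp: enc_prod_def dest: enc_inj intro: prod_eqI)
end

instantiation list :: (enc) enc
begin
definition enc_list :: "'a list \<Rightarrow> nat" where "enc_list xs = list_encode (map enc xs)"
instance
proof
  fix xs ys :: "'a list"
  assume "enc xs = enc ys"
  moreover have "inj (enc :: 'a \<Rightarrow> nat)" by (auto intro: injI enc_inj)
  ultimately show "xs = ys" by (simp add: enc_list_def list_encode_eq inj_map_eq_map)
qed
end

instantiation int :: enc
begin
definition enc_int :: "int \<Rightarrow> nat" where "enc_int i = enc (nat i, nat (- i))"
instance by standard (auto simp: enc_int_def enc_prod_def enc_nat_def)
end

lemma enc_simps:
  "enc (n :: nat) = n" "enc (x, y) = prod_encode (enc x, enc y)"
  "enc ([] :: 'a::enc list) = 0" "enc (z # zs) = Suc (enc (z, zs))"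
  by (simp_all add: enc_nat_def enc_prod_def enc_list_def)

definition pr :: "('a::enc \<Rightarrow> 'b::enc) \<Rightarrow> bool" where
  "pr f \<longleftrightarrow> (\<exists>P. \<forall>x. enc (f x) = prim_eval P (enc x))"

lemma prI: "(\<And>x. enc (f x) = prim_eval P (enc x)) \<Longrightarrow> pr f"
  unfolding pr_def by blast

lemma pr_comp: "pr f \<Longrightarrow> pr g \<Longrightarrow> pr (\<lambda>x. f (g x))"
  unfolding pr_def by (metis prim_eval.simps(7))

lemma pr_comp3:
  assumes "pr (\<lambda>z. f (fst z) (fst (snd z)) (snd (snd z)))" "pr (\<lambda>x. (g1 x, g2 x, g3 x))"
  shows "pr (\<lambda>x. f (g1 x) (g2 x) (g3 x))"
  using pr_comp[OF assms] by simp

lemma pr_prim_eval: "pr f \<Longrightarrow> pr (\<lambda>x. prim_eval P (f x))"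
  by (rule pr_comp[of "prim_eval P"], rule prI[of _ P]) (simp add: enc_simps)

lemma pr_enc_iff: "pr (\<lambda>x. enc (f x)) \<longleftrightarrow> pr f"
  by (simp add: pr_def enc_simps)

named_theorems pr_intros

lemma pr_enc [pr_intros]: "pr f \<Longrightarrow> pr (\<lambda>x. enc (f x))"
  by (simp add: pr_enc_iff)

lemma pr_id [pr_intros]: "pr (\<lambda>x. x)"
  by (rule prI[of _ PId]) simp

lemma pr_Pair [pr_intros]: "pr f \<Longrightarrow> pr g \<Longrightarrow> pr (\<lambda>x. (f x, g x))"
  unfolding pr_def enc_simps by (metis prim_eval.simps(6))

lemma pr_fst [pr_intros]: "pr f \<Longrightarrow> pr (\<lambda>x. fst (f x))"
  by (rule pr_comp[of fst], rule prI[of _ PFst]) (auto simp: enc_prod_def)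

lemma pr_snd [pr_intros]: "pr f \<Longrightarrow> pr (\<lambda>x. snd (f x))"
  by (rule pr_comp[of snd], rule prI[of _ PSnd]) (auto simp: enc_prod_def)

lemma pr_Suc [pr_intros]: "pr f \<Longrightarrow> pr (\<lambda>x. Suc (f x))"
  by (rule pr_comp[of Suc], rule prI[of _ PSucc]) (auto simp: enc_simps)

lemma pr_const [pr_intros]: "pr (\<lambda>x. c)"
proof -
  have "pr (\<lambda>x::'a. n)" for n :: nat
    by (induction n) (auto intro: pr_Suc prI[of _ PZero] simp: enc_simps)
  then have "pr (\<lambda>x::'a. enc c)" .
  then show ?thesis by (simp add: pr_enc_iff)
qed

lemma pr_funpow [pr_intros]:
  fixes f :: "'a::enc \<Rightarrow> 'b::enc \<Rightarrow> 'b"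
  assumes "pr n" "pr i" "pr (\<lambda>z. f (fst z) (snd z))"
  shows "pr (\<lambda>x. (f x ^^ n x) (i x))"
proof -
  from assms obtain N I F where
    N: "\<And>x. n x = prim_eval N (enc x)" and I: "\<And>x. enc (i x) = prim_eval I (enc x)"
    and F: "\<And>x y. enc (f x y) = prim_eval F (prod_encode (enc x, enc y))"
    by (fastforce simp: pr_def enc_simps)
  let ?step = "prim_eval (PPair PFst F)"
  have "(?step ^^ m) (prod_encode (enc x, enc y)) = prod_encode (enc x, enc ((f x ^^ m) y))" for m x y
    by (induction m) (auto simp: F)
  then show ?thesis
    by (intro prI[of _ "PComp PSnd (PComp (PIter (PPair PFst F)) (PPair (PPair PId I) N))"])
      (simp add: N[symmetric] I[symmetric])
qed

text \<open>A case distinction iterates a constant function at most once.\<close>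

lemma pr_if [pr_intros]:
  assumes "pr b" "pr f" "pr g"
  shows "pr (\<lambda>x. if b x then f x else g x)"
proof -
  have "pr (\<lambda>x. ((\<lambda>_. f x) ^^ enc (b x)) (g x))"
    by (intro pr_intros assms pr_comp[OF assms(2)])
  moreover have "((\<lambda>_. f x) ^^ enc (b x)) (g x) = (if b x then f x else g x)" for x
    by (simp add: enc_bool_def)
  ultimately show ?thesis by simp
qed

lemma pr_pred [pr_intros]:
  assumes "pr f"
  shows "pr (\<lambda>x. f x - 1 :: nat)"
proof -
  let ?step = "\<lambda>y::nat \<times> nat. (snd y, Suc (snd y))"
  have "(?step ^^ m) (0, 0) = (m - 1, m)" for m by (induction m) auto
  moreover have "pr (\<lambda>x. fst ((?step ^^ f x) (0, 0)))" by (intro pr_intros assms)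
  ultimately show ?thesis by simp
qed

lemma pr_diff [pr_intros]:
  assumes "pr f" "pr g"
  shows "pr (\<lambda>x. f x - g x :: nat)"
proof -
  have "((\<lambda>y. y - 1) ^^ m) n = n - m" for m n :: nat by (induction m) auto
  moreover have "pr (\<lambda>x. ((\<lambda>y. y - 1) ^^ g x) (f x))" by (intro pr_intros assms)
  ultimately show ?thesis by simp
qed

lemma pr_add [pr_intros]:
  assumes "pr f" "pr g"
  shows "pr (\<lambda>x. f x + g x :: nat)"
proof -
  have "(Suc ^^ m) n = n + m" for m n by (induction m) auto
  moreover have "pr (\<lambda>x. (Suc ^^ g x) (f x))" by (intro pr_intros assms)
  ultimately show ?thesis by (simp only:)
qed

lemma pr_is_zero:
  assumes "pr f"
  shows "pr (\<lambda>x. f x = (0 :: nat))"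
proof -
  have "((\<lambda>_. False) ^^ n) True \<longleftrightarrow> n = 0" for n by (cases n) auto
  moreover have "pr (\<lambda>x. ((\<lambda>_. False) ^^ f x) True)" by (intro pr_intros assms)
  ultimately show ?thesis by simp
qed

lemma pr_eq [pr_intros]:
  assumes "pr f" "pr g"
  shows "pr (\<lambda>x. f x = g x)"
proof -
  have "f x = g x \<longleftrightarrow> (enc (f x) - enc (g x)) + (enc (g x) - enc (f x)) = 0" for x
    by (auto intro: enc_inj)
  moreover have "pr (\<lambda>x. (enc (f x) - enc (g x)) + (enc (g x) - enc (f x)) = 0)"
    by (intro pr_is_zero pr_intros assms)
  ultimately show ?thesis by simp
qed

lemma pr_le [pr_intros]: "pr f \<Longrightarrow> pr g \<Longrightarrow> pr (\<lambda>x. f x \<le> (g x :: nat))"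
  using pr_is_zero[OF pr_diff[of f g]] by simp

lemma pr_less [pr_intros]: "pr f \<Longrightarrow> pr g \<Longrightarrow> pr (\<lambda>x. f x < (g x :: nat))"
  using pr_le[OF pr_Suc[of f], of g] by (simp add: Suc_le_eq)

lemma pr_conj [pr_intros]: "pr f \<Longrightarrow> pr g \<Longrightarrow> pr (\<lambda>x. f x \<and> g x)"
proof -
  assume "pr f" "pr g"
  then have "pr (\<lambda>x. if f x then g x else False)" by (intro pr_intros)
  moreover have "(if f x then g x else False) \<longleftrightarrow> f x \<and> g x" for x by simp
  ultimately show ?thesis by simp
qed

lemma pr_min [pr_intros]: "pr f \<Longrightarrow> pr g \<Longrightarrow> pr (\<lambda>x. min (f x) (g x) :: nat)"
  unfolding min_def by (intro pr_intros)


subsection \<open>Integers\<close>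

lemma pr_nat_of_int [pr_intros]: "pr f \<Longrightarrow> pr (\<lambda>x. nat (f x))"
  by (rule pr_comp[of nat], rule prI[of _ PFst]) (simp_all add: enc_int_def enc_simps)

lemma pr_uminus [pr_intros]: "pr f \<Longrightarrow> pr (\<lambda>x. - f x :: int)"
  by (rule pr_comp[of uminus], rule prI[of _ "PPair PSnd PFst"]) (simp_all add: enc_int_def enc_simps)

lemma pr_int_add [pr_intros]:
  assumes "pr f" "pr g"
  shows "pr (\<lambda>x. f x + g x :: int)"
proof -
  let ?p = "\<lambda>x. nat (f x) + nat (g x)" and ?n = "\<lambda>x. nat (- f x) + nat (- g x)"
  have "enc (f x + g x) = enc (?p x - ?n x, ?n x - ?p x)" for x
    unfolding enc_int_def by (rule arg_cong[of _ _ enc]) (auto simp: prod_eq_iff)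
  moreover have "pr (\<lambda>x. enc (?p x - ?n x, ?n x - ?p x))" by (intro pr_intros assms)
  ultimately have "pr (\<lambda>x. enc (f x + g x))" by simp
  then show ?thesis by (simp add: pr_enc_iff)
qed

lemma pr_int_nonneg [pr_intros]:
  assumes "pr f"
  shows "pr (\<lambda>x. 0 \<le> (f x :: int))"
proof -
  have "pr (\<lambda>x. nat (- f x) = 0)" by (intro pr_intros assms)
  moreover have "nat (- f x) = 0 \<longleftrightarrow> 0 \<le> f x" for x by auto
  ultimately show ?thesis by simp
qed


subsection \<open>Lists\<close>

lemma pr_Cons [pr_intros]:
  assumes "pr f" "pr g"
  shows "pr (\<lambda>x. f x # g x)"
proof -
  have "pr (\<lambda>x. Suc (enc (f x, g x)))" by (intro pr_intros assms)
  then show ?thesis using pr_enc_iff[of "\<lambda>x. f x # g x"] by (simp add: enc_simps(4))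
qed

lemma pr_case_list [pr_intros]:
  assumes "pr l" "pr a" "pr (\<lambda>z. f (fst z) (fst (snd z)) (snd (snd z)))"
  shows "pr (\<lambda>x. case l x of [] \<Rightarrow> a x | y # ys \<Rightarrow> f x y ys)"
proof -
  from assms(3) obtain F where F: "\<And>x y ys. enc (f x y ys) = prim_eval F (enc (x, y, ys))"
    unfolding pr_def by fastforce
  \<comment> \<open>The code of a list \<open>y # ys\<close> is the successor of the code of \<open>(y, ys)\<close>.\<close>
  have "enc (case l x of [] \<Rightarrow> a x | y # ys \<Rightarrow> f x y ys) =
      (if enc (l x) = 0 then enc (a x) else prim_eval F (enc (x, enc (l x) - 1)))" for x
    by (cases "l x") (simp_all add: enc_simps F)
  moreover have "pr (\<lambda>x. if enc (l x) = 0 then enc (a x) else prim_eval F (enc (x, enc (l x) - 1)))"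
    by (intro pr_intros pr_prim_eval assms)
  ultimately have "pr (\<lambda>x. enc (case l x of [] \<Rightarrow> a x | y # ys \<Rightarrow> f x y ys))" by simp
  then show ?thesis by (simp add: pr_enc_iff)
qed

lemma length_le_enc: "length xs \<le> enc xs"
proof (induction xs)
  case (Cons x xs)
  have "enc xs \<le> enc (x, xs)" by (simp add: enc_simps le_prod_encode_2)
  then show ?case using Cons by (simp add: enc_simps(4))
qed simp

text \<open>The code of a list bounds its length and hence the number of iterations that consume it.\<close>

lemma pr_fold [pr_intros]:
  assumes "pr l" "pr a" "pr (\<lambda>z. f (fst z) (fst (snd z)) (snd (snd z)))"
  shows "pr (\<lambda>x. fold (f x) (l x) (a x))"
proof -
  define step where
    "step x y = (case snd y of [] \<Rightarrow> y | u # us \<Rightarrow> (f x u (fst y), us))" for x y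
  have step_Nil: "(step x ^^ n) (b, []) = (b, [])" for x n b
    by (induction n) (auto simp: step_def)
  have "(step x ^^ n) (b, us) = (fold (f x) us b, [])" if "length us \<le> n" for n x b us
    using that
  proof (induction us arbitrary: b n)
    case (Cons u us)
    then obtain m where n: "n = Suc m" "length us \<le> m" by (cases n) auto
    have "(step x ^^ n) (b, u # us) = (step x ^^ m) (step x (b, u # us))"
      by (simp add: n funpow_swap1)
    moreover have "step x (b, u # us) = (f x u b, us)" by (simp add: step_def)
    ultimately show ?case using Cons.IH[OF n(2)] by simp
  qed (simp add: step_Nil)
  then have "fst ((step x ^^ enc (l x)) (a x, l x)) = fold (f x) (l x) (a x)" for x
    by (simp add: length_le_enc)
  moreover have "pr (\<lambda>x. fst ((step x ^^ enc (l x)) (a x, l x)))"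
    unfolding step_def
    by (intro pr_intros assms(1,2) pr_comp3[OF assms(3)])
  ultimately show ?thesis by simp
qed


lemma pr_rev [pr_intros]:
  assumes "pr l"
  shows "pr (\<lambda>x. rev (l x))"
proof -
  have "pr (\<lambda>x. fold (\<lambda>y ys. y # ys) (l x) [])" by (intro pr_intros assms)
  then show ?thesis by (simp add: rev_conv_fold)
qed

lemma pr_foldr [pr_intros]:
  assumes "pr l" "pr a" "pr (\<lambda>z. f (fst z) (fst (snd z)) (snd (snd z)))"
  shows "pr (\<lambda>x. foldr (f x) (l x) (a x))"
  unfolding foldr_conv_fold by (intro pr_intros assms)

lemma pr_map [pr_intros]:
  assumes "pr l" "pr (\<lambda>z. f (fst z) (snd z))"
  shows "pr (\<lambda>x. map (f x) (l x))"
proof -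
  have "map (f x) ys = foldr (\<lambda>y zs. f x y # zs) ys []" for x ys by (induction ys) auto
  moreover have "pr (\<lambda>x. foldr (\<lambda>y zs. f x y # zs) (l x) [])"
    using pr_comp[OF assms(2), of "\<lambda>z. (fst z, fst (snd z))" for z]
    by (intro pr_intros assms) (simp add: pr_intros)
  ultimately show ?thesis by simp
qed

lemma pr_append [pr_intros]:
  assumes "pr l" "pr m"
  shows "pr (\<lambda>x. l x @ m x)"
proof -
  have "foldr (\<lambda>y ys. y # ys) xs ys = xs @ ys" for xs ys :: "'b list" by (induction xs) auto
  moreover have "pr (\<lambda>x. foldr (\<lambda>y ys. y # ys) (l x) (m x))" by (intro pr_intros assms)
  ultimately show ?thesis by simp
qed

lemma pr_length [pr_intros]:
  assumes "pr l"
  shows "pr (\<lambda>x. length (l x))"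
proof -
  have "foldr (\<lambda>_. Suc) xs 0 = length xs" for xs :: "'b list" by (induction xs) auto
  moreover have "pr (\<lambda>x. foldr (\<lambda>y n. Suc n) (l x) 0)" by (intro pr_intros assms)
  ultimately show ?thesis by simp
qed

lemma pr_tl [pr_intros]:
  assumes "pr l"
  shows "pr (\<lambda>x. tl (l x))"
proof -
  have "tl xs = (case xs of [] \<Rightarrow> [] | y # ys \<Rightarrow> ys)" for xs :: "'b list" by (cases xs) auto
  then show ?thesis by (simp only:) (intro pr_intros assms)
qed

definition nth_or :: "'a \<Rightarrow> 'a list \<Rightarrow> nat \<Rightarrow> 'a" where
  "nth_or d xs n = (case (tl ^^ n) xs of [] \<Rightarrow> d | y # ys \<Rightarrow> y)"

lemma nth_or_eq: "nth_or d xs n = (if n < length xs then xs ! n else d)"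
proof -
  have "(tl ^^ n) xs = drop n xs" for n by (induction n) (auto simp: drop_Suc tl_drop)
  then show ?thesis
    by (auto simp: nth_or_def Cons_nth_drop_Suc[symmetric] split: list.split)
qed

lemma pr_nth_or [pr_intros]:
  assumes "pr d" "pr l" "pr n"
  shows "pr (\<lambda>x. nth_or (d x) (l x) (n x))"
  unfolding nth_or_def by (intro pr_intros assms)

text \<open>The second list is part of the state that is folded over the first one.\<close>

lemma pr_zip [pr_intros]:
  assumes "pr l" "pr m"
  shows "pr (\<lambda>x. zip (l x) (m x))"
proof -
  define step where "step = (\<lambda>u (z :: ('b \<times> 'c) list \<times> 'c list).
      case snd z of [] \<Rightarrow> z | v # vs \<Rightarrow> ((u, v) # fst z, vs))"
  have "rev (fst (fold step xs (acc, ys))) = rev acc @ zip xs ys" for xs ys acc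
  proof (induction xs arbitrary: ys acc)
    case (Cons x xs)
    show ?case
    proof (cases ys)
      case Nil
      then have "step x (acc, ys) = (acc, [])" by (simp add: step_def)
      then show ?thesis using Cons[of acc "[]"] Nil by simp
    next
      case (Cons v vs)
      then have "step x (acc, ys) = ((x, v) # acc, vs)" by (simp add: step_def)
      then show ?thesis using Cons.IH[of "(x, v) # acc" vs] Cons by simp
    qed
  qed simp
  from this[of _ "[]"] have "zip xs ys = rev (fst (fold step xs ([], ys)))" for xs ys by simp
  moreover have "pr (\<lambda>x. rev (fst (fold (\<lambda>u z. step u z) (l x) ([], m x))))"
    unfolding step_def by (intro pr_intros assms)
  ultimately show ?thesis by simp
qed

text \<open>
  An association list whose newest entry comes first describes a tape inscription: writing a cell
  is the addition of an entry.
\<close>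

definition lookup :: "'v \<Rightarrow> ('k \<times> 'v) list \<Rightarrow> 'k \<Rightarrow> 'v" where
  "lookup d lg k = foldr (\<lambda>e v. if fst e = k then snd e else v) lg d"

lemma lookup_simps [simp]:
  "lookup d [] k = d"
  "lookup d (e # lg) k = (if fst e = k then snd e else lookup d lg k)"
  by (simp_all add: lookup_def)

lemma pr_lookup [pr_intros]:
  assumes "pr d" "pr lg" "pr k"
  shows "pr (\<lambda>x. lookup (d x) (lg x) (k x))"
  unfolding lookup_def by (intro pr_intros assms pr_comp[OF assms(3)])


subsection \<open>Case distinctions over finite sets\<close>

text \<open>
  Finitely many cases, each with a primitive recursive function, combine to a primitive recursive
  function however the assignment of functions to cases is given. This applies to the
  transition tables of Type-2 machines and to the statements of generalized Turing machines.
\<close>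

lemma pr_finite_cases:
  assumes "finite S" "inj_on \<kappa> S" "pr d" "pr e" "\<And>s. s \<in> S \<Longrightarrow> pr (F s)"
  shows "\<exists>G. pr G \<and> (\<forall>s\<in>S. \<forall>x. d x = \<kappa> s \<longrightarrow> G x = F s x) \<and> (\<forall>x. d x \<notin> \<kappa> ` S \<longrightarrow> G x = e x)"
  using assms
proof (induction S)
  case empty
  then show ?case by auto
next
  case (insert s S)
  then obtain G where G: "pr G" "\<forall>s\<in>S. \<forall>x. d x = \<kappa> s \<longrightarrow> G x = F s x"
      "\<forall>x. d x \<notin> \<kappa> ` S \<longrightarrow> G x = e x"
    by (auto simp: inj_on_insert)
  have "pr (\<lambda>x. if d x = \<kappa> s then F s x else G x)"
    by (intro pr_intros insert.prems G(1)) auto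
  moreover have "\<kappa> s' \<noteq> \<kappa> s" if "s' \<in> S" for s'
    using that insert.prems(1) insert.hyps(2) by (auto simp: inj_on_def)
  ultimately show ?case
    using G(2,3) by (intro exI[of _ "\<lambda>x. if d x = \<kappa> s then F s x else G x"]) auto
qed

lemma pr_finite_table:
  assumes "finite S" "inj_on \<kappa> S"
  shows "\<exists>G. pr G \<and> (\<forall>s\<in>S. G (\<kappa> s) = F s)"
  using pr_finite_cases[OF assms pr_id pr_const, of "\<lambda>s _. F s" undefined] pr_const by blast

section \<open>Primitive recursive transducers\<close>

definition com_seq :: "'s com list \<Rightarrow> 's com" where
  "com_seq cs = foldr (;;) cs Skip"

lemma com_seq_simps [simp]: "com_seq [] = Skip" "com_seq (c # cs) = c ;; com_seq cs"
  by (simp_all add: com_seq_def)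

lemma fitting_com_seq [simp]: "fitting n (com_seq cs) \<longleftrightarrow> (\<forall>c\<in>set cs. fitting n c)"
  by (induction cs) auto

lemma runs_com_seq:
  "(\<And>j. j < length cs \<Longrightarrow> runs p (cs ! j) (S j) (S (Suc j))) \<Longrightarrow>
    runs p (com_seq cs) (S 0) (S (length cs))"
proof (induction cs arbitrary: S)
  case (Cons c cs)
  have "runs p (cs ! j) (S (Suc j)) (S (Suc (Suc j)))" if "j < length cs" for j
    using Cons.prems[of "Suc j"] that by simp
  from Cons.IH[of "\<lambda>j. S (Suc j)", OF this] Cons.prems[of 0] show ?case
    by (auto intro: runs_Then)
qed (simp add: runs_Skip)

definition increase :: "nat \<Rightarrow> nat \<Rightarrow> 's com" where
  "increase r n = com_seq (replicate n (Inc r))"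

lemma runs_increase: "v' = v(r := v r + n) \<Longrightarrow> runs p (increase r n) (h, v, w) (h, v', w)"
  using runs_com_seq[of "replicate n (Inc r)" p "\<lambda>j. (h, v(r := v r + j), w)"]
  by (simp add: increase_def runs_Inc')

definition case_scanned :: "'s list \<Rightarrow> nat \<Rightarrow> ('s \<Rightarrow> 's com) \<Rightarrow> 's com" where
  "case_scanned as i f = com_seq (map (\<lambda>a. Cond (Scanned i a) (f a) Skip) as)"

lemma runs_case_scanned:
  assumes "distinct as" "a \<in> set as" "a = p i (h i)" "runs p (f a) (h, v, w) (h, v', w')"
  shows "runs p (case_scanned as i f) (h, v, w) (h, v', w')"
proof -
  have skip: "runs p (case_scanned bs i f) (h, u, w') (h, u, w')" if "a \<notin> set bs" for bs u w'
    using that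
    by (induction bs) (use assms(3) in \<open>auto simp: case_scanned_def
        intro!: runs_Then[OF runs_Cond_False[OF _ runs_Skip]] runs_Skip\<close>)
  show ?thesis
    using assms(1,2)
  proof (induction as)
    case (Cons b as)
    show ?case
    proof (cases "b = a")
      case True
      then have "runs p (Cond (Scanned i b) (f b) Skip) (h, v, w) (h, v', w')"
        using assms(3,4) by (intro runs_Cond_True) auto
      then show ?thesis
        using skip[of as] Cons.prems True by (auto simp: case_scanned_def intro: runs_Then)
    next
      case False
      then have "runs p (Cond (Scanned i b) (f b) Skip) (h, v, w) (h, v, w)"
        using assms(3) by (intro runs_Cond_False runs_Skip) auto
      then show ?thesis
        using Cons False by (auto simp: case_scanned_def intro: runs_Then)
    qed
  qed simp
qed

text \<open>
  Counter \<open>1\<close> holds the code of the current data, counter \<open>0\<close> keeps the main loop running.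
\<close>

definition read_letter :: "'s list \<Rightarrow> ('s \<Rightarrow> nat) \<Rightarrow> prim \<Rightarrow> nat \<Rightarrow> 's com" where
  "read_letter as code F i =
     case_scanned as i (\<lambda>a. increase 2 (enc (i, code a))) ;; Advance i ;; encode_pair 1 ;; prim_com F 1"

lemma runs_read_letter:
  assumes "distinct as" "set as = UNIV" "\<And>r. r > 1 \<Longrightarrow> v r = 0"
    and "h' = h(i := Suc (h i))"
    and "v' = v(1 := prim_eval F (prod_encode (v 1, enc (i, code (p i (h i))))))"
  shows "runs p (read_letter as code F i) (h, v, w) (h', v', w)"
proof -
  let ?c = "enc (i, code (p i (h i)))"
  show ?thesis
    unfolding read_letter_def
  proof (intro runs_Then)
    show "runs p (case_scanned as i (\<lambda>a. increase 2 (enc (i, code a)))) (h, v, w) (h, v(2 := ?c), w)"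
      by (rule runs_case_scanned, rule assms(1), (simp add: assms(2)), rule refl, rule runs_increase)
        (simp add: assms(3))
    show "runs p (Advance i) (h, v(2 := ?c), w) (h', v(2 := ?c), w)"
      unfolding assms(4) by (rule runs_Advance)
    show "runs p (encode_pair 1) (h', v(2 := ?c), w) (h', v(1 := prod_encode (v 1, ?c)), w)"
      by (rule runs_encode_pair) (simp_all add: assms(3) fun_eq_iff numeral_2_eq_2)
    show "runs p (prim_com F 1) (h', v(1 := prod_encode (v 1, ?c)), w) (h', v', w)"
      by (rule runs_prim_com) (simp_all add: assms(3,5) fun_eq_iff)
  qed
qed

definition emit_if :: "('s \<Rightarrow> prim) \<Rightarrow> 's \<Rightarrow> 's com" where
  "emit_if G a = add_to 1 2 3 ;; prim_com (G a) 2 ;; Cond (NonZero 2) (Emit a ;; clear 2) Skip"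

lemma runs_emit_if:
  assumes v: "\<And>r. r > 1 \<Longrightarrow> v r = 0"
  shows "runs p (emit_if G a) (h, v, w) (h, v, w @ (if prim_eval (G a) (v 1) \<noteq> 0 then [a] else []))"
  unfolding emit_if_def
proof (intro runs_Then)
  let ?b = "prim_eval (G a) (v 1)"
  show "runs p (add_to 1 2 3) (h, v, w) (h, v(2 := v 1), w)"
    by (rule runs_add_to) (simp_all add: v)
  show "runs p (prim_com (G a) 2) (h, v(2 := v 1), w) (h, v(2 := ?b), w)"
    by (rule runs_prim_com) (simp_all add: v)
  show "runs p (Cond (NonZero 2) (Emit a ;; clear 2) Skip) (h, v(2 := ?b), w)
      (h, v, w @ (if ?b \<noteq> 0 then [a] else []))"
  proof (cases "?b = 0")
    case True
    then have "v(2 := ?b) = v" using v by (simp add: fun_eq_iff)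
    then show ?thesis using True by (simp add: runs_Cond_False runs_Skip v)
  next
    case False
    moreover have "runs p (clear 2) (h, v(2 := ?b), w @ [a]) (h, v, w @ [a])"
      by (rule runs_clear) (simp add: v fun_eq_iff)
    ultimately show ?thesis by (auto intro!: runs_Cond_True runs_Then[OF runs_Emit])
  qed
qed

fun history :: "('s \<Rightarrow> nat) \<Rightarrow> (nat \<Rightarrow> nat \<Rightarrow> 's) \<Rightarrow> nat \<Rightarrow> nat \<Rightarrow> (nat \<times> nat) list" where
  "history code p n 0 = []"
| "history code p n (Suc N) = rev (map (\<lambda>i. (i, code (p i N))) [0..<n]) @ history code p n N"

text \<open>
  A word function that is evaluated on longer and longer prefixes of the inputs determines a
  computable function on sequences if its values are prefixes of the result and grow beyond all
  bounds. The machine reads one letter of each input per stage, evaluates the word function and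
  emits the next letter if the value is long enough to contain it; the data consist of the
  number \<open>N\<close> of the stage, the number \<open>m\<close> of letters emitted so far and the letters read.
\<close>

theorem transducer_computes:
  fixes st :: "nat \<times> (nat \<times> nat) list \<Rightarrow> nat list" and code :: "'s::finite \<Rightarrow> nat"
  assumes st: "pr st" and code: "inj code"
  shows "\<exists>U. wf_t2 n U \<and> (\<forall>p q len.
      (\<forall>N. st (N, history code p n (Suc N)) = map (\<lambda>j. code (q j)) [0..<len N]) \<longrightarrow>
      (\<forall>j. \<exists>N0. \<forall>N\<ge>N0. j \<le> len N) \<longrightarrow>
      Seq q \<in> t2_result U (map (\<lambda>i. Seq (p i)) [0..<n]))"
proof -
  define word where "word z = st (fst (fst z), snd z)" for z :: "(nat \<times> nat) \<times> (nat \<times> nat) list"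
  define add_letter where "add_letter z = (fst (fst z), snd z # snd (fst z))"
    for z :: "((nat \<times> nat) \<times> (nat \<times> nat) list) \<times> nat \<times> nat"
  define is_next where "is_next a z \<longleftrightarrow> snd (fst z) < length (word z) \<and>
      nth_or 0 (word z) (snd (fst z)) = code a" for a z
  define tick where "tick z = ((Suc (fst (fst z)),
      if snd (fst z) < length (word z) then Suc (snd (fst z)) else snd (fst z)), snd z)" for z
  have word: "pr word"
    unfolding word_def by (intro pr_comp[OF st] pr_intros)
  have "pr add_letter" unfolding add_letter_def by (intro pr_intros)
  then obtain F where F: "\<And>z. enc (add_letter z) = prim_eval F (enc z)" unfolding pr_def by blast
  have "pr (is_next a)" for a unfolding is_next_def by (intro pr_intros word)
  then obtain G where G: "\<And>a z. enc (is_next a z) = prim_eval (G a) (enc z)"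
    unfolding pr_def by metis
  have "pr tick" unfolding tick_def by (intro pr_intros word)
  then obtain H where H: "\<And>z. enc (tick z) = prim_eval H (enc z)" unfolding pr_def by blast
  obtain as :: "'s list" where as: "set as = UNIV" "distinct as"
    using finite_distinct_list[of "UNIV :: 's set"] by auto
  define body where "body = com_seq (map (read_letter as code F) [0..<n]) ;;
      com_seq (map (emit_if G) as) ;; prim_com H 1"
  define prog where "prog = Inc 0 ;; While (NonZero 0) body"
  have "fitting n prog"
    by (auto simp: prog_def body_def read_letter_def emit_if_def case_scanned_def increase_def
        encode_pair_def add_to_def move_to_def clear_def intro!: fitting_Cond)
  then obtain W where fits: "fits n W prog" by (auto simp: fitting_def)
  have "Seq q \<in> t2_result (com_machine n W prog) (map (\<lambda>i. Seq (p i)) [0..<n])"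
    if prefix: "\<And>N. st (N, history code p n (Suc N)) = map (\<lambda>j. code (q j)) [0..<len N]"
      and grows: "\<And>j. \<exists>N0. \<forall>N\<ge>N0. j \<le> len N" for p q len
  proof -
    define m where "m = rec_nat 0 (\<lambda>N k. if k < len N then Suc k else k)"
    have m: "m 0 = 0" "m (Suc N) = (if m N < len N then Suc (m N) else m N)" for N
      by (simp_all add: m_def)
    define data where "data N = ((N, m N), history code p n N)" for N
    define heads where "heads N i = (if i < n then N else 0)" for N i :: nat
    define regs where "regs x = (\<lambda>_::nat. 0)(0 := 1, 1 := enc x)"
      for x :: "(nat \<times> nat) \<times> (nat \<times> nat) list"
    have regs: "regs x r = 0" if "r > 1" for x r using that by (simp add: regs_def)
    \<comment> \<open>the state at the head of the main loop before stage \<open>N\<close>\<close>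
    define S where "S N = (heads N, regs (data N), map q [0..<m N])" for N
    define z where "z N = ((N, m N), history code p n (Suc N))" for N
    have word_z: "word (z N) = map (\<lambda>j. code (q j)) [0..<len N]" for N
      using prefix by (simp add: z_def word_def)
    have fst_z: "fst (z N) = (N, m N)" for N by (simp add: z_def)
    have body: "runs p body (S N) (S (Suc N))" for N
    proof -
      let ?w = "map q [0..<m N]"
      \<comment> \<open>the state when the inputs below \<open>j\<close> have been read\<close>
      define R where "R j = (\<lambda>i. if i < j then Suc N else heads N i,
          regs ((N, m N), rev (map (\<lambda>i. (i, code (p i N))) [0..<j]) @ history code p n N), ?w)" for j
      have "runs p (read_letter as code F j) (R j) (R (Suc j))" if "j < n" for j
        unfolding R_def
      proof (rule runs_read_letter[OF as(2,1)])
        show "regs ((N, m N), rev (map (\<lambda>i. (i, code (p i N))) [0..<Suc j]) @ history code p n N) =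
          (regs ((N, m N), rev (map (\<lambda>i. (i, code (p i N))) [0..<j]) @ history code p n N))
            (1 := prim_eval F (prod_encode
              (regs ((N, m N), rev (map (\<lambda>i. (i, code (p i N))) [0..<j]) @ history code p n N) 1,
               enc (j, code (p j (if j < j then Suc N else heads N j))))))"
          using that by (simp add: regs_def F[symmetric] enc_simps(2)[symmetric] add_letter_def heads_def)
      qed (use that in \<open>auto simp: regs heads_def\<close>)
      then have "runs p (com_seq (map (read_letter as code F) [0..<n])) (R 0) (R n)"
        using runs_com_seq[of "map (read_letter as code F) [0..<n]" p R] by simp
      moreover have "R 0 = S N"
        by (simp add: R_def S_def data_def)
      moreover have "R n = (heads (Suc N), regs (z N), ?w)"
        by (auto simp: R_def heads_def z_def)
      ultimately have 1: "runs p (com_seq (map (read_letter as code F) [0..<n])) (S N)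
          (heads (Suc N), regs (z N), ?w)" by simp
      define out where "out bs = concat (map (\<lambda>a. if is_next a (z N) then [a] else []) bs)" for bs
      have out: "runs p (com_seq (map (emit_if G) bs)) (heads (Suc N), regs (z N), u)
          (heads (Suc N), regs (z N), u @ out bs)" for bs u
      proof (induction bs arbitrary: u)
        case (Cons a bs)
        have "prim_eval (G a) (regs (z N) 1) \<noteq> 0 \<longleftrightarrow> is_next a (z N)"
          by (simp add: regs_def G[symmetric] enc_bool_def)
        then have "runs p (emit_if G a) (heads (Suc N), regs (z N), u)
            (heads (Suc N), regs (z N), u @ (if is_next a (z N) then [a] else []))"
          using runs_emit_if[of "regs (z N)" p G a, OF regs] by simp
        then show ?case
          using Cons[of "u @ (if is_next a (z N) then [a] else [])"]
          by (auto simp: out_def intro: runs_Then)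
      qed (simp add: runs_Skip out_def)
      have "?w @ out as = map q [0..<m (Suc N)]"
      proof (cases "m N < len N")
        case True
        then have "is_next a (z N) \<longleftrightarrow> a = q (m N)" for a
          using code by (auto simp: is_next_def word_z fst_z nth_or_eq inj_def)
        then have "out as = concat (map (\<lambda>a. if a = q (m N) then [a] else []) as)"
          by (simp add: out_def)
        moreover have "concat (map (\<lambda>a. if a = b then [a] else []) bs) = (if b \<in> set bs then [b] else [])"
          if "distinct bs" for b and bs :: "'s list"
          using that by (induction bs) auto
        ultimately show ?thesis using True as by (simp add: m)
      next
        case False
        then have "\<not> is_next a (z N)" for a by (simp add: is_next_def word_z fst_z)
        then show ?thesis using False by (simp add: m out_def)
      qed
      with out[of as ?w] have 2: "runs p (com_seq (map (emit_if G) as)) (heads (Suc N), regs (z N), ?w)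
          (heads (Suc N), regs (z N), map q [0..<m (Suc N)])" by simp
      have "tick (z N) = data (Suc N)"
        by (simp add: tick_def word_z data_def m fst_z) (simp add: z_def)
      then have 3: "runs p (prim_com H 1) (heads (Suc N), regs (z N), map q [0..<m (Suc N)]) (S (Suc N))"
        unfolding S_def
        by (intro runs_prim_com) (auto simp: regs regs_def H[symmetric])
      show ?thesis unfolding body_def by (rule runs_Then[OF 1 runs_Then[OF 2 3]])
    qed
    \<comment> \<open>The initial data have code \<open>0\<close>, the initial value of the counter.\<close>
    have "enc (data 0) = 0"
      by (simp add: data_def m enc_simps prod_encode_def)
    then have start: "runs p (Inc 0) ((\<lambda>_. 0), (\<lambda>_. 0), []) (S 0)"
      unfolding S_def by (simp add: m heads_def[abs_def]) (rule runs_Inc', simp add: regs_def fun_eq_iff)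
    have "\<exists>N. j \<le> m N" for j
    proof (induction j)
      case (Suc j)
      then obtain N where N: "j \<le> m N" by blast
      obtain N0 where N0: "\<And>N. N \<ge> N0 \<Longrightarrow> Suc j \<le> len N" using grows by blast
      have "mono m" by (rule mono_iff_le_Suc[THEN iffD2]) (simp add: m)
      then have "j \<le> m (max N N0)" using N by (meson max.cobounded1 monoD order_trans)
      moreover have "Suc j \<le> len (max N N0)" using N0 by simp
      ultimately have "Suc j \<le> m (Suc (max N N0))" by (simp add: m)
      then show ?case by blast
    qed simp
    then show ?thesis
      unfolding prog_def
      by (intro forever_result[where S = S and m = m, OF fits[unfolded prog_def] start body])
        (simp_all add: S_def regs_def m)
  qed
  then show ?thesis using wf_com_machine by blast
qed

section \<open>Simulation of Type-2 machines on finite prefixes\<close>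

instance sym :: (countable) countable by countable_datatype

definition letter_code :: "'s::finite \<Rightarrow> nat" where
  "letter_code a = to_nat (Letter a)"

lemma inj_letter_code: "inj letter_code"
  by (simp add: letter_code_def inj_def)

text \<open>The word may have any length, including \<open>0\<close>: only the letters that it has are prescribed.\<close>

definition codes_prefix :: "nat list \<Rightarrow> (nat \<Rightarrow> 's::finite) \<Rightarrow> bool" where
  "codes_prefix w p \<longleftrightarrow> (\<forall>j<length w. w ! j = letter_code (p j))"

text \<open>
  A simulated configuration consists of the state, the positions of the input heads, the work tapes
  (an association list and a head position each) and the output. Symbols are represented by
  their codes, \<open>bl\<close> being the code of the blank.
\<close>

type_synonym t2_sim = "nat \<times> int list \<times> ((int \<times> nat) list \<times> int) list \<times> nat list"

definition sim_input :: "nat \<Rightarrow> nat list \<Rightarrow> int \<Rightarrow> nat" where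
  "sim_input bl w h = (if 0 \<le> h then nth_or bl w (nat h) else bl)"

definition sim_scanned :: "nat \<Rightarrow> nat list list \<Rightarrow> t2_sim \<Rightarrow> nat \<times> nat list \<times> nat list" where
  "sim_scanned bl ws d =
     (fst d, map (\<lambda>e. sim_input bl (fst e) (snd e)) (zip ws (fst (snd d))),
      map (\<lambda>e. lookup bl (fst e) (snd e)) (fst (snd (snd d))))"

definition sim_update :: "t2_sim \<Rightarrow> nat \<times> int list \<times> (nat \<times> int) list \<times> nat list \<Rightarrow> t2_sim" where
  "sim_update d r =
     (fst r, map (\<lambda>e. fst e + snd e) (zip (fst (snd d)) (fst (snd r))),
      map (\<lambda>e. ((snd (fst e), fst (snd e)) # fst (fst e), snd (fst e) + snd (snd e)))
        (zip (fst (snd (snd d))) (fst (snd (snd r)))),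
      snd (snd (snd d)) @ snd (snd (snd r)))"

definition sim_step :: "(nat \<times> nat list \<times> nat list \<Rightarrow> nat \<times> int list \<times> (nat \<times> int) list \<times> nat list) \<Rightarrow>
    nat \<Rightarrow> nat \<Rightarrow> nat list list \<Rightarrow> t2_sim \<Rightarrow> t2_sim" where
  "sim_step tb halt bl ws d = (if fst d = halt then d else sim_update d (tb (sim_scanned bl ws d)))"

lemma pr_sim_step:
  assumes "pr tb" "pr ws" "pr d"
  shows "pr (\<lambda>x. sim_step tb halt bl (ws x) (d x))"
  unfolding sim_step_def sim_update_def sim_scanned_def sim_input_def
  by (intro pr_intros assms pr_comp[OF assms(1)] pr_comp[OF assms(2)] pr_comp[OF assms(3)])

text \<open>Every cell of a work tape holds a symbol of the machine, so only finitely many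
  arguments of the transition function matter.\<close>

definition t2_valid :: "nat \<Rightarrow> 's t2_machine \<Rightarrow> 's t2_config \<Rightarrow> bool" where
  "t2_valid n M c \<longleftrightarrow> c_state c \<in> t2_states M \<and> length (c_heads c) = n \<and>
     length (c_works c) = t2_works M \<and> (\<forall>e\<in>set (c_works c). range (fst e) \<subseteq> t2_syms M)"

definition action_code :: "nat \<times> move list \<times> ('s::finite sym \<times> move) list \<times> 's option \<Rightarrow>
    nat \<times> int list \<times> (nat \<times> int) list \<times> nat list" where
  "action_code r = (fst r, map shift (fst (snd r)),
     map (\<lambda>e. (to_nat (fst e), shift (snd e))) (fst (snd (snd r))),
     (case snd (snd (snd r)) of None \<Rightarrow> [] | Some a \<Rightarrow> [letter_code a]))"

definition table_of :: "nat \<Rightarrow> 's::finite t2_machine \<Rightarrow>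
    (nat \<times> nat list \<times> nat list \<Rightarrow> nat \<times> int list \<times> (nat \<times> int) list \<times> nat list) \<Rightarrow> bool" where
  "table_of n M tb \<longleftrightarrow> (\<forall>q ins wks. q \<in> t2_states M \<and>
      length ins = n \<and> set ins \<subseteq> insert Blank (range Letter) \<and>
      length wks = t2_works M \<and> set wks \<subseteq> t2_syms M \<longrightarrow>
      tb (q, map to_nat ins, map to_nat wks) = action_code (t2_trans M q ins wks))"

lemma exists_pr_table:
  fixes M :: "'s::finite t2_machine"
  assumes "wf_t2 n M"
  shows "\<exists>tb. pr tb \<and> table_of n M tb"
proof -
  let ?I = "{ins :: 's sym list. set ins \<subseteq> insert Blank (range Letter) \<and> length ins = n}"
  let ?W = "{wks. set wks \<subseteq> t2_syms M \<and> length wks = t2_works M}"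
  let ?k = "\<lambda>z :: nat \<times> 's sym list \<times> 's sym list.
    (fst z, map to_nat (fst (snd z)) :: nat list, map to_nat (snd (snd z)) :: nat list)"
  have fin: "finite (t2_states M \<times> ?I \<times> ?W)"
    using assms unfolding wf_t2_def by (intro finite_cartesian_product finite_lists_length_eq) auto
  have "inj ?k"
    by (auto simp: inj_def prod_eq_iff)
  then have inj: "inj_on ?k (t2_states M \<times> ?I \<times> ?W)" by (rule inj_on_subset) simp
  obtain tb where "pr tb" "\<forall>z \<in> t2_states M \<times> ?I \<times> ?W.
      tb (?k z) = action_code (t2_trans M (fst z) (fst (snd z)) (snd (snd z)))"
    using pr_finite_table[OF fin inj, of "\<lambda>z. action_code (t2_trans M (fst z) (fst (snd z)) (snd (snd z)))"]
    by blast
  then show ?thesis unfolding table_of_def by (intro exI[of _ tb]) auto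
qed

definition sim_rel :: "nat \<Rightarrow> 's::finite t2_machine \<Rightarrow> 's t2_config \<Rightarrow> t2_sim \<Rightarrow> bool" where
  "sim_rel n M c d \<longleftrightarrow> t2_valid n M c \<and>
     fst d = c_state c \<and> fst (snd d) = c_heads c \<and>
     list_all2 (\<lambda>e e'. snd e' = snd e \<and> (\<forall>j. lookup (to_nat (Blank :: 's sym)) (fst e') j = to_nat (fst e j)))
       (c_works c) (fst (snd (snd d))) \<and>
     snd (snd (snd d)) = map letter_code (c_out c)"

lemma t2_trans_closed:
  assumes "wf_t2 n M" "q \<in> t2_states M" "q \<noteq> t2_halt M"
    "length ins = n" "set ins \<subseteq> insert Blank (range Letter)"
    "length wks = t2_works M" "set wks \<subseteq> t2_syms M" "t2_trans M q ins wks = (q', mvs, acts, out)"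
  shows "q' \<in> t2_states M \<and> length mvs = n \<and> length acts = t2_works M \<and> fst ` set acts \<subseteq> t2_syms M"
  using assms(1)[unfolded wf_t2_def, THEN conjunct2, THEN conjunct2, THEN conjunct2, THEN conjunct2,
      THEN conjunct2, rule_format, OF conjI, OF assms(2)] assms(3-) by blast

lemma sim_rel_step:
  fixes M :: "'s::finite t2_machine"
  defines "bl \<equiv> to_nat (Blank :: 's sym)"
  assumes wf: "wf_t2 n M" and tb: "table_of n M tb" and rel: "sim_rel n M c d"
    and len: "length ps = n" "length ws = n"
    and input: "\<And>i. i < n \<Longrightarrow>
      sim_input bl (ws ! i) (c_heads c ! i) = to_nat (input_tape (ps ! i) (c_heads c ! i))"
  shows "sim_rel n M (t2_step M ps c) (sim_step tb (t2_halt M) bl ws d)"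
    and "i < n \<Longrightarrow> c_heads (t2_step M ps c) ! i \<le> c_heads c ! i + 1"
proof -
  have "sim_rel n M (t2_step M ps c) (sim_step tb (t2_halt M) bl ws d) \<and>
    (\<forall>i<n. c_heads (t2_step M ps c) ! i \<le> c_heads c ! i + 1)"
  proof (cases "c_state c = t2_halt M")
    case True
    then show ?thesis using rel by (simp add: t2_step_def sim_step_def sim_rel_def)
  next
    case False
    define ins where "ins = map2 input_tape ps (c_heads c)"
    define wks where "wks = map (\<lambda>(t, h). t h) (c_works c)"
    have valid: "t2_valid n M c" and d: "fst d = c_state c" "fst (snd d) = c_heads c"
      "snd (snd (snd d)) = map letter_code (c_out c)"
      and tapes: "list_all2 (\<lambda>e e'. snd e' = snd e \<and> (\<forall>j. lookup bl (fst e') j = to_nat (fst e j)))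
        (c_works c) (fst (snd (snd d)))"
      using rel by (simp_all add: sim_rel_def bl_def)
    have lens: "length (c_heads c) = n" "length (c_works c) = t2_works M"
      "length (fst (snd (snd d))) = t2_works M"
      using valid list_all2_lengthD[OF tapes] by (auto simp: t2_valid_def)
    have "input_tape x j \<in> insert Blank (range Letter)" for x :: "'s elem" and j
      by (cases x) auto
    then have ins: "length ins = n" "set ins \<subseteq> insert Blank (range Letter)"
      using len lens by (auto simp: ins_def)
    have wks: "length wks = t2_works M" "set wks \<subseteq> t2_syms M"
      using valid lens by (fastforce simp: wks_def t2_valid_def)+
    obtain q mvs acts out where tr: "t2_trans M (c_state c) ins wks = (q, mvs, acts, out)"
      by (cases "t2_trans M (c_state c) ins wks") auto
    have res: "q \<in> t2_states M" "length mvs = n" "length acts = t2_works M" "fst ` set acts \<subseteq> t2_syms M"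
      using t2_trans_closed[OF wf _ False ins wks tr] valid by (auto simp: t2_valid_def)
    have "map (\<lambda>e. sim_input bl (fst e) (snd e)) (zip ws (fst (snd d))) = map to_nat ins"
      using input len lens by (intro nth_equalityI) (simp_all add: d ins_def)
    moreover have "map (\<lambda>e. lookup bl (fst e) (snd e)) (fst (snd (snd d))) = map to_nat wks"
      using tapes by (intro nth_equalityI) (simp_all add: lens wks_def list_all2_conv_all_nth split_beta)
    ultimately have "tb (sim_scanned bl ws d) = action_code (q, mvs, acts, out)"
      using tb ins wks valid tr unfolding table_of_def t2_valid_def
      by (simp add: sim_scanned_def d)
    then have step: "sim_step tb (t2_halt M) bl ws d = sim_update d (action_code (q, mvs, acts, out))"
      using False by (simp add: sim_step_def d)
    define c' where "c' = t2_step M ps c"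
    have c': "c_state c' = q" "c_heads c' = map2 (\<lambda>h m. h + shift m) (c_heads c) mvs"
      "c_works c' = map2 (\<lambda>(t, h) (a, m). (t(h := a), h + shift m)) (c_works c) acts"
      "c_out c' = c_out c @ (case out of None \<Rightarrow> [] | Some a \<Rightarrow> [a])"
      using False tr by (simp_all add: c'_def t2_step_def ins_def wks_def)
    have work: "c_works c' ! r = ((fst (c_works c ! r))(snd (c_works c ! r) := fst (acts ! r)),
        snd (c_works c ! r) + shift (snd (acts ! r)))" if "r < t2_works M" for r
      using that lens res by (simp add: c' split_beta)
    have len': "length (c_works c') = t2_works M" using lens res by (simp add: c')
    have "range (fst e) \<subseteq> t2_syms M" if e: "e \<in> set (c_works c')" for e
    proof -
      obtain r where r: "r < t2_works M" "e = c_works c' ! r"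
        using e len' by (metis in_set_conv_nth)
      have "range (fst (c_works c ! r)) \<subseteq> t2_syms M" "fst (acts ! r) \<in> t2_syms M"
        using valid r lens res by (auto simp: t2_valid_def)
      then show ?thesis using r work by (auto simp: image_subset_iff)
    qed
    then have "t2_valid n M c'"
      using res lens by (simp add: t2_valid_def c')
    moreover have "list_all2 (\<lambda>e e'. snd e' = snd e \<and> (\<forall>j. lookup bl (fst e') j = to_nat (fst e j)))
        (c_works c') (fst (snd (snd (sim_update d (action_code (q, mvs, acts, out))))))"
      unfolding list_all2_conv_all_nth
    proof (intro conjI allI impI)
      show "length (c_works c') = length (fst (snd (snd (sim_update d (action_code (q, mvs, acts, out))))))"
        using lens res by (simp add: c' sim_update_def action_code_def)
      fix r assume "r < length (c_works c')"
      then have r: "r < t2_works M" using lens res by (simp add: c')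
      have "snd (fst (snd (snd d)) ! r) = snd (c_works c ! r)"
        "\<And>j. lookup bl (fst (fst (snd (snd d)) ! r)) j = to_nat (fst (c_works c ! r) j)"
        using tapes r lens by (auto simp: list_all2_conv_all_nth)
      then show "snd (fst (snd (snd (sim_update d (action_code (q, mvs, acts, out))))) ! r) =
          snd (c_works c' ! r)"
        and "lookup bl (fst (fst (snd (snd (sim_update d (action_code (q, mvs, acts, out))))) ! r)) j =
          to_nat (fst (c_works c' ! r) j)" for j
        using r lens res by (simp_all add: work sim_update_def action_code_def)
    qed
    moreover have "fst (snd (sim_update d (action_code (q, mvs, acts, out)))) = c_heads c'"
      using lens res
      by (intro nth_equalityI) (simp_all add: c' sim_update_def action_code_def d)
    ultimately have "sim_rel n M c' (sim_step tb (t2_halt M) bl ws d)"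
      unfolding step sim_rel_def bl_def[symmetric]
      by (simp add: sim_update_def action_code_def d c' split: option.split)
    moreover have "c_heads c' ! i \<le> c_heads c ! i + 1" if "i < n" for i
    proof -
      have "shift (mvs ! i) \<le> 1" by (cases "mvs ! i") auto
      then show ?thesis using that lens res by (simp add: c')
    qed
    ultimately show ?thesis by (simp add: c'_def)
  qed
  then show "sim_rel n M (t2_step M ps c) (sim_step tb (t2_halt M) bl ws d)"
    and "i < n \<Longrightarrow> c_heads (t2_step M ps c) ! i \<le> c_heads c ! i + 1" by blast+
qed

text \<open>
  A head has reached at most position \<open>t\<close> after \<open>t\<close> steps. Hence prefixes of length
  \<open>t\<close> suffice for \<open>t\<close> steps, and the simulation never looks beyond their ends.
\<close>

theorem pr_simulates_t2_machine:
  fixes M :: "'s::finite t2_machine"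
  assumes wf: "wf_t2 n M"
  shows "\<exists>sim :: nat list list \<times> nat \<Rightarrow> nat \<times> nat list. pr sim \<and>
    (\<forall>p ws t. length ws = n \<and> (\<forall>i<n. codes_prefix (ws ! i) (p i) \<and> t \<le> length (ws ! i)) \<longrightarrow>
       (let c = t2_run M (map (\<lambda>i. Seq (p i)) [0..<n]) t
        in sim (ws, t) = (c_state c, map letter_code (c_out c))))"
proof -
  obtain tb where tb: "pr tb" "table_of n M tb" using exists_pr_table[OF wf] by blast
  define bl where "bl = to_nat (Blank :: 's sym)"
  define start :: t2_sim where "start = (t2_start M, replicate n 0, replicate (t2_works M) ([], 0), [])"
  define run where "run ws t = (sim_step tb (t2_halt M) bl ws ^^ t) start" for ws t
  have "pr (\<lambda>z. run (fst z) (snd z))"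
    unfolding run_def by (intro pr_intros pr_sim_step tb)
  then have "pr (\<lambda>z. (fst (run (fst z) (snd z)), snd (snd (snd (run (fst z) (snd z))))))"
    by (intro pr_intros)
  moreover have "sim_rel n M (t2_run M ps t) (run ws t) \<and> (\<forall>i<n. c_heads (t2_run M ps t) ! i \<le> int t)"
    if ws: "length ws = n" and prefix: "\<forall>i<n. codes_prefix (ws ! i) (p i) \<and> t \<le> length (ws ! i)"
      and ps: "ps = map (\<lambda>i. Seq (p i)) [0..<n]" for p ws t ps
    using prefix
  proof (induction t)
    case 0
    have "t2_valid n M (t2_run M ps 0)"
      using wf by (auto simp: t2_valid_def t2_run_def t2_init_def ps wf_t2_def)
    then show ?case
      by (auto simp: sim_rel_def run_def start_def t2_run_def t2_init_def ps list_all2_conv_all_nth)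
  next
    case (Suc t)
    have "\<forall>i<n. codes_prefix (ws ! i) (p i) \<and> t \<le> length (ws ! i)"
      using Suc.prems Suc_leD by blast
    from Suc.IH[OF this] have IH: "sim_rel n M (t2_run M ps t) (run ws t)"
      "\<forall>i<n. c_heads (t2_run M ps t) ! i \<le> int t" by blast+
    have input: "sim_input bl (ws ! i) (c_heads (t2_run M ps t) ! i) =
        to_nat (input_tape (ps ! i) (c_heads (t2_run M ps t) ! i))" if i: "i < n" for i
    proof -
      have psi: "ps ! i = Seq (p i)" using i by (simp add: ps)
      show ?thesis
      proof (cases "0 \<le> c_heads (t2_run M ps t) ! i")
        case True
        define h where "h = nat (c_heads (t2_run M ps t) ! i)"
        have "h < length (ws ! i)" using IH(2) Suc.prems i True by (fastforce simp: h_def)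
        moreover from this have "ws ! i ! h = letter_code (p i h)"
          using Suc.prems i unfolding codes_prefix_def by blast
        ultimately show ?thesis
          using True psi by (simp add: sim_input_def nth_or_eq letter_code_def h_def[symmetric])
      next
        case False
        then show ?thesis using psi by (simp add: sim_input_def bl_def)
      qed
    qed
    have "length ps = n" by (simp add: ps)
    note step = sim_rel_step[OF wf tb(2) IH(1) this ws, folded bl_def, OF input]
    have "c_heads (t2_run M ps (Suc t)) ! i \<le> int (Suc t)" if "i < n" for i
      using step(2)[OF _ that] IH(2) that by (fastforce simp: t2_run_def)
    then show ?case using step(1) by (simp add: t2_run_def run_def)
  qed
  ultimately show ?thesis
    by (intro exI[of _ "\<lambda>z. (fst (run (fst z) (snd z)), snd (snd (snd (run (fst z) (snd z)))))"])
      (auto simp: Let_def sim_rel_def)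
qed


subsection \<open>Outputs of Type-2 machines\<close>

lemma t2_run_Suc: "t2_run M ps (Suc t) = t2_step M ps (t2_run M ps t)"
  by (simp add: t2_run_def)

lemma t2_out_mono: "t \<le> t' \<Longrightarrow> \<exists>u. c_out (t2_run M ps t') = c_out (t2_run M ps t) @ u"
proof (induction rule: dec_induct)
  case (step t')
  have "\<exists>u. c_out (t2_step M ps c) = c_out c @ u" for c
    by (auto simp: t2_step_def split: prod.split)
  with step.IH show ?case by (metis append.assoc t2_run_Suc)
qed simp

lemma t2_halted: "t \<le> t' \<Longrightarrow> c_state (t2_run M ps t) = t2_halt M \<Longrightarrow> t2_run M ps t' = t2_run M ps t"
  by (induction rule: dec_induct) (simp_all add: t2_run_Suc t2_step_def)

lemma t2_result_Seq:
  assumes "Seq q \<in> t2_result M ps"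
  shows "c_out (t2_run M ps t) = map q [0..<length (c_out (t2_run M ps t))]"
    and "\<exists>t0. \<forall>t\<ge>t0. l \<le> length (c_out (t2_run M ps t))"
proof -
  have out: "\<exists>t. c_out (t2_run M ps t) = map q [0..<l]" for l
    using assms by (auto simp: t2_result_def)
  let ?l = "length (c_out (t2_run M ps t))"
  obtain t' where t': "c_out (t2_run M ps t') = map q [0..<?l]" using out by blast
  then have len: "length (c_out (t2_run M ps t')) = ?l" by simp
  obtain u where "c_out (t2_run M ps t') = c_out (t2_run M ps t) @ u \<or>
      c_out (t2_run M ps t) = c_out (t2_run M ps t') @ u"
    using t2_out_mono[of t t' M ps] t2_out_mono[of t' t M ps] by (meson nle_le)
  with len have "c_out (t2_run M ps t) = c_out (t2_run M ps t')" by auto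
  then show "c_out (t2_run M ps t) = map q [0..<?l]" by (simp only: t')
  obtain t0 where "c_out (t2_run M ps t0) = map q [0..<l]" using out by blast
  then have "l \<le> length (c_out (t2_run M ps t))" if "t \<ge> t0" for t
    using t2_out_mono[OF that, of M ps] by auto
  then show "\<exists>t0. \<forall>t\<ge>t0. l \<le> length (c_out (t2_run M ps t))" by blast
qed

lemma t2_result_Word:
  assumes "Word w \<in> t2_result M ps"
  shows "c_state (t2_run M ps t) = t2_halt M \<Longrightarrow> c_out (t2_run M ps t) = w"
    and "\<exists>t0. \<forall>t\<ge>t0. c_state (t2_run M ps t) = t2_halt M"
proof -
  obtain t0 where t0: "c_state (t2_run M ps t0) = t2_halt M" "c_out (t2_run M ps t0) = w"
    using assms by (auto simp: t2_result_def)
  then show "\<exists>t0. \<forall>t\<ge>t0. c_state (t2_run M ps t) = t2_halt M"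
    by (metis t2_halted)
  assume "c_state (t2_run M ps t) = t2_halt M"
  then show "c_out (t2_run M ps t) = w"
    using t0 by (metis t2_halted nle_le)
qed

lemma t2_result_Seq_unique:
  assumes "Seq q \<in> t2_result M ps" "Seq q' \<in> t2_result M ps"
  shows "q = q'"
proof
  fix j
  obtain t where "c_out (t2_run M ps t) = map q [0..<Suc j]"
    using assms(1) unfolding t2_result_def by blast
  then have "map q [0..<Suc j] = map q' [0..<Suc j]"
    using t2_result_Seq(1)[OF assms(2), of t] by simp
  then show "q j = q' j" by simp
qed

section \<open>Simulation of generalized Turing machines over sequences\<close>

text \<open>
  The cells of the machine hold sequences, and every value of a function in a statement is a result
  of some Type-2 machine. Inclusion is what the simulation needs: it follows a computation of the
  machine, in which every function is applied to arguments where it has a value.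
\<close>

fun t2_stmt :: "('l, 'g, 's elem, 's::{finite, zero_neq_one}) gtm \<Rightarrow>
    ('l, 'g, 's elem, 's) stmt \<Rightarrow> bool" where
  "t2_stmt D (GoRight i l) \<longleftrightarrow> l \<in> labels D"
| "t2_stmt D (GoLeft i l) \<longleftrightarrow> l \<in> labels D"
| "t2_stmt D (Write i a l) \<longleftrightarrow> a \<in> gamma D \<and> l \<in> labels D"
| "t2_stmt D (IfSym i a l l') \<longleftrightarrow> a \<in> gamma D \<and> l \<in> labels D \<and> l' \<in> labels D"
| "t2_stmt D (Assign i f js l) \<longleftrightarrow> l \<in> labels D \<and> (\<exists>T. wf_t2 (length js) T \<and>
     (\<forall>ps. \<forall>x\<in>f ps. set ps \<subseteq> sigma_omega \<and> x \<in> t2_result T ps \<inter> sigma_omega))"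
| "t2_stmt D (Test f js l l') \<longleftrightarrow> l \<in> labels D \<and> l' \<in> labels D \<and> (\<exists>T. wf_t2 (length js) T \<and>
     (\<forall>ps. \<forall>x\<in>f ps. set ps \<subseteq> sigma_omega \<and> x \<in> t2_result T ps))"

definition t2_gtm :: "('l, 'g, 's elem, 's::{finite, zero_neq_one}) gtm \<Rightarrow> bool" where
  "t2_gtm D \<longleftrightarrow> finite (labels D) \<and> init_label D \<in> labels D \<and> final_label D \<in> labels D \<and>
     finite (gamma D) \<and> blank D \<in> gamma D \<and> carr D = (\<lambda>_. sigma_omega) \<and>
     (\<forall>l \<in> labels D - {final_label D}. t2_stmt D (stm D l))"

text \<open>
  A simulated configuration consists of the code of the label, an association list for the
  contents of all tapes and one for the head positions. A cell is \<open>(0, w)\<close> if it holds a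
  sequence of which the prefix \<open>w\<close> is known, and \<open>(Suc c, [])\<close> if it holds the symbol with
  code \<open>c\<close>. The label code \<open>0\<close> belongs to no label: it says that the
  known prefixes were too short to decide a test.
\<close>

type_synonym gtm_sim = "nat \<times> ((nat \<times> int) \<times> nat \<times> nat list) list \<times> (nat \<times> int) list"

definition sim_pos :: "gtm_sim \<Rightarrow> nat \<Rightarrow> int" where
  "sim_pos s i = lookup 0 (snd (snd s)) i"

definition sim_cell :: "nat \<times> nat list \<Rightarrow> gtm_sim \<Rightarrow> nat \<Rightarrow> nat \<times> nat list" where
  "sim_cell bl s i = lookup bl (fst (snd s)) (i, sim_pos s i)"

definition sim_move :: "nat \<Rightarrow> nat \<Rightarrow> int \<Rightarrow> gtm_sim \<Rightarrow> gtm_sim" where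
  "sim_move l i m s = (l, fst (snd s), (i, sim_pos s i + m) # snd (snd s))"

definition sim_write :: "nat \<Rightarrow> nat \<Rightarrow> nat \<times> nat list \<Rightarrow> gtm_sim \<Rightarrow> gtm_sim" where
  "sim_write l i c s = (l, ((i, sim_pos s i), c) # fst (snd s), snd (snd s))"

definition sim_goto :: "nat \<Rightarrow> gtm_sim \<Rightarrow> gtm_sim" where
  "sim_goto l s = (l, snd s)"

definition sim_args :: "nat \<times> nat list \<Rightarrow> nat list \<Rightarrow> gtm_sim \<Rightarrow> nat list list" where
  "sim_args bl js s = map (\<lambda>j. snd (sim_cell bl s j)) js"

definition fuel :: "nat \<Rightarrow> nat list list \<Rightarrow> nat" where
  "fuel N ws = foldr (\<lambda>w n. min (length w) n) ws N"

lemma fuel_le: "fuel N ws \<le> N" "w \<in> set ws \<Longrightarrow> fuel N ws \<le> length w"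
  and fuel_ge: "k \<le> N \<Longrightarrow> (\<And>w. w \<in> set ws \<Longrightarrow> k \<le> length w) \<Longrightarrow> k \<le> fuel N ws"
  by (induction ws) (auto simp: fuel_def)

lemma pr_fuel [pr_intros]: "pr N \<Longrightarrow> pr ws \<Longrightarrow> pr (\<lambda>x. fuel (N x) (ws x))"
  unfolding fuel_def by (intro pr_intros)

lemma pr_gtm_sim_intros:
  assumes "pr s"
  shows "pr i \<Longrightarrow> pr (\<lambda>x. sim_pos (s x) (i x))"
    and "pr i \<Longrightarrow> pr (\<lambda>x. sim_cell bl (s x) (i x))"
    and "pr l \<Longrightarrow> pr (\<lambda>x. sim_move (l x) j m (s x))"
    and "pr l \<Longrightarrow> pr c \<Longrightarrow> pr (\<lambda>x. sim_write (l x) j (c x) (s x))"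
    and "pr l \<Longrightarrow> pr (\<lambda>x. sim_goto (l x) (s x))"
    and "pr (\<lambda>x. sim_args bl js (s x))"
  unfolding sim_move_def sim_write_def sim_goto_def sim_args_def sim_cell_def sim_pos_def
  by (intro pr_intros assms pr_comp[OF assms]; assumption)+

locale gtm_simulation =
  fixes D :: "('l, 'g, 's elem, 's::{finite, zero_neq_one}) gtm"
    and lcode :: "'l \<Rightarrow> nat" and gcode :: "'g \<Rightarrow> nat"
  assumes D: "t2_gtm D"
    and lcode: "inj_on lcode (labels D)" "\<And>l. lcode l \<noteq> 0"
    and gcode: "inj_on gcode (gamma D)"
begin

definition bl :: "nat \<times> nat list" where "bl = (Suc (gcode (blank D)), [])"

fun cell_rel :: "nat \<Rightarrow> ('s elem, 'g) cell \<Rightarrow> nat \<times> nat list \<Rightarrow> bool" where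
  "cell_rel m (Sym a) d \<longleftrightarrow> a \<in> gamma D \<and> d = (Suc (gcode a), [])"
| "cell_rel m (Val (Seq p)) d \<longleftrightarrow> fst d = 0 \<and> codes_prefix (snd d) p \<and> m \<le> length (snd d)"
| "cell_rel m (Val (Word w)) d \<longleftrightarrow> False"

text \<open>The number \<open>m\<close> bounds the lengths of the known prefixes from below.\<close>

definition gtm_rel :: "nat \<Rightarrow> ('l, 'g, 's elem) config \<Rightarrow> gtm_sim \<Rightarrow> bool" where
  "gtm_rel m \<kappa> s \<longleftrightarrow> lab \<kappa> \<in> labels D \<and> fst s = lcode (lab \<kappa>) \<and> (\<forall>i. sim_pos s i = pos \<kappa> i) \<and>
     (\<forall>i j. cell_rel m (tape \<kappa> i j) (lookup bl (fst (snd s)) (i, j)))"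

lemma cell_rel_mono: "cell_rel m c d \<Longrightarrow> m' \<le> m \<Longrightarrow> cell_rel m' c d"
  by (induction m c d rule: cell_rel.induct) auto

lemma gtm_rel_mono: "gtm_rel m \<kappa> s \<Longrightarrow> m' \<le> m \<Longrightarrow> gtm_rel m' \<kappa> s"
  unfolding gtm_rel_def using cell_rel_mono by blast

lemma sim_cell_rel: "gtm_rel m \<kappa> s \<Longrightarrow> cell_rel m (scanned \<kappa> i) (sim_cell bl s i)"
  by (simp add: gtm_rel_def sim_cell_def scanned_def)

lemma gtm_rel_move: "gtm_rel m \<kappa> s \<Longrightarrow> l \<in> labels D \<Longrightarrow>
    gtm_rel m (\<kappa>\<lparr>lab := l, pos := (pos \<kappa>)(i := pos \<kappa> i + n)\<rparr>) (sim_move (lcode l) i n s)"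
  by (auto simp: gtm_rel_def sim_move_def sim_pos_def)

lemma gtm_rel_write: "gtm_rel m \<kappa> s \<Longrightarrow> l \<in> labels D \<Longrightarrow> cell_rel m c d \<Longrightarrow>
    gtm_rel m ((write_cell i c \<kappa>)\<lparr>lab := l\<rparr>) (sim_write (lcode l) i d s)"
  by (auto simp: gtm_rel_def sim_write_def sim_pos_def write_cell_def)

lemma gtm_rel_goto: "gtm_rel m \<kappa> s \<Longrightarrow> l \<in> labels D \<Longrightarrow>
    gtm_rel m (\<kappa>\<lparr>lab := l\<rparr>) (sim_goto (lcode l) s)"
  by (auto simp: gtm_rel_def sim_goto_def sim_pos_def)

text \<open>
  Soundness and convergence of a simulated step. The first part holds at every stage \<open>N\<close> and
  ensures that no wrong letter is ever emitted. The second part, for large \<open>N\<close> and long known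
  prefixes, ensures that every letter is eventually emitted; here \<open>m\<close> is the length that the
  remaining steps will require.
\<close>

definition simulates_step :: "(nat \<times> gtm_sim \<Rightarrow> gtm_sim) \<Rightarrow>
    ('l, 'g, 's elem) config \<Rightarrow> ('l, 'g, 's elem) config \<Rightarrow> bool" where
  "simulates_step S \<kappa> \<kappa>' \<longleftrightarrow> (\<forall>m. \<exists>m'. \<forall>N s m0. gtm_rel m0 \<kappa> s \<longrightarrow>
     (fst (S (N, s)) = 0 \<or> gtm_rel 0 \<kappa>' (S (N, s))) \<and>
     (m' \<le> N \<and> m' \<le> m0 \<longrightarrow> gtm_rel m \<kappa>' (S (N, s))))"

lemma simulates_stepI:
  assumes "\<And>N s m. gtm_rel m \<kappa> s \<Longrightarrow> gtm_rel m \<kappa>' (S (N, s))"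
  shows "simulates_step S \<kappa> \<kappa>'"
  unfolding simulates_step_def using assms gtm_rel_mono by (meson le0)

text \<open>
  The number of steps of a call is limited by the known prefixes of its arguments, so the call
  behaves as the Type-2 machine does on the full sequences. The number of steps grows with the
  stage and with these prefixes.
\<close>

lemma simulated_call:
  assumes rel: "gtm_rel m \<kappa> s" and xs: "map (scanned \<kappa>) js = map Val xs" "set xs \<subseteq> sigma_omega"
    and sim: "\<forall>p ws t. length ws = length js \<and>
        (\<forall>i<length js. codes_prefix (ws ! i) (p i) \<and> t \<le> length (ws ! i)) \<longrightarrow>
       (let c = t2_run T (map (\<lambda>i. Seq (p i)) [0..<length js]) t
        in sim (ws, t) = (c_state c, map letter_code (c_out c)))"
  shows "\<exists>t. sim (sim_args bl js s, fuel N (sim_args bl js s)) =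
       (c_state (t2_run T xs t), map letter_code (c_out (t2_run T xs t))) \<and>
     (\<forall>k. k \<le> N \<longrightarrow> k \<le> m \<longrightarrow> k \<le> t)"
proof -
  let ?ws = "sim_args bl js s"
  define t where "t = fuel N ?ws"
  have len: "length xs = length js" "length ?ws = length js"
    using xs(1) by (metis length_map) (simp add: sim_args_def)
  moreover have "\<exists>p. xs ! i = Seq p" if "i < length xs" for i
    using xs(2) that nth_mem by (fastforce simp: sigma_omega_def)
  then obtain p where p: "\<And>i. i < length xs \<Longrightarrow> xs ! i = Seq (p i)" by metis
  ultimately have xs_eq: "xs = map (\<lambda>i. Seq (p i)) [0..<length js]"
    by (intro nth_equalityI) simp_all
  have ws: "codes_prefix (?ws ! i) (p i) \<and> m \<le> length (?ws ! i)" if "i < length js" for i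
  proof -
    have "scanned \<kappa> (js ! i) = Val (Seq (p i))"
      using xs(1) that len p by (metis nth_map)
    then show ?thesis
      using sim_cell_rel[OF rel, of "js ! i"] that by (simp add: sim_args_def)
  qed
  have "t \<le> length (?ws ! i)" if "i < length js" for i
    using that len fuel_le(2)[of "?ws ! i" ?ws N] by (simp add: t_def)
  then have "sim (?ws, t) = (c_state (t2_run T xs t), map letter_code (c_out (t2_run T xs t)))"
    using sim len(2) ws unfolding xs_eq Let_def by blast
  moreover have "k \<le> t" if "k \<le> N" "k \<le> m" for k
    unfolding t_def
  proof (rule fuel_ge[OF that(1)])
    fix w assume "w \<in> set ?ws"
    then obtain i where "i < length js" "w = ?ws ! i" using len by (metis in_set_conv_nth)
    then show "k \<le> length w" using ws that(2) by fastforce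
  qed
  ultimately show ?thesis by (intro exI[of _ t]) (simp add: t_def)
qed

text \<open>
  Only assignments and tests need an argument. An assignment is always simulated soundly, and its
  result is long if the call runs long enough. A test is simulated soundly whenever the call has
  halted, which happens after a number of steps that depends on the true arguments only.
\<close>

lemma exists_pr_step:
  assumes l: "l \<in> labels D - {final_label D}"
  shows "\<exists>S. pr S \<and> (\<forall>\<kappa> \<kappa>'. lab \<kappa> = l \<longrightarrow> succ D \<kappa> \<kappa>' \<longrightarrow> simulates_step S \<kappa> \<kappa>')"
proof -
  have stmt: "t2_stmt D (stm D l)" using D l by (auto simp: t2_gtm_def)
  show ?thesis
  proof (cases "stm D l")
    case (GoRight i l')
    let ?S = "\<lambda>x :: nat \<times> gtm_sim. sim_move (lcode l') i 1 (snd x)"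
    have "simulates_step ?S \<kappa> \<kappa>'" if "lab \<kappa> = l" "succ D \<kappa> \<kappa>'" for \<kappa> \<kappa>'
      using that(2) that(1) GoRight stmt
      by cases (auto intro!: simulates_stepI gtm_rel_move)
    moreover have "pr ?S" by (intro pr_gtm_sim_intros pr_intros)
    ultimately show ?thesis by blast
  next
    case (GoLeft i l')
    let ?S = "\<lambda>x :: nat \<times> gtm_sim. sim_move (lcode l') i (- 1) (snd x)"
    have "simulates_step ?S \<kappa> \<kappa>'" if "lab \<kappa> = l" "succ D \<kappa> \<kappa>'" for \<kappa> \<kappa>'
      using that(2) that(1) GoLeft stmt gtm_rel_move[of _ \<kappa> _ l' i "- 1"]
      by cases (auto intro!: simulates_stepI)
    moreover have "pr ?S" by (intro pr_gtm_sim_intros pr_intros)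
    ultimately show ?thesis by blast
  next
    case (Write i a l')
    let ?S = "\<lambda>x :: nat \<times> gtm_sim. sim_write (lcode l') i (Suc (gcode a), []) (snd x)"
    have "simulates_step ?S \<kappa> \<kappa>'" if "lab \<kappa> = l" "succ D \<kappa> \<kappa>'" for \<kappa> \<kappa>'
      using that(2) that(1) Write stmt
      by cases (auto intro!: simulates_stepI gtm_rel_write)
    moreover have "pr ?S" by (intro pr_gtm_sim_intros pr_intros)
    ultimately show ?thesis by blast
  next
    case (IfSym i a l1 l2)
    let ?S = "\<lambda>x :: nat \<times> gtm_sim.
      sim_goto (if sim_cell bl (snd x) i = (Suc (gcode a), []) then lcode l1 else lcode l2) (snd x)"
    have "sim_cell bl s i = (Suc (gcode a), []) \<longleftrightarrow> scanned \<kappa> i = Sym a" if "gtm_rel m \<kappa> s" for m \<kappa> s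
      using sim_cell_rel[OF that, of i] stmt IfSym gcode
      by (cases "(m, scanned \<kappa> i, sim_cell bl s i)" rule: cell_rel.cases) (auto simp: inj_on_def)
    note branch = this
    have "simulates_step ?S \<kappa> \<kappa>'" if "lab \<kappa> = l" "succ D \<kappa> \<kappa>'" for \<kappa> \<kappa>'
    proof (rule simulates_stepI)
      fix N s m assume "gtm_rel m \<kappa> s"
      moreover have "\<kappa>' = \<kappa>\<lparr>lab := if scanned \<kappa> i = Sym a then l1 else l2\<rparr>"
        using that(2,1) IfSym by cases auto
      ultimately show "gtm_rel m \<kappa>' (?S (N, s))"
        using branch gtm_rel_goto IfSym stmt by simp
    qed
    moreover have "pr ?S" by (intro pr_gtm_sim_intros pr_intros)
    ultimately show ?thesis by blast
  next
    case (Assign i f js l')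
    then obtain T where T: "wf_t2 (length js) T"
      and f: "\<And>ps x. x \<in> f ps \<Longrightarrow> set ps \<subseteq> sigma_omega \<and> x \<in> t2_result T ps \<inter> sigma_omega"
      using stmt by auto
    obtain sim :: "nat list list \<times> nat \<Rightarrow> nat \<times> nat list" where sim: "pr sim" and
      sim_T: "\<forall>p ws t. length ws = length js \<and>
        (\<forall>i<length js. codes_prefix (ws ! i) (p i) \<and> t \<le> length (ws ! i)) \<longrightarrow>
       (let c = t2_run T (map (\<lambda>i. Seq (p i)) [0..<length js]) t
        in sim (ws, t) = (c_state c, map letter_code (c_out c)))"
      using pr_simulates_t2_machine[OF T] by blast
    let ?call = "\<lambda>x. sim (sim_args bl js (snd x), fuel (fst x) (sim_args bl js (snd x)))"
    let ?S = "\<lambda>x :: nat \<times> gtm_sim. sim_write (lcode l') i (0, snd (?call x)) (snd x)"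
    have "pr ?call" by (intro pr_comp[OF sim] pr_gtm_sim_intros pr_intros)
    then have "pr ?S" by (intro pr_gtm_sim_intros pr_intros)
    moreover have "simulates_step ?S \<kappa> \<kappa>'" if lab: "lab \<kappa> = l" and succ: "succ D \<kappa> \<kappa>'" for \<kappa> \<kappa>'
    proof -
      obtain xs x where xs: "map (scanned \<kappa>) js = map Val xs" "x \<in> f xs"
        and \<kappa>': "\<kappa>' = (write_cell i (Val x) \<kappa>)\<lparr>lab := l'\<rparr>"
        using succ lab Assign by cases auto
      obtain q where q: "x = Seq q" "Seq q \<in> t2_result T xs"
        using f[OF xs(2)] by (auto simp: sigma_omega_def)
      have in_omega: "set xs \<subseteq> sigma_omega" using f[OF xs(2)] by blast
      have step: "gtm_rel k \<kappa>' (?S (N, s))"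
        if rel: "gtm_rel m0 \<kappa> s" and k: "k \<le> m0" "k \<le> length (snd (?call (N, s)))" for m0 N s k
      proof -
        obtain t where "?call (N, s) = (c_state (t2_run T xs t), map letter_code (c_out (t2_run T xs t)))"
          using simulated_call[OF rel xs(1) in_omega sim_T, of N] by auto
        then have "codes_prefix (snd (?call (N, s))) q"
          using t2_result_Seq(1)[OF q(2), of t] by (simp add: codes_prefix_def) (metis (no_types, lifting) add_0 diff_zero length_map length_upt nth_map nth_upt)
        then show ?thesis
          using gtm_rel_write[OF gtm_rel_mono[OF rel k(1)], of l' "Val x"] k(2) Assign stmt
          by (simp add: \<kappa>' q(1))
      qed
      show ?thesis
        unfolding simulates_step_def
      proof
        fix m
        obtain t0 where t0: "\<And>t. t \<ge> t0 \<Longrightarrow> m \<le> length (c_out (t2_run T xs t))"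
          using t2_result_Seq(2)[OF q(2)] by blast
        have "gtm_rel m \<kappa>' (?S (N, s))"
          if rel: "gtm_rel m0 \<kappa> s" and large: "max m t0 \<le> N" "max m t0 \<le> m0" for m0 N s
        proof (rule step[OF rel])
          obtain t where "?call (N, s) = (c_state (t2_run T xs t), map letter_code (c_out (t2_run T xs t)))"
              "\<And>k. k \<le> N \<Longrightarrow> k \<le> m0 \<Longrightarrow> k \<le> t"
            using simulated_call[OF rel xs(1) in_omega sim_T, of N] by auto
          then show "m \<le> length (snd (?call (N, s)))" using t0 large by simp
        qed (use large in simp)
        then show "\<exists>m'. \<forall>N s m0. gtm_rel m0 \<kappa> s \<longrightarrow>
            (fst (?S (N, s)) = 0 \<or> gtm_rel 0 \<kappa>' (?S (N, s))) \<and>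
            (m' \<le> N \<and> m' \<le> m0 \<longrightarrow> gtm_rel m \<kappa>' (?S (N, s)))"
          using step[of _ _ 0] by (intro exI[of _ "max m t0"]) blast
      qed
    qed
    ultimately show ?thesis by blast
  next
    case (Test f js l1 l2)
    then obtain T where T: "wf_t2 (length js) T"
      and f: "\<And>ps x. x \<in> f ps \<Longrightarrow> set ps \<subseteq> sigma_omega \<and> x \<in> t2_result T ps"
      using stmt by auto
    obtain sim :: "nat list list \<times> nat \<Rightarrow> nat \<times> nat list" where sim: "pr sim" and
      sim_T: "\<forall>p ws t. length ws = length js \<and>
        (\<forall>i<length js. codes_prefix (ws ! i) (p i) \<and> t \<le> length (ws ! i)) \<longrightarrow>
       (let c = t2_run T (map (\<lambda>i. Seq (p i)) [0..<length js]) t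
        in sim (ws, t) = (c_state c, map letter_code (c_out c)))"
      using pr_simulates_t2_machine[OF T] by blast
    let ?call = "\<lambda>x. sim (sim_args bl js (snd x), fuel (fst x) (sim_args bl js (snd x)))"
    let ?S = "\<lambda>x :: nat \<times> gtm_sim. sim_goto
       (if fst (?call x) = t2_halt T then
          (if snd (?call x) = [letter_code (0 :: 's)] then lcode l1 else lcode l2)
        else 0) (snd x)"
    have "pr ?call" by (intro pr_comp[OF sim] pr_gtm_sim_intros pr_intros)
    then have "pr ?S" by (intro pr_gtm_sim_intros pr_intros)
    moreover have "simulates_step ?S \<kappa> \<kappa>'" if lab: "lab \<kappa> = l" and succ: "succ D \<kappa> \<kappa>'" for \<kappa> \<kappa>'
    proof -
      obtain xs b where xs: "map (scanned \<kappa>) js = map Val xs" "Word [b] \<in> f xs"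
        and \<kappa>': "\<kappa>' = \<kappa>\<lparr>lab := if b = 0 then l1 else l2\<rparr>"
        using succ lab Test by cases auto
      have w: "Word [b] \<in> t2_result T xs" and in_omega: "set xs \<subseteq> sigma_omega"
        using f[OF xs(2)] by auto
      have branch: "[letter_code b] = [letter_code (0 :: 's)] \<longleftrightarrow> b = 0"
        using inj_letter_code by (auto simp: inj_def)
      have step: "fst (?S (N, s)) = 0 \<or> gtm_rel m0 \<kappa>' (?S (N, s))"
        "\<exists>t. (\<forall>k. k \<le> N \<longrightarrow> k \<le> m0 \<longrightarrow> k \<le> t) \<and>
          (c_state (t2_run T xs t) = t2_halt T \<longrightarrow> gtm_rel m0 \<kappa>' (?S (N, s)))"
        if rel: "gtm_rel m0 \<kappa> s" for m0 N s
      proof -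
        obtain t where t: "?call (N, s) = (c_state (t2_run T xs t), map letter_code (c_out (t2_run T xs t)))"
            "\<And>k. k \<le> N \<Longrightarrow> k \<le> m0 \<Longrightarrow> k \<le> t"
          using simulated_call[OF rel xs(1) in_omega sim_T, of N] by auto
        have halted: "gtm_rel m0 \<kappa>' (?S (N, s))" if "c_state (t2_run T xs t) = t2_halt T"
          using t(1) that t2_result_Word(1)[OF w that] branch gtm_rel_goto[OF rel] Test stmt
          by (auto simp: \<kappa>')
        then show "fst (?S (N, s)) = 0 \<or> gtm_rel m0 \<kappa>' (?S (N, s))"
          using t(1) by (auto simp: sim_goto_def)
        show "\<exists>t. (\<forall>k. k \<le> N \<longrightarrow> k \<le> m0 \<longrightarrow> k \<le> t) \<and>
          (c_state (t2_run T xs t) = t2_halt T \<longrightarrow> gtm_rel m0 \<kappa>' (?S (N, s)))"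
          using t(2) halted by blast
      qed
      obtain t0 where t0: "\<And>t. t \<ge> t0 \<Longrightarrow> c_state (t2_run T xs t) = t2_halt T"
        using t2_result_Word(2)[OF w] by blast
      show ?thesis
        unfolding simulates_step_def
      proof
        fix m
        have "fst (?S (N, s)) = 0 \<or> gtm_rel 0 \<kappa>' (?S (N, s))" if rel: "gtm_rel m0 \<kappa> s" for m0 N s
          using step(1)[OF rel, of N] gtm_rel_mono by blast
        moreover have "gtm_rel m \<kappa>' (?S (N, s))"
          if rel: "gtm_rel m0 \<kappa> s" and large: "max m t0 \<le> N \<and> max m t0 \<le> m0" for m0 N s
        proof -
          have "gtm_rel m0 \<kappa>' (?S (N, s))" using step(2)[OF rel, of N] t0 large by force
          then show ?thesis using large gtm_rel_mono by fastforce
        qed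
        ultimately show "\<exists>m'. \<forall>N s m0. gtm_rel m0 \<kappa> s \<longrightarrow>
            (fst (?S (N, s)) = 0 \<or> gtm_rel 0 \<kappa>' (?S (N, s))) \<and>
            (m' \<le> N \<and> m' \<le> m0 \<longrightarrow> gtm_rel m \<kappa>' (?S (N, s)))"
          by (intro exI[of _ "max m t0"]) blast
      qed
    qed
    ultimately show ?thesis by blast
  qed
qed

end

subsection \<open>Words found at finite stages\<close>

text \<open>
  The letters read from input \<open>i\<close>, oldest first. The history lists the newest letters first.
\<close>

definition column :: "nat \<Rightarrow> (nat \<times> nat) list \<Rightarrow> nat list" where
  "column i lg = fold (\<lambda>e ws. if fst e = i then snd e # ws else ws) lg []"

lemma column_append: "column i (lg @ lg') = column i lg' @ column i lg"
proof -
  have "fold (\<lambda>e ws. if fst e = i then snd e # ws else ws) lg ws = column i lg @ ws" for lg ws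
  proof (induction lg arbitrary: ws)
    case (Cons e lg)
    have "column i (e # lg) = column i lg @ (if fst e = i then [snd e] else [])"
      using Cons[of "[snd e]"] by (simp add: column_def)
    then show ?case using Cons by simp
  qed (simp add: column_def)
  from this[of lg' "column i lg"] show ?thesis by (simp add: column_def)
qed

lemma column_Nil [simp]: "column i [] = []"
  by (simp add: column_def)

lemma column_Cons: "column i (e # lg) = column i lg @ (if fst e = i then [snd e] else [])"
  using column_append[of i "[e]" lg] by (simp add: column_def)

lemma column_history: "i < n \<Longrightarrow> column i (history code p n N) = map (\<lambda>j. code (p i j)) [0..<N]"
proof (induction N)
  case (Suc N)
  have "column i (rev (map (\<lambda>i. (i, c i)) [0..<n])) = (if i < n then [c i] else [])" for c n
    by (induction n) (auto simp: column_Cons)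
  then show ?case using Suc by (simp add: column_append)
qed (simp add: column_def)

lemma pr_column [pr_intros]:
  assumes "pr i" "pr lg"
  shows "pr (\<lambda>x. column (i x) (lg x))"
  unfolding column_def by (intro pr_intros assms pr_comp[OF assms(1)])

context gtm_simulation
begin

definition input_cells :: "(nat \<times> nat) list \<Rightarrow> ((nat \<times> int) \<times> nat \<times> nat list) list" where
  "input_cells lg = map (\<lambda>i. ((Suc i, 0), (0, column i lg))) [0..<num_inputs D]"

lemma lookup_input_cells:
  "lookup bl (input_cells lg) (i, j) =
     (if j = 0 \<and> 1 \<le> i \<and> i \<le> num_inputs D then (0, column (i - 1) lg) else bl)"
proof -
  have "lookup bl (map (\<lambda>i. ((Suc i, 0 :: int), (0, column i lg))) is) (i, j) =
     (if j = 0 \<and> i \<in> Suc ` set is then (0, column (i - 1) lg) else bl)" for "is"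
    by (induction "is") auto
  moreover have "i \<in> Suc ` set [0..<num_inputs D] \<longleftrightarrow> 1 \<le> i \<and> i \<le> num_inputs D"
    by (cases i) auto
  ultimately show ?thesis by (simp add: input_cells_def)
qed

lemma gtm_rel_init:
  assumes "xs = map (\<lambda>i. Seq (p i)) [0..<num_inputs D]"
  shows "gtm_rel N (init_config D xs)
    (lcode (init_label D), input_cells (history letter_code p (num_inputs D) N), [])"
proof -
  have "column (i - 1) (history letter_code p (num_inputs D) N) = map (\<lambda>j. letter_code (p (i - 1) j)) [0..<N]"
    if "1 \<le> i" "i \<le> num_inputs D" for i
    using that by (intro column_history) simp
  moreover have "blank D \<in> gamma D" "init_label D \<in> labels D" using D by (auto simp: t2_gtm_def)
  moreover from this have "cell_rel N (Sym (blank D)) bl" by (simp add: bl_def)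
  ultimately show ?thesis
    using assms
    by (auto simp: gtm_rel_def init_config_def sim_pos_def lookup_input_cells codes_prefix_def
        simp del: cell_rel.simps(1))
qed

text \<open>
  At stage \<open>N\<close> the machine is simulated from scratch for \<open>N\<close> steps. A simulation that is
  stuck or has not reached the final label contributes the empty word.
\<close>

theorem gtm_computable:
  "\<exists>U. wf_t2 (num_inputs D) U \<and> (\<forall>xs q. Seq q \<in> gtm_fun D xs \<longrightarrow> Seq q \<in> t2_result U xs)"
proof -
  define n where "n = num_inputs D"
  define inner where "inner = labels D - {final_label D}"
  have "finite inner" "inj_on lcode inner"
    using D lcode(1) by (auto simp: t2_gtm_def inner_def intro: inj_on_subset)
  have "\<forall>l\<in>inner. \<exists>S. pr S \<and> (\<forall>\<kappa> \<kappa>'. lab \<kappa> = l \<longrightarrow> succ D \<kappa> \<kappa>' \<longrightarrow> simulates_step S \<kappa> \<kappa>')"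
    using exists_pr_step unfolding inner_def by blast
  from bchoice[OF this] obtain F where F: "\<And>l. l \<in> inner \<Longrightarrow> pr (F l)"
    "\<And>\<kappa> \<kappa>'. lab \<kappa> \<in> inner \<Longrightarrow> succ D \<kappa> \<kappa>' \<Longrightarrow> simulates_step (F (lab \<kappa>)) \<kappa> \<kappa>'"
    by blast
  have "pr (\<lambda>x :: nat \<times> gtm_sim. fst (snd x))" "pr (\<lambda>x :: nat \<times> gtm_sim. snd x)"
    by (intro pr_intros)+
  from pr_finite_cases[OF \<open>finite inner\<close> \<open>inj_on lcode inner\<close> this, of F] F(1)
  obtain G where G: "pr G" "\<And>l x. l \<in> inner \<Longrightarrow> fst (snd x) = lcode l \<Longrightarrow> G x = F l x"
    "\<And>x. fst (snd x) \<notin> lcode ` inner \<Longrightarrow> G x = snd x"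
    by blast
  define run where "run N lg t = ((\<lambda>s. G (N, s)) ^^ t) (lcode (init_label D), input_cells lg, [])"
    for N lg t
  define st where "st z = (if fst (run (fst z) (snd z) (fst z)) = lcode (final_label D)
      then snd (lookup bl (fst (snd (run (fst z) (snd z) (fst z)))) (0, 0)) else [])" for z
  have "pr st"
    unfolding st_def run_def input_cells_def by (intro pr_intros pr_comp[OF G(1)])
  from transducer_computes[OF this inj_letter_code, of n]
  obtain U :: "'s t2_machine" where U: "wf_t2 n U" "\<And>p q len.
      (\<And>N. st (N, history letter_code p n (Suc N)) = map (\<lambda>j. letter_code (q j)) [0..<len N]) \<Longrightarrow>
      (\<And>j. \<exists>N0. \<forall>N\<ge>N0. j \<le> len N) \<Longrightarrow>
      Seq q \<in> t2_result U (map (\<lambda>i. Seq (p i)) [0..<n])"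
    by blast
  have "Seq q \<in> t2_result U xs" if q: "Seq q \<in> gtm_fun D xs" for xs q
  proof -
    have "xs \<in> listset (map (carr D) [1..<Suc n])"
      using q by (simp add: gtm_fun_iff n_def del: upt_Suc)
    then have xs: "length xs = n" "\<And>i. i < n \<Longrightarrow> xs ! i \<in> sigma_omega"
      using D by (auto simp: in_listset_iff list_all2_conv_all_nth t2_gtm_def simp del: upt_Suc)
    have "\<exists>p. xs ! i = Seq p" if "i < n" for i using xs(2)[OF that] by (auto simp: sigma_omega_def)
    then obtain p where "\<And>i. i < n \<Longrightarrow> xs ! i = Seq (p i)" by metis
    with xs(1) have xs_eq: "xs = map (\<lambda>i. Seq (p i)) [0..<n]" by (intro nth_equalityI) simp_all
    obtain \<kappa> where "(succ D)\<^sup>*\<^sup>* (init_config D xs) \<kappa>" and acc: "accepting D \<kappa>" "tape \<kappa> 0 0 = Val (Seq q)"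
      using q by (auto simp: gtm_fun_iff)
    then obtain T K where K: "K 0 = init_config D xs" "K T = \<kappa>"
        "\<And>t. t < T \<Longrightarrow> succ D (K t) (K (Suc t))"
      by (metis rtranclp_imp_relpowp relpowp_fun_conv)
    define s where "s N = run N (history letter_code p n (Suc N))" for N
    have s_Suc: "s N (Suc t) = G (N, s N t)" for N t by (simp add: s_def run_def)
    have start: "gtm_rel (Suc N) (K 0) (s N 0)" for N
      unfolding K(1) s_def run_def n_def by (simp only: funpow_0) (rule gtm_rel_init[OF xs_eq[unfolded n_def]])
    \<comment> \<open>Stuck and final configurations do not change any more.\<close>
    have stays: "s N t' = s N t" if "fst (s N t) \<notin> lcode ` inner" "t \<le> t'" for N t t'
      using that(2) by (induction rule: dec_induct) (use that(1) G(3) in \<open>auto simp: s_Suc\<close>)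
    have not_0: "0 \<notin> lcode ` inner" using lcode(2) by (metis imageE)
    have not_final: "lcode (final_label D) \<notin> lcode ` inner"
      using lcode(1) D by (auto simp: inner_def inj_on_def t2_gtm_def)
    have step: "lab (K t) \<in> inner \<and> s N (Suc t) = F (lab (K t)) (N, s N t)"
      if "t < T" "gtm_rel m (K t) (s N t)" for N m t
    proof -
      have "lab (K t) \<noteq> final_label D" using K(3)[OF that(1)] by (auto elim: succ.cases)
      then have "lab (K t) \<in> inner" using that(2) by (simp add: gtm_rel_def inner_def)
      then show ?thesis using G(2)[of "lab (K t)" "(N, s N t)"] that(2) by (simp add: s_Suc gtm_rel_def)
    qed
    have sound: "fst (s N t) = 0 \<or> gtm_rel 0 (K t) (s N t)" if "t \<le> T" for N t
      using that
    proof (induction t)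
      case 0
      then show ?case using start gtm_rel_mono by blast
    next
      case (Suc t)
      show ?case
      proof (cases "fst (s N t) = 0")
        case True
        then show ?thesis using stays[of N t "Suc t"] not_0 by simp
      next
        case False
        then have rel: "gtm_rel 0 (K t) (s N t)" using Suc by simp
        note st = step[OF _ rel]
        have "simulates_step (F (lab (K t))) (K t) (K (Suc t))"
          using F(2) K(3) st Suc.prems by simp
        then show ?thesis
          using rel st Suc.prems unfolding simulates_step_def by (metis Suc_le_lessD)
      qed
    qed
    have converges: "\<exists>N0. \<forall>N\<ge>N0. gtm_rel m (K t) (s N t)" if "t \<le> T" for t m
      using that
    proof (induction t arbitrary: m)
      case 0
      show ?case
        by (rule exI[of _ m]) (use start gtm_rel_mono in \<open>meson le_SucI\<close>)
    next
      case (Suc t)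
      then obtain N1 where N1: "\<And>N. N \<ge> N1 \<Longrightarrow> gtm_rel 0 (K t) (s N t)" by (meson Suc_leD)
      have "simulates_step (F (lab (K t))) (K t) (K (Suc t))"
        using F(2) K(3) step[OF _ N1[OF order_refl]] Suc.prems by simp
      then obtain m' where m': "\<And>N \<sigma> m0. gtm_rel m0 (K t) \<sigma> \<Longrightarrow> m' \<le> N \<Longrightarrow> m' \<le> m0 \<Longrightarrow>
          gtm_rel m (K (Suc t)) (F (lab (K t)) (N, \<sigma>))"
        unfolding simulates_step_def by meson
      obtain N0 where N0: "\<And>N. N \<ge> N0 \<Longrightarrow> gtm_rel m' (K t) (s N t)"
        using Suc.IH[of m'] Suc.prems by auto
      have "gtm_rel m (K (Suc t)) (s N (Suc t))" if "N \<ge> max m' N0" for N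
        using m'[OF N0[of N], of N] step[OF _ N0[of N]] that Suc.prems by simp
      then show ?case by blast
    qed
    have final: "lab (K T) = final_label D" using acc(1) K(2) by (simp add: accepting_def)
    define out where "out N = snd (lookup bl (fst (snd (s N T))) (0, 0))" for N
    have out: "codes_prefix (out N) q \<and> m \<le> length (out N)" if "gtm_rel m (K T) (s N T)" for m N
    proof -
      have "cell_rel m (Val (Seq q)) (lookup bl (fst (snd (s N T))) (0, 0))"
        using that acc(2) K(2) by (metis gtm_rel_def)
      then show ?thesis by (simp add: out_def)
    qed
    have st_s: "st (N, history letter_code p n (Suc N)) =
        (if fst (s N N) = lcode (final_label D) then snd (lookup bl (fst (snd (s N N))) (0, 0)) else [])" for N
      by (simp add: st_def s_def del: history.simps)
    have st_eq: "st (N, history letter_code p n (Suc N)) =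
        (if T \<le> N \<and> fst (s N T) = lcode (final_label D) then out N else [])" for N
    proof (cases "T \<le> N")
      case True
      have "fst (s N T) = 0 \<or> fst (s N T) = lcode (final_label D)"
        using sound[of T N] final by (auto simp: gtm_rel_def)
      then have "s N N = s N T" using stays[of N T N] not_0 not_final True by auto
      then show ?thesis using True unfolding st_s by (simp add: out_def)
    next
      case False
      have "fst (s N N) \<noteq> lcode (final_label D)"
      proof (cases "fst (s N N) = 0")
        case True
        then show ?thesis using lcode(2)[of "final_label D"] by simp
      next
        case nz: False
        then have "gtm_rel 0 (K N) (s N N)" using sound[of N N] False by simp
        moreover from this have "lcode (lab (K N)) \<in> lcode ` inner" using step[of N 0 N] False by simp
        ultimately show ?thesis using not_final by (metis gtm_rel_def)
      qed
      then show ?thesis using False unfolding st_s by simp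
    qed
    define len where "len N = length (st (N, history letter_code p n (Suc N)))" for N
    have "codes_prefix (st (N, history letter_code p n (Suc N))) q" for N
    proof (cases "T \<le> N \<and> fst (s N T) = lcode (final_label D)")
      case True
      then have "gtm_rel 0 (K T) (s N T)" using sound[of T N] lcode(2)[of "final_label D"] by auto
      then show ?thesis using out True unfolding st_eq by simp
    next
      case False
      then show ?thesis unfolding st_eq by (simp only: if_False) (simp add: codes_prefix_def)
    qed
    then have "st (N, history letter_code p n (Suc N)) = map (\<lambda>j. letter_code (q j)) [0..<len N]" for N
      by (intro nth_equalityI) (simp_all add: len_def codes_prefix_def del: history.simps)
    moreover have "\<exists>N0. \<forall>N\<ge>N0. j \<le> len N" for j
    proof -
      obtain N0 where N0: "\<And>N. N \<ge> N0 \<Longrightarrow> gtm_rel j (K T) (s N T)" using converges[of T j] by blast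
      have "j \<le> len N" if "N \<ge> max N0 T" for N
        using N0[of N] out[OF N0[of N]] that final unfolding len_def st_eq by (auto simp: gtm_rel_def)
      then show ?thesis by blast
    qed
    ultimately show ?thesis unfolding xs_eq by (rule U(2))
  qed
  then show ?thesis using U(1) unfolding n_def by blast
qed

end

section \<open>The simulation theorem\<close>

lemma realizes_comp:
  assumes "realizes (map \<gamma> is) \<gamma>0 h f" "realizes (map \<delta> is) \<delta>0 f g"
  shows "realizes (map (\<lambda>i. \<delta> i \<odot> \<gamma> i) is) (\<delta>0 \<odot> \<gamma>0) h g"
  unfolding realizes_def
proof (intro allI impI, elim conjE)
  fix xs vs assume vs: "vs \<in> prod_rep (map (\<lambda>i. \<delta> i \<odot> \<gamma> i) is) xs" and ne: "g vs \<noteq> {}"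
  have len: "length xs = length is" "length vs = length is" using vs by (auto simp: in_prod_rep_iff)
  have "\<exists>y. y \<in> \<gamma> (is ! j) (xs ! j) \<and> vs ! j \<in> \<delta> (is ! j) y" if "j < length is" for j
    using vs that by (auto simp: in_prod_rep_iff rel_comp_def)
  then obtain y where y: "\<And>j. j < length is \<Longrightarrow>
      y j \<in> \<gamma> (is ! j) (xs ! j) \<and> vs ! j \<in> \<delta> (is ! j) (y j)" by metis
  let ?ys = "map y [0..<length is]"
  have "?ys \<in> prod_rep (map \<gamma> is) xs" "vs \<in> prod_rep (map \<delta> is) ?ys"
    using y len by (auto simp: in_prod_rep_iff)
  then have "f ?ys \<noteq> {}" "\<And>y0. y0 \<in> f ?ys \<Longrightarrow> g vs \<inter> \<delta>0 y0 \<noteq> {}"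
    and "h xs \<noteq> {}" "\<And>x0. x0 \<in> h xs \<Longrightarrow> f ?ys \<inter> \<gamma>0 x0 \<noteq> {}"
    using assms ne unfolding realizes_def by blast+
  then show "h xs \<noteq> {} \<and> (\<forall>x0\<in>h xs. g vs \<inter> (\<delta>0 \<odot> \<gamma>0) x0 \<noteq> {})"
    unfolding rel_comp_def by fast
qed

text \<open>
  A computable realization may be replaced by its Turing computable extension since both are
  single-valued: where the realization is defined, they agree.
\<close>

lemma rep_computable_machine:
  assumes "rep_computable Us U0 \<beta>s \<beta>0 g"
  obtains F T where "wf_t2 (length Us) T" "realizes \<beta>s \<beta>0 F g"
    "\<And>ps x. x \<in> F ps \<Longrightarrow> ps \<in> listset Us \<and> x \<in> t2_result T ps \<inter> U0"
proof -
  from assms obtain f where f1: "computable Us U0 f" "realizes \<beta>s \<beta>0 f g"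
    unfolding rep_computable_def by blast
  then obtain F where F1: "turing_computable Us U0 F" and f: "\<And>ps. f ps \<subseteq> F ps"
    unfolding computable_def by blast
  then obtain T where F: "partial_fun (listset Us) U0 F"
    and T: "wf_t2 (length Us) T" "\<And>ps. ps \<in> listset Us \<Longrightarrow> F ps = t2_result T ps \<inter> U0"
    unfolding turing_computable_def by meson
  have dom: "ps \<in> listset Us" if "x \<in> F ps" for ps x
    using F[unfolded partial_fun_def multifun_def] that by auto
  have unique: "x = y" if "x \<in> F ps" "y \<in> F ps" for x y ps
    using F[unfolded partial_fun_def] that by auto
  have eq: "F ps = f ps" if "f ps \<noteq> {}" for ps
    using f[of ps] unique[of _ ps] that by auto
  have "realizes \<beta>s \<beta>0 F g"
    unfolding realizes_def
  proof (intro allI impI)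
    fix xs vs assume "vs \<in> prod_rep \<beta>s xs \<and> g vs \<noteq> {}"
    then have "f xs \<noteq> {} \<and> (\<forall>x0\<in>f xs. g vs \<inter> \<beta>0 x0 \<noteq> {})"
      using f1(2) unfolding realizes_def by blast
    then show "F xs \<noteq> {} \<and> (\<forall>x0\<in>F xs. g vs \<inter> \<beta>0 x0 \<noteq> {})"
      using eq[of xs] by simp
  qed
  moreover have "ps \<in> listset Us \<and> x \<in> t2_result T ps \<inter> U0" if "x \<in> F ps" for ps x
    using T(2)[OF dom[OF that]] dom[OF that] that by simp
  ultimately show ?thesis using that T(1) by blast
qed

lemma listset_omega: "ps \<in> listset (map (\<lambda>_. sigma_omega) js) \<Longrightarrow> set ps \<subseteq> sigma_omega"
  by (auto simp: in_listset_iff list_all2_conv_all_nth in_set_conv_nth)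

text \<open>
  Via \<open>\<gamma>\<close>, each statement of \<open>M\<close> is realized by a statement whose function is computed by a
  Type-2 machine.
\<close>

lemma exists_t2_stmt:
  fixes M :: "('l, 'g, 'y, 's::{finite, zero_neq_one}) gtm" and D :: "('l, 'g, 's elem, 's) gtm"
  assumes wf: "wf_stmt M s" and repl: "stmt_replacement Y \<gamma> \<delta> s0 s"
    and D: "labels D = labels M" "gamma D = gamma M"
  shows "\<exists>s'. stmt_realizes \<gamma> s' s \<and> t2_stmt D s'"
  using repl
proof cases
  case (5 i js f g l)
  then have "rep_computable (map (\<lambda>_. sigma_omega) js) sigma_omega (map \<gamma> js) (\<gamma> i) g"
    by (simp add: assign_realization_def)
  then obtain F T where T: "wf_t2 (length (map (\<lambda>_. sigma_omega :: 's elem set) js)) T" and F: "realizes (map \<gamma> js) (\<gamma> i) F g"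
    "\<And>ps x. x \<in> F ps \<Longrightarrow> ps \<in> listset (map (\<lambda>_. sigma_omega) js) \<and> x \<in> t2_result T ps \<inter> sigma_omega"
    by (rule rep_computable_machine) blast
  have "\<forall>ps. \<forall>x\<in>F ps. set ps \<subseteq> sigma_omega \<and> x \<in> t2_result T ps \<inter> sigma_omega"
    using F(2) listset_omega by blast
  moreover have "l \<in> labels D" using wf 5 D by simp
  ultimately have "t2_stmt D (Assign i F js l)"
    unfolding t2_stmt.simps using T[unfolded length_map] by blast
  moreover have "stmt_realizes \<gamma> (Assign i F js l) s"
    unfolding 5(2) by (rule stmt_realizes.intros(5)[OF F(1)])
  ultimately show ?thesis by blast
next
  case (6 js f g l l')
  then have "rep_computable (map (\<lambda>_. sigma_omega) js) sigma_star (map \<gamma> js) id_star g"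
    by (simp add: test_realization_def)
  then obtain F T where T: "wf_t2 (length (map (\<lambda>_. sigma_omega :: 's elem set) js)) T" and F: "realizes (map \<gamma> js) id_star F g"
    "\<And>ps x. x \<in> F ps \<Longrightarrow> ps \<in> listset (map (\<lambda>_. sigma_omega) js) \<and> x \<in> t2_result T ps \<inter> sigma_star"
    by (rule rep_computable_machine) blast
  have "\<forall>ps. \<forall>x\<in>F ps. set ps \<subseteq> sigma_omega \<and> x \<in> t2_result T ps"
    using F(2) listset_omega by blast
  moreover have "l \<in> labels D" "l' \<in> labels D" using wf 6 D by simp_all
  ultimately have "t2_stmt D (Test F js l l')"
    unfolding t2_stmt.simps using T[unfolded length_map] by blast
  moreover have "\<forall>a\<in>g xs. \<forall>b\<in>g xs. a = b" for xs
    using 6 wf by (auto simp: partial_fun_def)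
  then have "stmt_realizes \<gamma> (Test F js l l') s"
    unfolding 6(2) by (rule stmt_realizes.intros(6)[OF F(1)])
  ultimately show ?thesis by blast
qed (use wf D in \<open>auto intro: stmt_realizes.intros\<close>)

text \<open>
  The function of a machine whose parts are deterministic is single-valued because each of its
  values is the unique sequence that the simulating Type-2 machine writes.
\<close>

lemma gtm_fun_computable:
  fixes D :: "('l, 'g, 's elem, 's::{finite, zero_neq_one}) gtm"
  assumes D: "t2_gtm D"
  shows "computable (replicate (num_inputs D) sigma_omega) sigma_omega (gtm_fun D)"
proof -
  let ?Us = "replicate (num_inputs D) (sigma_omega :: 's elem set)"
  have fin: "finite (labels D)" "finite (gamma D)" using D by (auto simp: t2_gtm_def)
  obtain f :: "'l \<Rightarrow> nat" where f: "inj_on f (labels D)"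
    using finite_imp_inj_to_nat_seg[OF fin(1)] by blast
  obtain g :: "'g \<Rightarrow> nat" where g: "inj_on g (gamma D)"
    using finite_imp_inj_to_nat_seg[OF fin(2)] by blast
  interpret gtm_simulation D "\<lambda>l. Suc (f l)" g
    by unfold_locales (use D f g in \<open>auto simp: inj_on_def\<close>)
  obtain U where U: "wf_t2 (num_inputs D) U" "\<And>xs q. Seq q \<in> gtm_fun D xs \<Longrightarrow> Seq q \<in> t2_result U xs"
    using gtm_computable by blast
  have carr: "map (carr D) [1..<Suc (num_inputs D)] = ?Us"
    using D by (simp add: t2_gtm_def map_replicate_const)
  have dom: "x \<in> gtm_fun D xs \<Longrightarrow> xs \<in> listset ?Us \<and> x \<in> sigma_omega" for x xs
    using D unfolding gtm_fun_iff carr by (auto simp: accepting_def t2_gtm_def)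
  then have res: "x \<in> gtm_fun D xs \<Longrightarrow> x \<in> t2_result U xs \<inter> sigma_omega" for x xs
    using U(2) by (fastforce simp: sigma_omega_def)
  define F where "F xs = (if xs \<in> listset ?Us then t2_result U xs \<inter> sigma_omega else {})" for xs
  have "partial_fun (listset ?Us) sigma_omega F"
    by (auto simp: partial_fun_def multifun_def F_def sigma_omega_def dest: t2_result_Seq_unique)
  then have "turing_computable ?Us sigma_omega F"
    using U(1) by (auto simp: turing_computable_def F_def)
  moreover have "gtm_fun D xs \<subseteq> F xs" for xs using dom res by (auto simp: F_def)
  moreover have "partial_fun (listset ?Us) sigma_omega (gtm_fun D)"
    unfolding partial_fun_def multifun_def
    using dom res \<open>partial_fun (listset ?Us) sigma_omega F\<close> \<open>\<And>xs. gtm_fun D xs \<subseteq> F xs\<close>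
    unfolding partial_fun_def by blast
  ultimately show ?thesis unfolding computable_def by blast
qed

theorem theorem6p6:
  fixes P :: "('l, 'g, 'z, 's::{finite, zero_neq_one}) gtm"
    and M :: "('l, 'g, 'y, 's) gtm"
    and Y :: "nat \<Rightarrow> 'y set" and Z :: "nat \<Rightarrow> 'z set"
    and \<delta> :: "nat \<Rightarrow> 'y \<Rightarrow> 'z set"
    and \<gamma> :: "nat \<Rightarrow> 's elem \<Rightarrow> 'y set"
    and k L :: nat
  assumes P: "wf_gtm P" "num_inputs P = k" "last_tape P = L" "carr P = Z"
    and delta: "\<And>i. i \<le> L \<Longrightarrow> gen_multirep (Y i) (Z i) (\<delta> i)"
    and gamma: "\<And>i. i \<le> L \<Longrightarrow> multirep (Y i) (\<gamma> i)"
    and assigns: "\<And>l i f js l'. \<lbrakk>l \<in> labels P - {final_label P}; stm P l = Assign i f js l'\<rbrakk>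
          \<Longrightarrow> \<exists>g. assign_realization Y \<gamma> \<delta> i js f g"
    and tests: "\<And>l f js l' l''. \<lbrakk>l \<in> labels P - {final_label P}; stm P l = Test f js l' l''\<rbrakk>
          \<Longrightarrow> \<exists>g. test_realization Y \<gamma> \<delta> js f g"
    and M: "wf_gtm M" "carr M = Y" "gtm_replacement \<gamma> \<delta> P M"
  shows "rep_computable (replicate k sigma_omega) sigma_omega
           (map \<gamma> [1..<Suc k]) (\<gamma> 0) (gtm_fun M) \<and>
         realizes (map \<delta> [1..<Suc k]) (\<delta> 0) (gtm_fun M) (gtm_fun P) \<and>
         rep_computable (replicate k sigma_omega) sigma_omega
           (map (\<lambda>i. \<delta> i \<odot> \<gamma> i) [1..<Suc k]) (\<delta> 0 \<odot> \<gamma> 0) (gtm_fun P)"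
proof -
  have same: "labels M = labels P" "init_label M = init_label P" "final_label M = final_label P"
    "blank M = blank P" "num_inputs M = k" "k \<le> L"
    and repl: "\<And>l. l \<in> labels P - {final_label P} \<Longrightarrow> stmt_replacement Y \<gamma> \<delta> (stm P l) (stm M l)"
    using M(2,3) P by (auto simp: gtm_replacement_def wf_gtm_def)
  have wf: "wf_stmt P (stm P l)" "wf_stmt M (stm M l)" if "l \<in> labels P - {final_label P}" for l
    using P(1) M(1) that same by (auto simp: wf_gtm_def)
  have "stmt_realizes \<delta> (stm M l) (stm P l)" if "l \<in> labels P - {final_label P}" for l
    using repl[OF that]
    by cases (use wf(1)[OF that] in \<open>auto simp: assign_realization_def test_realization_def
        partial_fun_def intro!: stmt_realizes.intros\<close>)
  then have "gtm_realizes \<delta> M P"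
    using P M(1) same wf by (auto simp: gtm_realizes_def wf_gtm_def)
  from gtm_fun_realizes[OF this, of L]
  have b: "realizes (map \<delta> [1..<Suc k]) (\<delta> 0) (gtm_fun M) (gtm_fun P)"
    using same P M(2) delta by (simp add: gen_multirep_def)
  \<comment> \<open>The machine whose functions are the partial functions on sequences computed by the given
    Type-2 machines realizes \<open>M\<close> in the same way as \<open>M\<close> realizes \<open>P\<close>.\<close>
  define D0 :: "('l, 'g, 's elem, 's) gtm" where
    "D0 = \<lparr>labels = labels M, init_label = init_label M, final_label = final_label M,
       gamma = gamma M, blank = blank M, num_inputs = k, last_tape = L,
       carr = (\<lambda>_. sigma_omega), stm = undefined\<rparr>"
  have "\<forall>l \<in> labels M - {final_label M}. \<exists>s'. stmt_realizes \<gamma> s' (stm M l) \<and> t2_stmt D0 s'"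
  proof
    fix l assume "l \<in> labels M - {final_label M}"
    then have l: "l \<in> labels P - {final_label P}" using same by simp
    show "\<exists>s'. stmt_realizes \<gamma> s' (stm M l) \<and> t2_stmt D0 s'"
      by (rule exists_t2_stmt[OF wf(2)[OF l] repl[OF l]]) (simp_all add: D0_def)
  qed
  from bchoice[OF this] obtain st where
    st: "\<And>l. l \<in> labels M - {final_label M} \<Longrightarrow> stmt_realizes \<gamma> (st l) (stm M l) \<and> t2_stmt D0 (st l)"
    by blast
  define D where "D = D0\<lparr>stm := st\<rparr>"
  have fields: "labels D = labels M" "init_label D = init_label M" "final_label D = final_label M"
    "gamma D = gamma M" "blank D = blank M" "num_inputs D = k" "carr D = (\<lambda>_. sigma_omega)" "stm D = st"
    by (simp_all add: D_def D0_def)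
  have "t2_stmt D s \<longleftrightarrow> t2_stmt D0 s" for s
    by (cases s) (simp_all add: D_def)
  then have "t2_gtm D"
    using M(1) st by (auto simp: t2_gtm_def fields wf_gtm_def)
  then have comp: "computable (replicate k sigma_omega) sigma_omega (gtm_fun D)"
    using gtm_fun_computable[of D] by (simp add: fields)
  have "gtm_realizes \<gamma> D M"
    using M(1) st by (auto simp: gtm_realizes_def fields wf_gtm_def same(5))
  from gtm_fun_realizes[OF this, of L]
  have real: "realizes (map \<gamma> [1..<Suc k]) (\<gamma> 0) (gtm_fun D) (gtm_fun M)"
    using same M(2) gamma by (simp add: fields multirep_def gen_multirep_def)
  have "rep_computable (replicate k sigma_omega) sigma_omega (map \<gamma> [1..<Suc k]) (\<gamma> 0) (gtm_fun M)"
    using comp real by (auto simp: rep_computable_def simp del: upt_Suc)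
  moreover have "rep_computable (replicate k sigma_omega) sigma_omega
           (map (\<lambda>i. \<delta> i \<odot> \<gamma> i) [1..<Suc k]) (\<delta> 0 \<odot> \<gamma> 0) (gtm_fun P)"
    using comp realizes_comp[OF real b] by (auto simp: rep_computable_def simp del: upt_Suc)
  ultimately show ?thesis using b by blast
qed

end
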